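(* Consider the initial-boundary value problem (P) described in the context. Assume that $\lambda_i$ and $f_i$ are continuous, $\lambda_i$ and $\varphi_i$ are $C^1$-smooth in $x$, $f_i$ are $C^1$-smooth in $x$ and $u$, and $h_i$ are $C^1$-smooth in both arguments $(t,v)$, for all $1\le i\le n$. Suppose that $\nabla_y f(x,t,y)$ is bounded on $K\times\mathbb{R}^n$ for every compact $K\subset\overline{\Pi}$, and that $\nabla_z h(t,z)$ is bounded on $K\times\mathbb{R}^n$ for every compact $K\subset[0,\infty)$. If the zero-order compatibility conditions and the first-order compatibility conditions (both stated in the context) are fulfilled, then problem (P) has a unique classical solution in $\Pi$.
   Context: Let $\Pi=\{(x,t)\mid 0<x<1,\ t>0\}$, and let $n\ge 1$ and $1\le k\le n$ be integers. The data are: real functions $\lambda_1,\dots,\lambda_n$ on $\overline{\Pi}$ with $\lambda_1,\dots,\lambda_k<0$ and $\lambda_{k+1},\dots,\lambda_n>0$ on $\overline{\Pi}$, and $\Lambda=\mathrm{diag}(\lambda_1,\dots,\lambda_n)$; a function $f=(f_1,\dots,f_n):\overline{\Pi}\times\mathbb{R}^n\to\mathbb{R}^n$; a function $\varphi=(\varphi_1,\dots,\varphi_n):[0,1]\to\mathbb{R}^n$; and a function $h=(h_1,\dots,h_n):[0,\infty)\times\mathbb{R}^n\to\mathbb{R}^n$. Problem (P): find $u=(u_1,\dots,u_n)$ with $$(\partial_t+\Lambda(x,t)\partial_x)u=f(x,t,u),\quad (x,t)\in\Pi,$$ $$u(x,0)=\varphi(x),\quad x\in(0,1),$$ $$u_i(0,t)=h_i(t,v(t)),\quad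 k+1\le i\le n,\ t\in(0,\infty),$$ $$u_i(1,t)=h_i(t,v(t)),\quad 1\le i\le k,\ t\in(0,\infty),$$ where $v(t)=(u_1(0,t),\dots,u_k(0,t),u_{k+1}(1,t),\dots,u_n(1,t))$. A classical solution in $\Pi$ is a function $u$ that is $C^1$ in both variables (up to the boundary, i.e. on $\overline{\Pi}$) and satisfies all equations of (P). "$C^1$-smooth in" certain variables means that the corresponding first-order partial derivatives exist and are continuous functions of all arguments, up to the boundary. $\nabla_y f(x,t,y)$ and $\nabla_z h(t,z)$ denote the derivatives of $f$ and $h$ in their $\mathbb{R}^n$-argument; likewise $\nabla_v h_i$ is the gradient of $h_i$ in its second argument. The dot $\cdot$ is the scalar product in $\mathbb{R}^n$. Put $v(0)=(\varphi_1(0),\dots,\varphi_k(0),\varphi_{k+1}(1),\dots,\varphi_n(1))$, and let $v'(0)\in\mathbb{R}^n$ be the vector whose $i$-th component is $f_i(0,0,\varphi(0))-\lambda_i(0,0)\varphi_i'(0)$ for $1\le i\le k$ and $f_i(1,0,\varphi(1))-\lambda_i(1,0)\varphi_i'(1)$ for $k+1\le i\le n$. Zero-order compatibility conditions: $\varphi_i(0)=h_i(0,v(0))$ for $k+1\le i\le n$, and $\varphi_i(1)=h_i(0,v(0))$ for $1\le i\le k$. First-order compatibility conditions: $f_i(0,0,\varphi(0))-\lambda_i(0,0)\varphi_i'(0)=\partial_t h_i(0,v(0))+\nabla_v h_i(0,v(0))\cdot v'(0)$ for $k+1\le i\le n$, and $f_i(1,0,\varphi(1))-\lambda_i(1,0)\varphi_i'(1)=\partial_t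 h_i(0,v(0))+\nabla_v h_i(0,v(0))\cdot v'(0)$ for $1\le i\le k$. *)

theory Defs
  imports "HOL-Analysis.Analysis"
begin

text \<open>
  Vectors of \<open>\<real>\<^sup>n\<close> have type \<open>real ^ 'n\<close>, so \<open>n = CARD('n) \<ge> 1\<close>. The index type carries no order;
  the map \<open>num :: 'n \<Rightarrow> nat\<close>, required to be a bijection onto \<open>{1..n}\<close>, numbers the components,
  so that \<open>num i \<le> k\<close> says that the component \<open>i\<close> is one of the first \<open>k\<close>.
\<close>

definition Pi_dom :: "(real \<times> real) set" where
  "Pi_dom = {0<..<1} \<times> {0<..}"

definition Pi_bar :: "(real \<times> real) set" where
  "Pi_bar = {0..1} \<times> {0..}"

text \<open>Derivatives are taken relative to the closed domain, hence one-sided at its boundary.\<close>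

definition dx :: "(real \<Rightarrow> real \<Rightarrow> 'b::real_normed_vector) \<Rightarrow> real \<Rightarrow> real \<Rightarrow> 'b" where
  "dx u x t = vector_derivative (\<lambda>\<xi>. u \<xi> t) (at x within {0..1})"

definition dt :: "(real \<Rightarrow> real \<Rightarrow> 'b::real_normed_vector) \<Rightarrow> real \<Rightarrow> real \<Rightarrow> 'b" where
  "dt u x t = vector_derivative (\<lambda>\<tau>. u x \<tau>) (at t within {0..})"

text \<open>
  \<open>C1_in S P g\<close>: the partial derivative of \<open>g\<close> in its first argument, which ranges over \<open>S\<close>, exists
  and is continuous in all arguments on \<open>S \<times> P\<close>.
\<close>

definition C1_in ::
  "real set \<Rightarrow> 'p::topological_space set \<Rightarrow> (real \<Rightarrow> 'p \<Rightarrow> 'b::real_normed_vector) \<Rightarrow> bool" where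
  "C1_in S P g \<longleftrightarrow>
     (\<forall>p\<in>P. (\<lambda>s. g s p) differentiable_on S) \<and>
     continuous_on (S \<times> P) (\<lambda>(s, p). vector_derivative (\<lambda>\<sigma>. g \<sigma> p) (at s within S))"

definition grad :: "(real ^ 'n \<Rightarrow> real) \<Rightarrow> real ^ 'n \<Rightarrow> real ^ 'n" where
  "grad F y = (\<chi> j. deriv (\<lambda>s. F (y + s *\<^sub>R axis j 1)) 0)"

text \<open>Analogue of \<open>C1_in\<close> for all partial derivatives in an argument ranging over \<open>\<real>\<^sup>n\<close>.\<close>

definition C1_in_vec ::
  "'p::topological_space set \<Rightarrow> ('p \<Rightarrow> real ^ 'n \<Rightarrow> real) \<Rightarrow> bool" where
  "C1_in_vec P F \<longleftrightarrow>
     (\<forall>p\<in>P. \<forall>y j. (\<lambda>s. F p (y + s *\<^sub>R axis j 1)) differentiable (at 0)) \<and>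
     continuous_on (P \<times> UNIV) (\<lambda>(p, y). grad (F p) y)"

text \<open>
  The vector \<open>(a\<^sub>1, \<dots>, a\<^sub>k, b\<^sub>k\<^sub>+\<^sub>1, \<dots>, b\<^sub>n)\<close>. With \<open>a\<close> and \<open>b\<close> the values at \<open>x = 0\<close> and \<open>x = 1\<close> it gives
  \<open>v(t)\<close>, \<open>v(0)\<close> and \<open>v'(0)\<close>.
\<close>

definition glue :: "('n \<Rightarrow> nat) \<Rightarrow> nat \<Rightarrow> real ^ 'n \<Rightarrow> real ^ 'n \<Rightarrow> real ^ 'n" where
  "glue num k a b = (\<chi> i. if num i \<le> k then a $ i else b $ i)"

definition classical_solution ::
  "('n::finite \<Rightarrow> nat) \<Rightarrow> nat \<Rightarrow> (real \<Rightarrow> real \<Rightarrow> real ^ 'n) \<Rightarrow>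
   (real \<Rightarrow> real \<Rightarrow> real ^ 'n \<Rightarrow> real ^ 'n) \<Rightarrow> (real \<Rightarrow> real ^ 'n) \<Rightarrow>
   (real \<Rightarrow> real ^ 'n \<Rightarrow> real ^ 'n) \<Rightarrow> (real \<Rightarrow> real \<Rightarrow> real ^ 'n) \<Rightarrow> bool" where
  "classical_solution num k lam f phi h u \<longleftrightarrow>
     C1_in {0..1} {0..} u \<and>
     C1_in {0..} {0..1} (\<lambda>t x. u x t) \<and>
     (\<forall>(x, t)\<in>Pi_dom. \<forall>i. dt u x t $ i + lam x t $ i * dx u x t $ i = f x t (u x t) $ i) \<and>
     (\<forall>x\<in>{0<..<1}. u x 0 = phi x) \<and>
     (\<forall>t\<in>{0<..}. \<forall>i. k + 1 \<le> num i \<longrightarrow> u 0 t $ i = h t (glue num k (u 0 t) (u 1 t)) $ i) \<and>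
     (\<forall>t\<in>{0<..}. \<forall>i. num i \<le> k \<longrightarrow> u 1 t $ i = h t (glue num k (u 0 t) (u 1 t)) $ i)"

definition zero_order_compat ::
  "('n::finite \<Rightarrow> nat) \<Rightarrow> nat \<Rightarrow> (real \<Rightarrow> real ^ 'n) \<Rightarrow> (real \<Rightarrow> real ^ 'n \<Rightarrow> real ^ 'n) \<Rightarrow> bool" where
  "zero_order_compat num k phi h \<longleftrightarrow>
     (let v0 = glue num k (phi 0) (phi 1) in
       (\<forall>i. k + 1 \<le> num i \<longrightarrow> phi 0 $ i = h 0 v0 $ i) \<and>
       (\<forall>i. num i \<le> k \<longrightarrow> phi 1 $ i = h 0 v0 $ i))"

text \<open>The value of \<open>\<partial>\<^sub>t u(x, 0)\<close> which the system and the initial condition prescribe.\<close>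

definition initial_dt ::
  "(real \<Rightarrow> real \<Rightarrow> real ^ 'n) \<Rightarrow> (real \<Rightarrow> real \<Rightarrow> real ^ 'n \<Rightarrow> real ^ 'n) \<Rightarrow>
   (real \<Rightarrow> real ^ 'n) \<Rightarrow> real \<Rightarrow> real ^ 'n::finite" where
  "initial_dt lam f phi x =
     (\<chi> i. f x 0 (phi x) $ i - lam x 0 $ i * vector_derivative phi (at x within {0..1}) $ i)"

definition first_order_compat ::
  "('n::finite \<Rightarrow> nat) \<Rightarrow> nat \<Rightarrow> (real \<Rightarrow> real \<Rightarrow> real ^ 'n) \<Rightarrow>
   (real \<Rightarrow> real \<Rightarrow> real ^ 'n \<Rightarrow> real ^ 'n) \<Rightarrow> (real \<Rightarrow> real ^ 'n) \<Rightarrow>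
   (real \<Rightarrow> real ^ 'n \<Rightarrow> real ^ 'n) \<Rightarrow> bool" where
  "first_order_compat num k lam f phi h \<longleftrightarrow>
     (let v0 = glue num k (phi 0) (phi 1);
          v0' = glue num k (initial_dt lam f phi 0) (initial_dt lam f phi 1);
          rhs = (\<lambda>i. vector_derivative (\<lambda>t. h t v0) (at 0 within {0..}) $ i
                      + grad (\<lambda>z. h 0 z $ i) v0 \<bullet> v0')
      in (\<forall>i. k + 1 \<le> num i \<longrightarrow> initial_dt lam f phi 0 $ i = rhs i) \<and>
         (\<forall>i. num i \<le> k \<longrightarrow> initial_dt lam f phi 1 $ i = rhs i))"

end

theory Submission
  imports Defs
begin

text \<open>
  The solution is the limit of the iteration that freezes \<open>u\<close> in \<open>f\<close> and \<open>h\<close>: every step solves decoupled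
  scalar transport equations whose inflow data come from the previous outflow values. A scalar transport
  equation is solved along its characteristics; the trace on the inflow boundary is turned into initial data
  on a fictitious part of the initial line, where the compatibility conditions make the extended data \<open>C\<^sup>1\<close>.
  A maximum principle with a weight that decays in time and grows from the inflow to the outflow end of each
  component shows that the step is a contraction in the weighted sup norm on \<open>[0,1] \<times> [0,T]\<close> for every \<open>T\<close>.
  The same estimate gives uniqueness. The derivatives \<open>\<partial>\<^sub>x u\<close> of the iterates satisfy a linear recursion of
  the same type whose coefficients converge uniformly, hence they converge uniformly too.
\<close>

section \<open>Calculus\<close>

text \<open>Decay in time alone cannot give the contraction: the inflow value at time
  \<open>t\<close> depends on outflow values at the same \<open>t\<close>, with a factor
  \<open>H\<close> of any size. The spatial growth of the weight supplies what is missing: the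
  weight is smaller by the factor \<open>exp (- a)\<close> at the inflow end than at the outflow
  end. So \<open>a\<close> is chosen from \<open>H\<close>, and then \<open>M\<close> from
  \<open>a\<close>. The gradients of \<open>f\<close> and \<open>h\<close> are bounded for all
  values of the unknown, so these constants depend on \<open>T\<close> but not on the iterates; this
  makes the solution global. The iterates are only C1, so the differentiated equation is available
  only along characteristics, and the maximum principle is stated so that it asks for no more. The
  gradients of \<open>f\<close> and \<open>h\<close> are merely continuous in the unknown, hence the
  coefficients in the recursion for the derivatives converge without a rate. There the estimate is a
  contraction up to an error that tends to 0, applied to the differences of iterates
  \<open>m + k\<close> and \<open>m\<close> and not only of consecutive ones. Every step needs
  compatible data again; prescribing the time derivative of each iterate at the two corners ensures
  this.\<close>

lemma grad_component_deriv:
  fixes F :: "real ^ 'n::finite \<Rightarrow> real"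
  assumes "\<And>y j. (\<lambda>s. F (y + s *\<^sub>R axis j 1)) differentiable (at 0)"
  shows "((\<lambda>s. F (y + s *\<^sub>R axis j 1)) has_real_derivative grad F (y + s *\<^sub>R axis j 1) $ j) (at s)"
proof -
  have "((\<lambda>r. F ((y + s *\<^sub>R axis j 1) + r *\<^sub>R axis j 1)) has_real_derivative
      grad F (y + s *\<^sub>R axis j 1) $ j) (at 0)"
    using assms[of "y + s *\<^sub>R axis j 1" j]
    by (simp add: grad_def DERIV_deriv_iff_real_differentiable)
  then have "((\<lambda>r. F (y + (r + s) *\<^sub>R axis j 1)) has_real_derivative
      grad F (y + s *\<^sub>R axis j 1) $ j) (at 0)"
    by (simp add: algebra_simps)
  then show ?thesis
    using DERIV_shift[of "\<lambda>r. F (y + r *\<^sub>R axis j 1)" _ 0 s] by (simp add: algebra_simps)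
qed

lemma grad_component_mvt:
  fixes F :: "real ^ 'n::finite \<Rightarrow> real"
  assumes d: "\<And>y j. (\<lambda>s. F (y + s *\<^sub>R axis j 1)) differentiable (at 0)"
  shows "\<exists>r. \<bar>r\<bar> \<le> \<bar>s\<bar> \<and> F (y + s *\<^sub>R axis j 1) - F y = s * grad F (y + r *\<^sub>R axis j 1) $ j"
proof -
  note D = grad_component_deriv[OF d, of y j]
  consider "s = 0" | "s > 0" | "s < 0" by linarith
  then show ?thesis
  proof cases
    case 1 then show ?thesis by auto
  next
    case 2
    obtain z where "0 < z" "z < s"
      "F (y + s *\<^sub>R axis j 1) - F (y + 0 *\<^sub>R axis j 1) = (s - 0) * grad F (y + z *\<^sub>R axis j 1) $ j"
      using MVT2[OF 2, of "\<lambda>s. F (y + s *\<^sub>R axis j 1)" "\<lambda>s. grad F (y + s *\<^sub>R axis j 1) $ j"] D by blast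
    then show ?thesis by (intro exI[of _ z]) auto
  next
    case 3
    obtain z where "s < z" "z < 0"
      "F (y + 0 *\<^sub>R axis j 1) - F (y + s *\<^sub>R axis j 1) = (0 - s) * grad F (y + z *\<^sub>R axis j 1) $ j"
      using MVT2[OF 3, of "\<lambda>s. F (y + s *\<^sub>R axis j 1)" "\<lambda>s. grad F (y + s *\<^sub>R axis j 1) $ j"] D by blast
    then show ?thesis by (intro exI[of _ z]) (auto simp: algebra_simps)
  qed
qed

text \<open>Continuous partial derivatives give Frechet differentiability. The increment is split by
  moving one coordinate after the other, by induction on the set \<open>J\<close> of coordinates
  already moved, with the mean value theorem for each of them.\<close>

lemma has_derivative_grad:
  fixes F :: "real ^ 'n::finite \<Rightarrow> real"
  assumes d: "\<And>y j. (\<lambda>s. F (y + s *\<^sub>R axis j 1)) differentiable (at 0)"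
    and c: "continuous_on UNIV (grad F)"
  shows "(F has_derivative (\<lambda>h. grad F y \<bullet> h)) (at y)"
  unfolding has_derivative_at_alt
proof (intro conjI allI impI)
  show "bounded_linear ((\<bullet>) (grad F y))" by (rule bounded_linear_inner_right)
  fix e :: real assume e: "e > 0"
  define n where "n = real CARD('n)"
  have n: "n > 0" by (simp add: n_def)
  have "isCont (grad F) y" using c by (simp add: continuous_on_eq_continuous_at)
  then obtain d0 where d0: "d0 > 0" "\<And>z. dist z y < d0 \<Longrightarrow> dist (grad F z) (grad F y) < e / n"
    unfolding continuous_at_eps_delta using divide_pos_pos[OF e n] by blast
  show "\<exists>d>0. \<forall>z. norm (z - y) < d \<longrightarrow> norm (F z - F y - grad F y \<bullet> (z - y)) \<le> e * norm (z - y)"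
  \<comment> \<open>All points of the coordinatewise path, and the mean value points on it, have
    distance from \<open>y\<close> at most the sum of the \<open>\<bar>h $ i\<bar>\<close>, hence at
    most \<open>n * norm h\<close>; the radius \<open>d0 / n\<close> keeps them where
    \<open>grad F\<close> varies by less than \<open>e / n\<close>.\<close>
  proof (intro exI[of _ "d0 / n"] conjI allI impI)
    show "d0 / n > 0" using d0 n by simp
    fix z assume z: "norm (z - y) < d0 / n"
    define h where "h = z - y"
    have Kn: "(\<Sum>i\<in>UNIV. \<bar>h $ i\<bar>) \<le> n * norm h"
      using sum_bounded_above[of UNIV "\<lambda>i. \<bar>h $ i\<bar>" "norm h"] component_le_norm_cart[of h]
      by (simp add: n_def)
    have Kd: "(\<Sum>i\<in>UNIV. \<bar>h $ i\<bar>) < d0"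
    proof -
      have "n * norm h < d0" using z n by (simp add: h_def pos_less_divide_eq mult.commute)
      then show ?thesis using Kn by linarith
    qed
    have "\<bar>F (y + (\<Sum>i\<in>J. (h $ i) *\<^sub>R axis i 1)) - F y - (\<Sum>i\<in>J. h $ i * grad F y $ i)\<bar>
        \<le> e / n * (\<Sum>i\<in>J. \<bar>h $ i\<bar>)" for J :: "'n set"
      using finite[of J]
    proof (induction J rule: finite_induct)
      case (insert j J)
      let ?w = "\<Sum>i\<in>J. (h $ i) *\<^sub>R axis i (1::real)"
      obtain r where r: "\<bar>r\<bar> \<le> \<bar>h $ j\<bar>"
        "F (y + ?w + (h $ j) *\<^sub>R axis j 1) - F (y + ?w) = h $ j * grad F (y + ?w + r *\<^sub>R axis j 1) $ j"
        using grad_component_mvt[OF d] by blast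
      have "norm (?w + r *\<^sub>R axis j 1) \<le> (\<Sum>i\<in>J. norm ((h $ i) *\<^sub>R axis i (1::real))) + norm (r *\<^sub>R axis j (1::real) :: real^'n)"
        by (intro norm_triangle_le add_mono norm_sum order_refl)
      also have "\<dots> \<le> (\<Sum>i\<in>J. \<bar>h $ i\<bar>) + \<bar>h $ j\<bar>"
        using r(1) by (simp add: norm_axis_1)
      also have "\<dots> = (\<Sum>i\<in>insert j J. \<bar>h $ i\<bar>)" using insert by simp
      also have "\<dots> \<le> (\<Sum>i\<in>UNIV. \<bar>h $ i\<bar>)" by (rule sum_mono2) auto
      finally have "dist (y + ?w + r *\<^sub>R axis j 1) y < d0" using Kd
        by (simp add: dist_norm add.assoc)
      from d0(2)[OF this] have "norm (grad F (y + ?w + r *\<^sub>R axis j 1) - grad F y) < e / n"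
        by (simp add: dist_norm)
      then have "\<bar>grad F (y + ?w + r *\<^sub>R axis j 1) $ j - grad F y $ j\<bar> \<le> e / n"
        using component_le_norm_cart[of "grad F (y + ?w + r *\<^sub>R axis j 1) - grad F y" j]
        unfolding vector_minus_component by linarith
      then have "\<bar>h $ j * (grad F (y + ?w + r *\<^sub>R axis j 1) $ j - grad F y $ j)\<bar> \<le> e / n * \<bar>h $ j\<bar>"
        unfolding abs_mult mult.commute[of "e / n"] by (intro mult_left_mono) auto
      then have *: "\<bar>F (y + ?w + (h $ j) *\<^sub>R axis j 1) - F (y + ?w) - h $ j * grad F y $ j\<bar> \<le> e / n * \<bar>h $ j\<bar>"
        unfolding r(2) right_diff_distrib .
      have eq: "y + (\<Sum>i\<in>insert j J. (h $ i) *\<^sub>R axis i (1::real)) = y + ?w + (h $ j) *\<^sub>R axis j 1"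
        using insert by (simp add: add_ac)
      have s1: "(\<Sum>i\<in>insert j J. h $ i * grad F y $ i) = h $ j * grad F y $ j + (\<Sum>i\<in>J. h $ i * grad F y $ i)"
        and s2: "e / n * (\<Sum>i\<in>insert j J. \<bar>h $ i\<bar>) = e / n * \<bar>h $ j\<bar> + e / n * (\<Sum>i\<in>J. \<bar>h $ i\<bar>)"
        using insert.hyps by (simp_all add: distrib_left)
      show ?case unfolding eq s1 s2 using * insert.IH by linarith
    qed simp
    from this[of UNIV] have "\<bar>F (y + h) - F y - grad F y \<bullet> h\<bar> \<le> e / n * (\<Sum>i\<in>UNIV. \<bar>h $ i\<bar>)"
    proof -
      have "(\<Sum>i\<in>UNIV. (h $ i) *\<^sub>R axis i (1::real)) = h"
        using basis_expansion[of h] by (simp only: scalar_mult_eq_scaleR)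
      moreover have "(\<Sum>i\<in>UNIV. h $ i * grad F y $ i) = grad F y \<bullet> h"
        unfolding inner_vec_def by (intro sum.cong) auto
      ultimately show "\<bar>F (y + (\<Sum>i\<in>UNIV. (h $ i) *\<^sub>R axis i 1)) - F y - (\<Sum>i\<in>UNIV. h $ i * grad F y $ i)\<bar>
        \<le> e / n * (\<Sum>i\<in>UNIV. \<bar>h $ i\<bar>) \<Longrightarrow> ?thesis" by simp
    qed
    also have "\<dots> \<le> e / n * (n * norm h)" using Kn e n by (intro mult_left_mono) auto
    finally show "norm (F z - F y - grad F y \<bullet> (z - y)) \<le> e * norm (z - y)"
      using n by (simp add: h_def)
  qed
qed

lemma grad_lipschitz:
  fixes F :: "real ^ 'n::finite \<Rightarrow> real"
  assumes d: "\<And>y j. (\<lambda>s. F (y + s *\<^sub>R axis j 1)) differentiable (at 0)"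
    and c: "continuous_on UNIV (grad F)" and B: "\<And>y. norm (grad F y) \<le> B"
  shows "\<bar>F y - F z\<bar> \<le> B * norm (y - z)"
proof -
  have "norm (F y - F z) \<le> B * norm (y - z)"
  proof (rule differentiable_bound[of UNIV F "\<lambda>y h. grad F y \<bullet> h"])
    fix x show "(F has_derivative (\<bullet>) (grad F x)) (at x within UNIV)"
      using has_derivative_grad[OF d c] by simp
    show "onorm ((\<bullet>) (grad F x)) \<le> B"
    proof (rule onorm_le)
      fix h show "norm (grad F x \<bullet> h) \<le> B * norm h"
        using Cauchy_Schwarz_ineq2[of "grad F x" h] mult_right_mono[OF B[of x] norm_ge_zero[of h]] by simp
    qed
  qed auto
  then show ?thesis by simp
qed

text \<open>Joint differentiability at a point needs one partial derivative at that point only and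
  the other one nearby and continuous. The gradient plays the first role and the scalar derivative
  \<open>Fs\<close> the second, which is why the pair is ordered as \<open>(y, r)\<close>.\<close>

lemma has_derivative_chain_scalar_grad:
  fixes F :: "real \<Rightarrow> real ^ 'n::finite \<Rightarrow> real"
  assumes S: "convex S" "s \<in> S"
    and ds: "\<And>r y. r \<in> S \<Longrightarrow> ((\<lambda>r. F r y) has_real_derivative Fs r y) (at r within S)"
    and cs: "continuous_on (S \<times> UNIV) (\<lambda>(r, y). Fs r y)"
    and d: "\<And>y j. (\<lambda>r. F s (y + r *\<^sub>R axis j 1)) differentiable (at 0)"
    and cg: "continuous_on UNIV (grad (F s))"
    and c: "(c has_vector_derivative c') (at s within S)"
  shows "((\<lambda>r. F r (c r)) has_real_derivative Fs s (c s) + grad (F s) (c s) \<bullet> c') (at s within S)"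
proof -
  have D: "((\<lambda>(y, r). F r y) has_derivative
      (\<lambda>(ty, tr). grad (F s) (c s) \<bullet> ty + blinfun_apply (blinfun_scaleR_left (Fs s (c s))) tr))
      (at (c s, s) within UNIV \<times> S)"
  proof (rule has_derivative_partialsI)
    show "((\<lambda>y. F s y) has_derivative (\<bullet>) (grad (F s) (c s))) (at (c s) within UNIV)"
      using has_derivative_grad[OF d cg] by simp
    show "((\<lambda>r. F r y) has_derivative blinfun_apply (blinfun_scaleR_left (Fs r y))) (at r within S)"
      if "r \<in> S" for y r
      using ds[OF that, of y] unfolding has_field_derivative_def
      by (rule has_derivative_eq_rhs) auto
    have "continuous_on (UNIV \<times> S) (\<lambda>(y, r). blinfun_scaleR_left (Fs r y))"
    proof -
      have "continuous_on (UNIV \<times> S) (\<lambda>p. (\<lambda>(r, y). Fs r y) (snd p, fst p))"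
        by (rule continuous_on_compose2[OF cs]) (auto intro!: continuous_intros)
      then show ?thesis
        unfolding split_beta by (auto intro!: continuous_intros)
    qed
    then show "continuous (at (c s, s) within UNIV \<times> S) (\<lambda>(y, r). blinfun_scaleR_left (Fs r y))"
      using S by (simp add: continuous_on_eq_continuous_within)
  qed (use S in auto)
  have G: "((\<lambda>r. (c r, r)) has_derivative (\<lambda>t. (t *\<^sub>R c', t))) (at s within S)"
    using c by (auto intro!: derivative_eq_intros simp: has_vector_derivative_def)
  have "((\<lambda>r. (\<lambda>(y, r). F r y) (c r, r)) has_derivative
     (\<lambda>t. (\<lambda>(ty, tr). grad (F s) (c s) \<bullet> ty + blinfun_apply (blinfun_scaleR_left (Fs s (c s))) tr) (t *\<^sub>R c', t)))
      (at s within S)"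
    using S by (intro has_derivative_in_compose[OF G] has_derivative_subset[OF D]) auto
  then have "((\<lambda>r. F r (c r)) has_derivative
     (\<lambda>t. grad (F s) (c s) \<bullet> (t *\<^sub>R c') + t * Fs s (c s))) (at s within S)"
    by simp
  then show ?thesis
    unfolding has_field_derivative_def
    by (rule has_derivative_eq_rhs) (auto simp: algebra_simps)
qed

lemma has_derivative_partials_vector:
  fixes u :: "real \<Rightarrow> real \<Rightarrow> 'b::real_normed_vector"
  assumes B: "convex B" and xt: "x \<in> A" "t \<in> B"
    and p: "((\<lambda>x. u x t) has_vector_derivative p) (at x within A)"
    and q: "\<And>x t. x \<in> A \<Longrightarrow> t \<in> B \<Longrightarrow> ((\<lambda>t. u x t) has_vector_derivative q x t) (at t within B)"
    and qc: "continuous_on (A \<times> B) (\<lambda>(x, t). q x t)"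
  shows "((\<lambda>(x, t). u x t) has_derivative (\<lambda>(a, b). a *\<^sub>R p + b *\<^sub>R q x t)) (at (x, t) within A \<times> B)"
proof -
  have "((\<lambda>(x, t). u x t) has_derivative (\<lambda>(a, b). a *\<^sub>R p + blinfun_apply (blinfun_scaleR_left (q x t)) b))
      (at (x, t) within A \<times> B)"
  proof (rule has_derivative_partialsI)
    have "continuous_on (A \<times> B) (\<lambda>(x, t). blinfun_scaleR_left (q x t))"
      using qc unfolding split_beta by (auto intro!: continuous_intros)
    then show "continuous (at (x, t) within A \<times> B) (\<lambda>(x, t). blinfun_scaleR_left (q x t))"
      using xt by (simp add: continuous_on_eq_continuous_within)
    show "((\<lambda>x. u x t) has_derivative (\<lambda>a. a *\<^sub>R p)) (at x within A)"
      using p by (simp add: has_vector_derivative_def)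
    show "((\<lambda>t. u x t) has_derivative blinfun_apply (blinfun_scaleR_left (q x t))) (at t within B)"
      if "x \<in> A" "t \<in> B" for x t
      using q[OF that] by (simp add: has_vector_derivative_def)
  qed (use xt B in auto)
  then show ?thesis by simp
qed

text \<open>\<open>C1_in\<close> and the notions built on partial derivatives below do not state
  continuity of the function itself; it is recovered here.\<close>

lemma continuous_on_of_partials:
  fixes u :: "real \<Rightarrow> real \<Rightarrow> 'b::real_normed_vector"
  assumes B: "convex B"
    and p: "\<And>x t. x \<in> A \<Longrightarrow> t \<in> B \<Longrightarrow> ((\<lambda>x. u x t) has_vector_derivative p x t) (at x within A)"
    and q: "\<And>x t. x \<in> A \<Longrightarrow> t \<in> B \<Longrightarrow> ((\<lambda>t. u x t) has_vector_derivative q x t) (at t within B)"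
    and qc: "continuous_on (A \<times> B) (\<lambda>(x, t). q x t)"
  shows "continuous_on (A \<times> B) (\<lambda>(x, t). u x t)"
  unfolding continuous_on_eq_continuous_within
proof
  fix z assume z: "z \<in> A \<times> B"
  obtain x t where zt: "z = (x, t)" "x \<in> A" "t \<in> B" using z by auto
  show "continuous (at z within A \<times> B) (\<lambda>(x, t). u x t)"
    unfolding zt(1) by (rule has_derivative_continuous[OF has_derivative_partials_vector[OF B zt(2,3) p[OF zt(2,3)] q qc]])
qed

text \<open>The function is differentiable only relative to \<open>A \<times> B\<close>, so the
  derivative along the curve is taken within a set \<open>S\<close> of times at which the curve
  stays in \<open>A\<close>.\<close>

lemma has_vector_derivative_along_curve:
  fixes u :: "real \<Rightarrow> real \<Rightarrow> 'b::real_normed_vector"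
  assumes B: "convex B"
    and p: "((\<lambda>x. u x t) has_vector_derivative p) (at (\<gamma> t) within A)"
    and q: "\<And>x t. x \<in> A \<Longrightarrow> t \<in> B \<Longrightarrow> ((\<lambda>t. u x t) has_vector_derivative q x t) (at t within B)"
    and qc: "continuous_on (A \<times> B) (\<lambda>(x, t). q x t)"
    and S: "t \<in> S" "S \<subseteq> B" "\<And>\<tau>. \<tau> \<in> S \<Longrightarrow> \<gamma> \<tau> \<in> A"
    and g: "(\<gamma> has_real_derivative l) (at t within S)"
  shows "((\<lambda>\<tau>. u (\<gamma> \<tau>) \<tau>) has_vector_derivative (l *\<^sub>R p + q (\<gamma> t) t)) (at t within S)"
proof -
  have D: "((\<lambda>(x, t). u x t) has_derivative (\<lambda>(a, b). a *\<^sub>R p + b *\<^sub>R q (\<gamma> t) t))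
      (at (\<gamma> t, t) within A \<times> B)"
    using S by (intro has_derivative_partials_vector[OF B _ _ p q qc]) auto
  have G: "((\<lambda>\<tau>. (\<gamma> \<tau>, \<tau>)) has_derivative (\<lambda>s. (l * s, s))) (at t within S)"
    using g by (auto intro!: derivative_eq_intros simp: has_field_derivative_def)
  have "((\<lambda>\<tau>. (\<lambda>(x, t). u x t) (\<gamma> \<tau>, \<tau>)) has_derivative
      (\<lambda>s. (\<lambda>(a, b). a *\<^sub>R p + b *\<^sub>R q (\<gamma> t) t) (l * s, s))) (at t within S)"
    using S by (intro has_derivative_in_compose[OF G] has_derivative_subset[OF D]) auto
  then show ?thesis
    unfolding has_vector_derivative_def by (simp add: algebra_simps)
qed

lemma has_real_derivative_Un_closed:
  fixes f :: "real \<Rightarrow> real"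
  assumes "closed S" "closed T"
    and "x \<in> S \<Longrightarrow> (f has_real_derivative D) (at x within S)"
    and "x \<in> T \<Longrightarrow> (f has_real_derivative D) (at x within T)"
  shows "(f has_real_derivative D) (at x within S \<union> T)"
proof -
  have *: "((\<lambda>y. (f y - f x) / (y - x)) \<longlongrightarrow> D) (at x within R)"
    if "closed R" "x \<in> R \<Longrightarrow> (f has_real_derivative D) (at x within R)" for R
  proof (cases "x \<in> R")
    case False
    \<comment> \<open>A point outside a closed set is no limit point of it, so this half of the
      union imposes no condition.\<close>
    then have "at x within R = bot"
      using \<open>closed R\<close> by (metis closed_limpt trivial_limit_within)
    then show ?thesis by simp
  qed (use that in \<open>simp add: has_field_derivative_iff\<close>)
  show ?thesis
    unfolding has_field_derivative_iff unfolding at_within_union by (intro filterlim_sup * assms)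
qed

text \<open>The substitution \<open>s = t * r\<close> moves the variable endpoint into the integrand
  and leaves an integral over the fixed interval \<open>{0..1}\<close>.\<close>

lemma continuous_on_param_integral:
  fixes k :: "'a::metric_space \<Rightarrow> real \<Rightarrow> real"
  assumes k: "continuous_on (P \<times> {0..}) (\<lambda>(p, s). k p s)"
  shows "continuous_on (P \<times> {0..}) (\<lambda>(p, t). integral {0..t} (k p))"
proof -
  have kp: "continuous_on {0..t} (k p)" if "p \<in> P" for p t
  proof -
    have "continuous_on {0..t} (\<lambda>s. (\<lambda>(p, s). k p s) (p, s))"
      by (rule continuous_on_compose2[OF k]) (use that in \<open>auto intro!: continuous_intros\<close>)
    then show ?thesis by simp
  qed
  have eq: "integral {0..t} (k p) = integral {0..1} (\<lambda>r. t * k p (t * r))" if "p \<in> P" "t \<ge> 0" for p t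
  proof -
    have "((\<lambda>r. t *\<^sub>R k p (t * r)) has_integral (integral {t * 0..t * 1} (k p))) {0..1}"
      by (rule has_integral_substitution[where c = 0 and d = t])
        (use that kp in \<open>auto intro!: derivative_eq_intros simp: mult_left_le\<close>)
    then show ?thesis
      unfolding real_scaleR_def mult_zero_right mult_1_right by (rule integral_unique[symmetric])
  qed
  have "continuous_on ((P \<times> {0..}) \<times> cbox 0 1) (\<lambda>x. (\<lambda>(p, s). k p s) (fst (fst x), snd (fst x) * snd x))"
    by (rule continuous_on_compose2[OF k]) (auto intro!: continuous_intros)
  then have "continuous_on ((P \<times> {0..}) \<times> cbox 0 (1::real)) (\<lambda>(x, r). snd x * k (fst x) (snd x * r))"
    unfolding split_beta by (auto intro!: continuous_intros)
  from integral_continuous_on_param[OF this]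
  show ?thesis
    by (rule continuous_on_eq) (auto simp: eq)
qed

lemma continuous_eq_on_unit_interval:
  fixes f g :: "real \<Rightarrow> 'b::real_normed_vector"
  assumes "continuous_on {0..1} f" "continuous_on {0..1} g" "\<And>x. 0 < x \<Longrightarrow> x < 1 \<Longrightarrow> f x = g x" "x \<in> {0..1}"
  shows "f x = g x"
proof -
  have "continuous_on (closure {0<..<1}) (\<lambda>x. f x - g x)"
    using assms by (auto intro!: continuous_intros)
  from continuous_constant_on_closure[OF this, of 0 x] show ?thesis using assms by auto
qed

section \<open>The flow of a scalar field\<close>

lemma has_real_derivative_integral_atLeast:
  fixes g :: "real \<Rightarrow> real"
  assumes g: "continuous_on {0..} g" and t: "0 \<le> t"
  shows "((\<lambda>t. integral {0..t} g) has_real_derivative g t) (at t within {0..})"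
proof -
  have "((\<lambda>t. integral {0..t} g) has_real_derivative g t) (at t within {0..t+1})"
    by (rule integral_has_real_derivative) (use t in \<open>auto intro: continuous_on_subset[OF g]\<close>)
  moreover have "at t within {0..t+1} = at t within {0..}"
    by (rule at_within_nhd[where S = "{..<t+1}"]) auto
  ultimately show ?thesis by simp
qed

lemma uniform_limit_of_geometric_steps:
  fixes f :: "nat \<Rightarrow> 'a \<Rightarrow> 'b::banach"
  assumes "\<And>m x. x \<in> A \<Longrightarrow> norm (f (Suc m) x - f m x) \<le> C / 2 ^ m"
  shows "uniform_limit A f (\<lambda>x. f 0 x + (\<Sum>m. f (Suc m) x - f m x)) sequentially"
proof -
  have "uniform_limit A (\<lambda>n x. \<Sum>m<n. f (Suc m) x - f m x) (\<lambda>x. \<Sum>m. f (Suc m) x - f m x) sequentially"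
  proof (rule Weierstrass_m_test)
    show "summable (\<lambda>m. C / 2 ^ m)"
      using summable_mult[OF summable_geometric[of "1/2::real"], of C] by (simp add: power_divide)
  qed (use assms in auto)
  from uniform_limit_add[OF uniform_limit_const this, of "f 0"]
  have "uniform_limit A (\<lambda>n x. f 0 x + (\<Sum>m<n. f (Suc m) x - f m x))
      (\<lambda>x. f 0 x + (\<Sum>m. f (Suc m) x - f m x)) sequentially" by simp
  moreover have "f 0 x + (\<Sum>m<n. f (Suc m) x - f m x) = f n x" for n x
    using sum_lessThan_telescope[of "\<lambda>m. f m x" n] by simp
  ultimately show ?thesis by simp
qed

text \<open>Separate continuity in time becomes joint continuity because the Lipschitz constant in
  space is uniform on bounded time intervals. This serves both the flow and its inverse.\<close>

lemma continuous_on_Lipschitz_fst: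
  fixes F :: "real \<Rightarrow> real \<Rightarrow> real"
  assumes c: "\<And>y. continuous_on {0..} (F y)"
    and K: "\<And>y z t T. 0 \<le> t \<Longrightarrow> t \<le> T \<Longrightarrow> \<bar>F z t - F y t\<bar> \<le> K T * \<bar>z - y\<bar>"
  shows "continuous_on (UNIV \<times> {0..}) (\<lambda>(y, t). F y t)"
  unfolding continuous_on_eq_continuous_within
proof
  fix p :: "real \<times> real" assume "p \<in> UNIV \<times> {0..}"
  then obtain y t where p: "p = (y, t)" "0 \<le> t" by auto
  let ?X = "at (y, t) within UNIV \<times> {0..}"
  have "continuous_on (UNIV \<times> {0..}) (\<lambda>p. K (t + 1) * \<bar>fst p - y\<bar> + \<bar>F y (snd p) - F y t\<bar>)"
    by (intro continuous_intros continuous_on_compose2[OF c[of y]]) auto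
  then have "continuous ?X (\<lambda>p. K (t + 1) * \<bar>fst p - y\<bar> + \<bar>F y (snd p) - F y t\<bar>)"
    using p(2) by (simp add: continuous_on_eq_continuous_within)
  then have lim: "((\<lambda>p. K (t + 1) * \<bar>fst p - y\<bar> + \<bar>F y (snd p) - F y t\<bar>) \<longlongrightarrow> 0) ?X"
    by (simp add: continuous_within)
  have "\<forall>\<^sub>F p in ?X. p \<in> UNIV \<times> {..<t+1} \<and> p \<in> UNIV \<times> {0..}"
    using eventually_at_topological[of "\<lambda>p. p \<in> UNIV \<times> {..<t+1} \<and> p \<in> UNIV \<times> {0..}"]
    by (intro iffD2[OF eventually_at_topological] exI[of _ "UNIV \<times> {..<t+1}"]) (auto intro!: open_Times)
  then have "\<forall>\<^sub>F p in ?X. norm ((\<lambda>(y, t). F y t) p - F y t)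
      \<le> K (t + 1) * \<bar>fst p - y\<bar> + \<bar>F y (snd p) - F y t\<bar>"
  proof eventually_elim
    case (elim p)
    obtain z s where "p = (z, s)" by force
    then show ?case using K[of s "t+1" z y] elim by auto
  qed
  from Lim_null_comparison[OF this lim]
  show "continuous (at p within UNIV \<times> {0..}) (\<lambda>(y, t). F y t)"
    unfolding p continuous_within by (simp add: LIM_zero_iff)
qed

lemma continuous_on_compose_pair:
  assumes "continuous_on (UNIV \<times> {0..}) (\<lambda>(x, t). F x t)"
    and "continuous_on S g" "continuous_on S h" "\<And>s. s \<in> S \<Longrightarrow> (0::real) \<le> h s"
  shows "continuous_on S (\<lambda>s. F (g s) (h s))"
  using continuous_on_compose2[OF assms(1), of S "\<lambda>s. (g s, h s)"] assms
  by (auto intro!: continuous_on_Pair)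

text \<open>The field lives on the whole line and its slope is bounded on every time slab, so that
  trajectories exist for all \<open>t \<ge> 0\<close> and no exit times appear. The speeds given on
  the strip are brought into this form by \<open>affine_extension\<close>.\<close>

locale flow_field =
  fixes l lx :: "real \<Rightarrow> real \<Rightarrow> real" and L :: "real \<Rightarrow> real"
  assumes l_cont: "continuous_on (UNIV \<times> {0..}) (\<lambda>(x, t). l x t)"
    and lx_cont: "continuous_on (UNIV \<times> {0..}) (\<lambda>(x, t). lx x t)"
    and l_deriv: "\<And>x t. 0 \<le> t \<Longrightarrow> ((\<lambda>x. l x t) has_real_derivative lx x t) (at x)"
    and lx_bound: "\<And>x t T. 0 \<le> t \<Longrightarrow> t \<le> T \<Longrightarrow> \<bar>lx x t\<bar> \<le> L T"
begin

lemma l_Lipschitz: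
  assumes "0 \<le> t" "t \<le> T" shows "\<bar>l x t - l y t\<bar> \<le> L T * \<bar>x - y\<bar>"
proof -
  have "norm (l x t - l y t) \<le> L T * norm (x - y)"
    by (rule field_differentiable_bound[where S = UNIV and f' = "\<lambda>x. lx x t"])
      (use l_deriv lx_bound assms in auto)
  then show ?thesis by simp
qed

lemma L_nonneg: "0 \<le> T \<Longrightarrow> 0 \<le> L T"
  using lx_bound[of 0 T 0] by linarith

lemmas continuous_on_l_comp = continuous_on_compose_pair[OF l_cont]

lemmas continuous_on_lx_comp = continuous_on_compose_pair[OF lx_cont]

primrec picard :: "real \<Rightarrow> nat \<Rightarrow> real \<Rightarrow> real" where
  "picard y 0 t = y"
| "picard y (Suc m) t = y + integral {0..t} (\<lambda>s. l (picard y m s) s)"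

lemma picard_cont: "continuous_on {0..} (picard y m)"
proof (induction m)
  case 0
  have "picard y 0 = (\<lambda>_. y)" by auto
  then show ?case by simp
next
  case (Suc m)
  have "continuous_on {0..} (\<lambda>s. l (picard y m s) s)"
    by (intro continuous_on_l_comp Suc continuous_intros) auto
  then have "continuous_on {0..} (\<lambda>t. integral {0..t} (\<lambda>s. l (picard y m s) s))"
    by (rule DERIV_continuous_on[OF has_real_derivative_integral_atLeast]) auto
  moreover have "picard y (Suc m) = (\<lambda>t. y + integral {0..t} (\<lambda>s. l (picard y m s) s))" by auto
  ultimately show ?case by (auto intro!: continuous_intros)
qed

lemma picard_integrand_cont: "continuous_on {0..t} (\<lambda>s. l (picard y m s) s)"
  by (intro continuous_on_l_comp continuous_on_subset[OF picard_cont] continuous_intros) auto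

lemma picard_step:
  assumes T: "0 \<le> T"
  shows "\<exists>C. \<forall>m. \<forall>t\<in>{0..T}. \<bar>picard y (Suc m) t - picard y m t\<bar> \<le> C / 2 ^ m"
proof -
  define K where "K = L T + 1"
  have K: "K > 0" "L T \<le> K" using L_nonneg[OF T] by (auto simp: K_def)
  have "compact ((\<lambda>t. picard y 1 t - picard y 0 t) ` {0..T})"
    by (intro compact_continuous_image continuous_intros continuous_on_subset[OF picard_cont]) auto
  from compact_imp_bounded[OF this] obtain C where C: "\<And>t. t \<in> {0..T} \<Longrightarrow> \<bar>picard y 1 t - picard y 0 t\<bar> \<le> C"
    unfolding bounded_iff real_norm_def by blast
  have C0: "C \<ge> 0" using C[of 0] T by force
  \<comment> \<open>The factor \<open>exp (2 * K * t)\<close> makes one integration with Lipschitz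
    constant \<open>K\<close> halve the bound, on all of \<open>{0..T}\<close> and not only for
    short times.\<close>
  have main: "\<bar>picard y (Suc m) t - picard y m t\<bar> \<le> C / 2 ^ m * exp (2 * K * t)" if "0 \<le> t" "t \<le> T" for m t
    using that
  proof (induction m arbitrary: t)
    case 0
    have "C * 1 \<le> C * exp (2 * K * t)" using C0 K 0 by (intro mult_left_mono) auto
    then show ?case using C[of t] 0 by (simp del: picard.simps)
  next
    case (Suc m)
    let ?d = "\<lambda>s. l (picard y (Suc m) s) s - l (picard y m s) s"
    have ftc: "((\<lambda>s. K * (C / 2 ^ m * exp (2 * K * s))) has_integral
        (C / 2 ^ Suc m * exp (2 * K * t) - C / 2 ^ Suc m * exp (2 * K * 0))) {0..t}"
      using Suc.prems K
      by (intro fundamental_theorem_of_calculus)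
        (auto intro!: derivative_eq_intros simp: has_real_derivative_iff_has_vector_derivative[symmetric])
    have "picard y (Suc (Suc m)) t - picard y (Suc m) t
        = integral {0..t} (\<lambda>s. l (picard y (Suc m) s) s) - integral {0..t} (\<lambda>s. l (picard y m s) s)"
      by simp
    also have "\<dots> = integral {0..t} ?d"
      by (intro integral_diff[symmetric] integrable_continuous_real picard_integrand_cont)
    also have "norm \<dots> \<le> integral {0..t} (\<lambda>s. K * (C / 2 ^ m * exp (2 * K * s)))"
    proof (rule integral_norm_bound_integral)
      show "?d integrable_on {0..t}"
        by (intro integrable_diff integrable_continuous_real picard_integrand_cont)
      show "(\<lambda>s. K * (C / 2 ^ m * exp (2 * K * s))) integrable_on {0..t}"
        using ftc by blast
      fix s assume s: "s \<in> {0..t}"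
      have "\<bar>?d s\<bar> \<le> L T * \<bar>picard y (Suc m) s - picard y m s\<bar>"
        using l_Lipschitz[of s T] s Suc.prems by auto
      also have "\<dots> \<le> K * (C / 2 ^ m * exp (2 * K * s))"
        using s Suc.prems K L_nonneg[OF T] by (intro mult_mono Suc.IH) auto
      finally show "norm (?d s) \<le> K * (C / 2 ^ m * exp (2 * K * s))" by simp
    qed
    also have "\<dots> \<le> C / 2 ^ Suc m * exp (2 * K * t)"
      using integral_unique[OF ftc] C0 by simp
    finally show ?case unfolding real_norm_def .
  qed
  show ?thesis
  proof (intro exI allI ballI)
    fix m t assume t: "t \<in> {0..T}"
    have "C / 2 ^ m * exp (2 * K * t) \<le> C / 2 ^ m * exp (2 * K * T)"
      using t C0 K by (intro mult_left_mono) auto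
    then show "\<bar>picard y (Suc m) t - picard y m t\<bar> \<le> (C * exp (2 * K * T)) / 2 ^ m"
      using main[of t m] t by auto
  qed
qed

lemma flow_exists:
  "\<exists>\<phi>. \<phi> 0 = y \<and> (\<forall>t\<ge>0. (\<phi> has_real_derivative l (\<phi> t) t) (at t within {0..}))"
proof -
  define \<phi> where "\<phi> = (\<lambda>t. picard y 0 t + (\<Sum>m. picard y (Suc m) t - picard y m t))"
  have ul: "uniform_limit {0..T} (picard y) \<phi> sequentially" for T
  proof -
    obtain C where C: "\<forall>m. \<forall>t\<in>{0..max 0 T}. \<bar>picard y (Suc m) t - picard y m t\<bar> \<le> C / 2 ^ m"
      using picard_step[of "max 0 T" y] by auto
    show ?thesis unfolding \<phi>_def
      by (rule uniform_limit_of_geometric_steps[where C = C]) (use C in auto)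
  qed
  have cT: "continuous_on {0..T} \<phi>" for T
    by (rule uniform_limit_theorem[OF _ ul]) (auto intro!: always_eventually continuous_on_subset[OF picard_cont])
  have c: "continuous_on {0..} \<phi>"
    unfolding continuous_on_eq_continuous_within
  proof
    fix t :: real assume t: "t \<in> {0..}"
    have "at t within {0..t+1} = at t within {0..}"
      by (rule at_within_nhd[where S = "{..<t+1}"]) auto
    then show "continuous (at t within {0..}) \<phi>"
      using bspec[OF cT[of "t+1", unfolded continuous_on_eq_continuous_within], of t] t by simp
  qed
  have lc: "continuous_on {0..} (\<lambda>s. l (\<phi> s) s)"
    by (intro continuous_on_l_comp c continuous_intros) auto
  have eq: "\<phi> t = y + integral {0..t} (\<lambda>s. l (\<phi> s) s)" if t: "0 \<le> t" for t
  proof -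
    have "uniform_limit (cbox 0 t) (\<lambda>m s. l (picard y m s) s) (\<lambda>s. l (\<phi> s) s) sequentially"
    proof (rule uniform_limitI)
      fix e :: real assume e: "e > 0"
      define K where "K = L t + 1"
      have K: "K > 0" "L t \<le> K" using L_nonneg[OF t] by (auto simp: K_def)
      have "\<forall>\<^sub>F m in sequentially. \<forall>s\<in>{0..t}. dist (picard y m s) (\<phi> s) < e / K"
        using uniform_limitD[OF ul] e K by simp
      then show "\<forall>\<^sub>F m in sequentially. \<forall>s\<in>cbox 0 t. dist (l (picard y m s) s) (l (\<phi> s) s) < e"
      proof eventually_elim
        case (elim m)
        show ?case
        proof
          fix s assume s: "s \<in> cbox 0 t"
          have "\<bar>l (picard y m s) s - l (\<phi> s) s\<bar> \<le> L t * \<bar>picard y m s - \<phi> s\<bar>"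
            using l_Lipschitz[of s t] s by auto
          also have "\<dots> \<le> K * \<bar>picard y m s - \<phi> s\<bar>" using K by (intro mult_right_mono) auto
          also have "\<dots> < e" using elim s K by (auto simp: dist_real_def field_simps)
          finally show "dist (l (picard y m s) s) (l (\<phi> s) s) < e" by (simp add: dist_real_def)
        qed
      qed
    qed
    then obtain I J where IJ: "\<And>m. ((\<lambda>s. l (picard y m s) s) has_integral I m) (cbox 0 t)"
      "((\<lambda>s. l (\<phi> s) s) has_integral J) (cbox 0 t)" "I \<longlonglongrightarrow> J"
      by (rule uniform_limit_integral_cbox) (use picard_integrand_cont in auto)
    have "I = (\<lambda>m. integral {0..t} (\<lambda>s. l (picard y m s) s))" "J = integral {0..t} (\<lambda>s. l (\<phi> s) s)"
      using integral_unique[OF IJ(1)] integral_unique[OF IJ(2)] by auto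
    with IJ(3) have "(\<lambda>m. integral {0..t} (\<lambda>s. l (picard y m s) s)) \<longlonglongrightarrow> integral {0..t} (\<lambda>s. l (\<phi> s) s)"
      by simp
    then have "(\<lambda>m. picard y (Suc m) t) \<longlonglongrightarrow> y + integral {0..t} (\<lambda>s. l (\<phi> s) s)"
      by (auto intro!: tendsto_intros)
    moreover have "(\<lambda>m. picard y (Suc m) t) \<longlonglongrightarrow> \<phi> t"
      using tendsto_uniform_limitI[OF ul, of t t] t by (intro LIMSEQ_Suc) simp
    ultimately show ?thesis using LIMSEQ_unique by blast
  qed
  have "(\<phi> has_real_derivative l (\<phi> t) t) (at t within {0..})" if t: "0 \<le> t" for t
  proof -
    have "((\<lambda>t. y + integral {0..t} (\<lambda>s. l (\<phi> s) s)) has_real_derivative l (\<phi> t) t) (at t within {0..})"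
      using has_real_derivative_integral_atLeast[OF lc t] by (auto intro!: derivative_eq_intros)
    then show ?thesis
      by (rule has_field_derivative_transform_within[where d = 1]) (use t eq in auto)
  qed
  moreover have "\<phi> 0 = y" using eq[of 0] by simp
  ultimately show ?thesis by blast
qed

section \<open>The flow map, its dependence on the starting point, and its inverse\<close>

definition Phi :: "real \<Rightarrow> real \<Rightarrow> real" where
  "Phi y = (SOME \<phi>. \<phi> 0 = y \<and> (\<forall>t\<ge>0. (\<phi> has_real_derivative l (\<phi> t) t) (at t within {0..})))"

lemma Phi_0 [simp]: "Phi y 0 = y"
  and Phi_deriv: "0 \<le> t \<Longrightarrow> (Phi y has_real_derivative l (Phi y t) t) (at t within {0..})"
  using someI_ex[OF flow_exists[of y]] unfolding Phi_def[of y, symmetric] by auto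

lemma Phi_cont1: "continuous_on {0..} (Phi y)"
  by (rule DERIV_continuous_on[where D = "\<lambda>t. l (Phi y t) t"]) (auto intro: Phi_deriv)

text \<open>The difference quotient of \<open>l\<close> in space, continued to the diagonal
  \<open>a = b\<close> by \<open>lx\<close>. The averaged form makes joint continuity immediate and
  needs no division by \<open>b - a\<close>.\<close>

definition dq :: "real \<Rightarrow> real \<Rightarrow> real \<Rightarrow> real" where
  "dq a b t = integral {0..1} (\<lambda>\<theta>. lx (a + \<theta> * (b - a)) t)"

lemma dq_integrand_cont: "0 \<le> t \<Longrightarrow> continuous_on {0..1} (\<lambda>\<theta>. lx (a + \<theta> * (b - a)) t)"
  by (intro continuous_on_lx_comp continuous_intros)

lemma dq_eq: "0 \<le> t \<Longrightarrow> l b t - l a t = (b - a) * dq a b t"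
proof -
  assume t: "0 \<le> t"
  have "((\<lambda>\<theta>. (b - a) * lx (a + \<theta> * (b - a)) t) has_integral
      (l (a + 1 * (b - a)) t - l (a + 0 * (b - a)) t)) {0..1}"
  proof (rule fundamental_theorem_of_calculus)
    fix \<theta> :: real
    have "((\<lambda>\<theta>. a + \<theta> * (b - a)) has_real_derivative (b - a)) (at \<theta> within {0..1})"
      by (auto intro!: derivative_eq_intros)
    from DERIV_chain2[OF l_deriv[OF t] this]
    show "((\<lambda>\<theta>. l (a + \<theta> * (b - a)) t) has_vector_derivative (b - a) * lx (a + \<theta> * (b - a)) t) (at \<theta> within {0..1})"
      by (simp add: has_real_derivative_iff_has_vector_derivative mult.commute)
  qed simp
  from integral_unique[OF this] show ?thesis by (simp add: dq_def)
qed

lemma dq_same [simp]: "dq a a t = lx a t"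
  by (simp add: dq_def)

lemma dq_bound: "0 \<le> t \<Longrightarrow> t \<le> T \<Longrightarrow> \<bar>dq a b t\<bar> \<le> L T"
  using integral_bound[OF _ dq_integrand_cont[of t a b], of "L T"] lx_bound[of t T]
  by (auto simp: dq_def)

lemma dq_cont: "continuous_on {(a, b, t). 0 \<le> t} (\<lambda>(a, b, t). dq a b t)"
proof -
  have "continuous_on ({(a, b, t). 0 \<le> t} \<times> cbox 0 1)
      (\<lambda>(p, \<theta>). lx (fst p + \<theta> * (fst (snd p) - fst p)) (snd (snd p)))"
    unfolding split_beta by (intro continuous_on_lx_comp continuous_intros) auto
  from integral_continuous_on_param[OF this] show ?thesis
    by (simp add: dq_def split_beta)
qed

lemma continuous_on_dq_comp:
  assumes "continuous_on S f" "continuous_on S g" "continuous_on S h" "\<And>s. s \<in> S \<Longrightarrow> 0 \<le> h s"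
  shows "continuous_on S (\<lambda>s. dq (f s) (g s) (h s))"
proof -
  have "continuous_on S (\<lambda>s. (\<lambda>(a, b, t). dq a b t) (f s, g s, h s))"
    by (rule continuous_on_compose2[OF dq_cont]) (use assms in \<open>auto intro!: continuous_on_Pair\<close>)
  then show ?thesis by simp
qed

text \<open>The ratio of the distance of two trajectories to the distance of their starting points.
  On the diagonal \<open>z = y\<close> it solves the variational equation and is the derivative of
  the flow in its starting point.\<close>

definition E :: "real \<Rightarrow> real \<Rightarrow> real \<Rightarrow> real" where
  "E y z t = exp (integral {0..t} (\<lambda>s. dq (Phi y s) (Phi z s) s))"

lemma E_pos [simp]: "0 < E y z t" and E_0 [simp]: "E y z 0 = 1" and E_neq_0 [simp]: "E y z t \<noteq> 0"
  by (auto simp: E_def)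

lemma E_deriv:
  "0 \<le> t \<Longrightarrow> (E y z has_real_derivative dq (Phi y t) (Phi z t) t * E y z t) (at t within {0..})"
  unfolding E_def
  by (auto intro!: derivative_eq_intros has_real_derivative_integral_atLeast continuous_on_dq_comp
      Phi_cont1 continuous_intros)

lemma E_bounds:
  assumes "0 \<le> t" "t \<le> T"
  shows "E y z t \<le> exp (L T * T)" "exp (- (L T * T)) \<le> E y z t"
proof -
  have "norm (integral {0..t} (\<lambda>s. dq (Phi y s) (Phi z s) s)) \<le> L T * (t - 0)"
    by (rule integral_bound)
      (use assms dq_bound in \<open>auto intro!: continuous_on_dq_comp continuous_on_subset[OF Phi_cont1] continuous_intros\<close>)
  also have "\<dots> \<le> L T * T" using assms L_nonneg by (intro mult_left_mono) auto
  finally show "E y z t \<le> exp (L T * T)" "exp (- (L T * T)) \<le> E y z t"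
    by (auto simp: E_def)
qed

text \<open>Hadamard form of the dependence on the initial value: the difference of two trajectories
  solves a scalar linear equation.\<close>

lemma Phi_diff:
  assumes t: "0 \<le> t"
  shows "Phi z t - Phi y t = (z - y) * E y z t"
proof -
  let ?g = "\<lambda>t. (Phi z t - Phi y t) / E y z t"
  have "(?g has_real_derivative 0) (at s within {0..})" if "s \<in> {0..}" for s
    using that
    by (auto intro!: derivative_eq_intros Phi_deriv E_deriv)
      (simp add: dq_eq algebra_simps)
  then obtain c where c: "\<And>s. 0 \<le> s \<Longrightarrow> ?g s = c"
    using has_field_derivative_zero_constant[of "{0..}" ?g] by auto
  from c[of 0] c[of t] t show ?thesis by (simp add: field_simps)
qed

lemma Phi_Lipschitz: "0 \<le> t \<Longrightarrow> t \<le> T \<Longrightarrow> \<bar>Phi z t - Phi y t\<bar> \<le> exp (L T * T) * \<bar>z - y\<bar>"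
  using E_bounds(1)[of t T y z] by (simp add: Phi_diff abs_mult mult.commute mult_left_mono less_imp_le)

text \<open>The lower bound on \<open>E\<close>: trajectories approach each other at most
  exponentially. It yields surjectivity of the flow map and the Lipschitz and continuity properties
  of its inverse.\<close>

lemma Phi_expand: "0 \<le> t \<Longrightarrow> t \<le> T \<Longrightarrow> \<bar>z - y\<bar> \<le> exp (L T * T) * \<bar>Phi z t - Phi y t\<bar>"
proof -
  assume t: "0 \<le> t" "t \<le> T"
  have "\<bar>z - y\<bar> * exp (- (L T * T)) \<le> \<bar>z - y\<bar> * E y z t"
    using E_bounds(2)[OF t] by (intro mult_left_mono) auto
  also have "\<dots> = \<bar>Phi z t - Phi y t\<bar>" using t by (simp add: Phi_diff abs_mult less_imp_le)
  finally show ?thesis by (simp add: exp_minus field_simps)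
qed

lemma Phi_cont: "continuous_on (UNIV \<times> {0..}) (\<lambda>(y, t). Phi y t)"
  by (rule continuous_on_Lipschitz_fst[OF Phi_cont1 Phi_Lipschitz])

lemmas continuous_on_Phi_comp = continuous_on_compose_pair[OF Phi_cont]

lemma E_cont: "continuous_on (UNIV \<times> {0..}) (\<lambda>(p, t). E (fst p) (snd p) t)"
proof -
  have "continuous_on (UNIV \<times> {0..}) (\<lambda>(p, s). dq (Phi (fst p) s) (Phi (snd p) s) s)"
    unfolding split_beta by (intro continuous_on_dq_comp continuous_on_Phi_comp continuous_intros) auto
  from continuous_on_exp[OF continuous_on_param_integral[OF this]]
  show ?thesis by (simp add: E_def split_beta)
qed

lemma continuous_on_E_comp:
  assumes "continuous_on S f" "continuous_on S g" "continuous_on S h" "\<And>s. s \<in> S \<Longrightarrow> 0 \<le> h s"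
  shows "continuous_on S (\<lambda>s. E (f s) (g s) (h s))"
proof -
  have "continuous_on S (\<lambda>s. (\<lambda>(p, t). E (fst p) (snd p) t) ((f s, g s), h s))"
    by (rule continuous_on_compose2[OF E_cont]) (use assms in \<open>auto intro!: continuous_on_Pair\<close>)
  then show ?thesis by simp
qed

text \<open>\<open>Phi_diff\<close> is Caratheodory's criterion with the slope function
  \<open>\<lambda>z. E y z t\<close>, which is continuous.\<close>

lemma Phi_deriv_y:
  assumes t: "0 \<le> t"
  shows "((\<lambda>y. Phi y t) has_real_derivative E y y t) (at y)"
  unfolding CARAT_DERIV
proof (intro exI conjI allI)
  have "continuous_on UNIV (\<lambda>z. E y z t)"
    by (intro continuous_on_E_comp continuous_intros t)
  then show "isCont (\<lambda>z. E y z t) y" by (simp add: continuous_on_eq_continuous_at)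
qed (use t in \<open>auto simp: Phi_diff mult.commute\<close>)

lemma Phi_inj: "0 \<le> t \<Longrightarrow> Phi y t = Phi z t \<Longrightarrow> y = z"
  using Phi_diff[of t z y] by simp

lemma Phi_surj:
  assumes t: "0 \<le> t" shows "\<exists>y. Phi y t = x"
proof -
  \<comment> \<open>By the expansion bound, a starting point this far from 0 has moved at least
    \<open>\<bar>x - Phi 0 t\<bar>\<close> away from \<open>Phi 0 t\<close> at time
    \<open>t\<close>, so \<open>Phi (-?M) t\<close> and \<open>Phi ?M t\<close> enclose
    \<open>x\<close>.\<close>
  let ?M = "exp (L t * t) * \<bar>x - Phi 0 t\<bar>"
  have M: "?M \<ge> 0" by simp
  have "?M \<le> exp (L t * t) * \<bar>Phi ?M t - Phi 0 t\<bar>"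
    using Phi_expand[of t t ?M 0] t by simp
  then have 1: "\<bar>x - Phi 0 t\<bar> \<le> Phi ?M t - Phi 0 t"
    using Phi_diff[OF t, of ?M 0] M by (simp add: less_imp_le)
  have "?M \<le> exp (L t * t) * \<bar>Phi (-?M) t - Phi 0 t\<bar>"
    using Phi_expand[of t t "-?M" 0] t by simp
  moreover have "Phi (-?M) t - Phi 0 t \<le> 0"
    unfolding Phi_diff[OF t, of "-?M" 0] using M by (simp add: less_imp_le mult_nonneg_nonneg)
  ultimately have 2: "\<bar>x - Phi 0 t\<bar> \<le> Phi 0 t - Phi (-?M) t"
    by simp
  have "\<exists>y\<ge>-?M. y \<le> ?M \<and> Phi y t = x"
  proof (rule IVT')
    show "Phi (-?M) t \<le> x" "x \<le> Phi ?M t" "-?M \<le> ?M" using 1 2 M by linarith+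
    show "continuous_on {-?M..?M} (\<lambda>y. Phi y t)"
      by (intro continuous_on_Phi_comp continuous_intros t)
  qed
  then show ?thesis by blast
qed

text \<open>The foot of the characteristic through \<open>(x, t)\<close>, that is, its position at
  time 0.\<close>

definition Psi :: "real \<Rightarrow> real \<Rightarrow> real" where
  "Psi x t = (THE y. Phi y t = x)"

lemma Phi_Psi [simp]: "0 \<le> t \<Longrightarrow> Phi (Psi x t) t = x"
  unfolding Psi_def by (rule theI') (metis Phi_inj Phi_surj)

lemma Psi_Phi [simp]: "0 \<le> t \<Longrightarrow> Psi (Phi y t) t = y"
  using Phi_inj[of t "Psi (Phi y t) t" y] by simp

lemma Psi_0 [simp]: "Psi x 0 = x"
  using Phi_Psi[of 0 x] by simp

lemma Psi_diff: "0 \<le> t \<Longrightarrow> Psi z t - Psi x t = (z - x) / E (Psi x t) (Psi z t) t"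
  using Phi_diff[of t "Psi z t" "Psi x t"] by simp

lemma Psi_mono: "0 \<le> t \<Longrightarrow> x \<le> z \<Longrightarrow> Psi x t \<le> Psi z t"
  using Psi_diff[of t z x] by (simp add: less_imp_le)
    (metis Psi_diff E_pos diff_ge_0_iff_ge divide_nonneg_pos)

lemma Psi_Lipschitz: "0 \<le> t \<Longrightarrow> t \<le> T \<Longrightarrow> \<bar>Psi z t - Psi x t\<bar> \<le> exp (L T * T) * \<bar>z - x\<bar>"
  using Phi_expand[of t T "Psi z t" "Psi x t"] by simp

lemma Psi_cont1: "continuous_on {0..} (Psi x)"
  unfolding continuous_on_eq_continuous_within
proof
  fix t :: real assume t: "t \<in> {0..}"
  let ?X = "at t within {0..}"
  \<comment> \<open>At a nearby time \<open>s\<close> the trajectory from \<open>y\<close> misses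
    \<open>x\<close> by \<open>\<bar>x - Phi y s\<bar>\<close>, which tends to 0;
    \<open>Phi_expand\<close> converts this into a bound on \<open>Psi x s - y\<close>.\<close>
  define y where "y = Psi x t"
  have "continuous_on {0..} (\<lambda>s. exp (L (t + 1) * (t + 1)) * \<bar>x - Phi y s\<bar>)"
    by (intro continuous_intros Phi_cont1)
  then have "continuous ?X (\<lambda>s. exp (L (t + 1) * (t + 1)) * \<bar>x - Phi y s\<bar>)"
    using t by (simp add: continuous_on_eq_continuous_within)
  then have lim: "((\<lambda>s. exp (L (t + 1) * (t + 1)) * \<bar>x - Phi y s\<bar>) \<longlongrightarrow> 0) ?X"
  proof -
    have "exp (L (t + 1) * (t + 1)) * \<bar>x - Phi y t\<bar> = 0" using t by (simp add: y_def)
    then show "continuous ?X (\<lambda>s. exp (L (t + 1) * (t + 1)) * \<bar>x - Phi y s\<bar>) \<Longrightarrow> ?thesis"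
      by (simp only: continuous_within)
  qed
  have "\<forall>\<^sub>F s in ?X. s < t + 1 \<and> 0 \<le> s"
    by (intro iffD2[OF eventually_at_topological] exI[of _ "{..<t+1}"]) auto
  then have "\<forall>\<^sub>F s in ?X. norm (Psi x s - Psi x t) \<le> exp (L (t + 1) * (t + 1)) * \<bar>x - Phi y s\<bar>"
  proof eventually_elim
    case (elim s)
    then show ?case using Phi_expand[of s "t+1" "Psi x s" y] by (simp add: y_def)
  qed
  from Lim_null_comparison[OF this lim]
  show "continuous ?X (Psi x)"
    unfolding continuous_within by (simp add: LIM_zero_iff)
qed

lemma Psi_cont: "continuous_on (UNIV \<times> {0..}) (\<lambda>(y, t). Psi y t)"
  by (rule continuous_on_Lipschitz_fst[OF Psi_cont1 Psi_Lipschitz])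

lemmas continuous_on_Psi_comp = continuous_on_compose_pair[OF Psi_cont]

definition Psix :: "real \<Rightarrow> real \<Rightarrow> real" where
  "Psix x t = 1 / E (Psi x t) (Psi x t) t"

lemma Psix_pos [simp]: "0 < Psix x t"
  by (simp add: Psix_def)

lemma continuous_on_Psix_comp:
  assumes "continuous_on S f" "continuous_on S h" "\<And>s. s \<in> S \<Longrightarrow> 0 \<le> h s"
  shows "continuous_on S (\<lambda>s. Psix (f s) (h s))"
  unfolding Psix_def
  by (intro continuous_intros continuous_on_E_comp continuous_on_Psi_comp assms) simp_all

lemma Psi_deriv_x:
  assumes t: "0 \<le> t"
  shows "((\<lambda>x. Psi x t) has_real_derivative Psix x t) (at x)"
  unfolding CARAT_DERIV
proof (intro exI conjI allI)
  have "continuous_on UNIV (\<lambda>z. 1 / E (Psi x t) (Psi z t) t)"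
    by (intro continuous_intros continuous_on_E_comp continuous_on_Psi_comp t) simp
  then show "isCont (\<lambda>z. 1 / E (Psi x t) (Psi z t) t) x" by (simp add: continuous_on_eq_continuous_at)
qed (use t in \<open>auto simp: Psi_diff Psix_def\<close>)

text \<open>The foot is constant along trajectories, so it solves the homogeneous transport
  equation. Its time quotient is that of the single trajectory \<open>Phi y\<close> through
  \<open>(x, t)\<close>, with opposite sign and divided by the separation ratio
  \<open>E\<close>.\<close>

lemma Psi_deriv_t:
  assumes t: "0 \<le> t"
  shows "(Psi x has_real_derivative - l x t * Psix x t) (at t within {0..})"
proof -
  define y where "y = Psi x t"
  let ?X = "at t within {0..}"
  have "continuous_on {0..} (\<lambda>s. 1 / E (Psi x s) y s)"
    by (intro continuous_intros continuous_on_E_comp Psi_cont1) auto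
  then have 1: "((\<lambda>s. 1 / E (Psi x s) y s) \<longlongrightarrow> Psix x t) ?X"
    using t by (simp add: continuous_on_def y_def Psix_def)
  have "(Phi y has_real_derivative l x t) ?X"
    using Phi_deriv[OF t, of y] t by (simp add: y_def)
  then have 2: "((\<lambda>s. (Phi y s - x) / (s - t)) \<longlongrightarrow> l x t) ?X"
    using t by (simp add: has_field_derivative_iff y_def)
  have "((\<lambda>s. - ((Phi y s - x) / (s - t) * (1 / E (Psi x s) y s))) \<longlongrightarrow> - (l x t * Psix x t)) ?X"
    by (intro tendsto_intros 1 2)
  moreover have "\<forall>\<^sub>F s in ?X. - ((Phi y s - x) / (s - t) * (1 / E (Psi x s) y s)) = (Psi x s - Psi x t) / (s - t)"
  proof (rule eventually_mono)
    show "\<forall>\<^sub>F s in ?X. s \<in> {0..}" by (simp add: eventually_at_filter)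
    fix s :: real assume "s \<in> {0..}"
    then have *: "y - Psi x s = (Phi y s - x) / E (Psi x s) y s"
      using Psi_diff[of s "Phi y s" x] by simp
    have "- ((Phi y s - x) / (s - t) * (1 / E (Psi x s) y s)) = - ((Phi y s - x) / E (Psi x s) y s / (s - t))"
      by simp
    also have "\<dots> = (Psi x s - y) / (s - t)"
      unfolding *[symmetric] by (simp only: minus_divide_left minus_diff_eq)
    finally show "- ((Phi y s - x) / (s - t) * (1 / E (Psi x s) y s)) = (Psi x s - Psi x t) / (s - t)"
      unfolding y_def .
  qed
  ultimately have "((\<lambda>s. (Psi x s - Psi x t) / (s - t)) \<longlongrightarrow> - (l x t * Psix x t)) ?X"
    by (rule Lim_transform_eventually)
  then show ?thesis
    unfolding has_field_derivative_iff by simp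
qed

end

section \<open>Scalar transport with inflow data\<close>

text \<open>Characteristics leave the strip, while the functions are controlled only inside it;
  derivatives along a characteristic are therefore taken within these times.\<close>

abbreviation strip_times :: "(real \<Rightarrow> real) \<Rightarrow> real set" where
  "strip_times c \<equiv> {\<tau>. 0 \<le> \<tau> \<and> c \<tau> \<in> {0..1}}"

abbreviation strip_cont :: "real set \<Rightarrow> (real \<Rightarrow> real \<Rightarrow> 'b::topological_space) \<Rightarrow> bool" where
  "strip_cont I g \<equiv> continuous_on ({0..1} \<times> I) (\<lambda>(x, t). g x t)"

lemma has_real_derivative_glue_at_0:
  fixes f g :: "real \<Rightarrow> real"
  assumes f: "\<And>t. 0 \<le> t \<Longrightarrow> (f has_real_derivative f' t) (at t within {0..})"
    and g: "\<And>t. t \<le> 0 \<Longrightarrow> (g has_real_derivative g' t) (at t within {..0})"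
    and eq: "f 0 = g 0" "f' 0 = g' 0"
  shows "((\<lambda>t. if 0 \<le> t then f t else g t) has_real_derivative (if 0 \<le> t then f' t else g' t)) (at t)"
    (is "(?h has_real_derivative ?D) _")
proof -
  have "(?h has_real_derivative ?D) (at t within {0..} \<union> {..0})"
  proof (rule has_real_derivative_Un_closed)
    assume "t \<in> {0..}"
    then show "(?h has_real_derivative ?D) (at t within {0..})"
      using has_field_derivative_transform_within[OF f[of t], of 1 ?h] by simp
  next
    assume t: "t \<in> {..0}"
    then have "(?h has_real_derivative g' t) (at t within {..0})"
      by (intro has_field_derivative_transform_within[OF g, where d = 1]) (use eq in \<open>auto simp: le_less\<close>)
    then show "(?h has_real_derivative ?D) (at t within {..0})" using t eq by (auto simp: le_less)
  qed auto
  moreover have "{0..} \<union> {..0::real} = UNIV" by auto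
  ultimately show ?thesis by simp
qed

lemma continuous_on_glue_at_0:
  fixes f g :: "real \<Rightarrow> 'a::topological_space"
  assumes "continuous_on {0..} f" "continuous_on {..0} g" "f 0 = g 0"
  shows "continuous_on UNIV (\<lambda>t. if 0 \<le> t then f t else g t)"
proof -
  have "continuous_on ({0..} \<union> {..0}) (\<lambda>t. if 0 \<le> t then f t else g t)"
    by (rule continuous_on_If) (use assms in auto)
  moreover have "{0..} \<union> {..0::real} = UNIV" by auto
  ultimately show ?thesis by simp
qed

context flow_field begin

text \<open>In the coordinates (foot, time) the equation says that \<open>w\<close> is a function
  \<open>F\<close> of the foot plus the integral of \<open>g\<close> along the trajectory. On feet
  \<open>y \<ge> 0\<close> the function \<open>F\<close> is \<open>phi\<close>; on negative feet it
  is determined by the inflow values \<open>b\<close>. As \<open>l 0 t > 0\<close>, the foot of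
  \<open>(0, t)\<close> decreases strictly in \<open>t\<close>, so each such foot belongs to one
  entry time.\<close>

lemma transport_rightward:
  fixes g gx :: "real \<Rightarrow> real \<Rightarrow> real" and phi phi' b b' :: "real \<Rightarrow> real"
  assumes l0: "\<And>t. 0 \<le> t \<Longrightarrow> 0 < l 0 t"
    and g: "continuous_on (UNIV \<times> {0..}) (\<lambda>(x, t). g x t)"
    and gx: "continuous_on (UNIV \<times> {0..}) (\<lambda>(x, t). gx x t)"
    and dg: "\<And>x t. 0 \<le> t \<Longrightarrow> ((\<lambda>x. g x t) has_real_derivative gx x t) (at x)"
    and dphi: "\<And>x. (phi has_real_derivative phi' x) (at x)"
    and phi': "continuous_on UNIV phi'"
    and db: "\<And>t. 0 \<le> t \<Longrightarrow> (b has_real_derivative b' t) (at t within {0..})"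
    and b': "continuous_on {0..} b'"
    and c0: "b 0 = phi 0" and c1: "b' 0 = g 0 0 - l 0 0 * phi' 0"
  shows "\<exists>w wx. (\<forall>x\<ge>0. \<forall>t\<ge>0. ((\<lambda>x. w x t) has_real_derivative wx x t) (at x)) \<and>
    (\<forall>x\<ge>0. \<forall>t\<ge>0. (w x has_real_derivative g x t - l x t * wx x t) (at t within {0..})) \<and>
    continuous_on ({0..} \<times> {0..}) (\<lambda>(x, t). wx x t) \<and>
    (\<forall>x\<ge>0. w x 0 = phi x) \<and> (\<forall>t\<ge>0. w 0 t = b t) \<and>
    (\<forall>x\<ge>0. \<forall>t\<ge>0. ((\<lambda>\<tau>. wx (Phi (Psi x t) \<tau>) \<tau>) has_real_derivative gx x t - lx x t * wx x t) (at t within {0..}))"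
proof -
  note g_comp = continuous_on_compose_pair[OF g] and gx_comp = continuous_on_compose_pair[OF gx]
  \<comment> \<open>\<open>J y t\<close> is the contribution of the source along the trajectory from
    \<open>y\<close>; \<open>Jy\<close> is its derivative in \<open>y\<close> by the Leibniz
    rule.\<close>
  define J where "J = (\<lambda>y t. integral {0..t} (\<lambda>s. g (Phi y s) s))"
  define Jy where "Jy = (\<lambda>y t. integral {0..t} (\<lambda>s. gx (Phi y s) s * E y y s))"
  have J0: "J y 0 = 0" and Jy0: "Jy y 0 = 0" for y by (auto simp: J_def Jy_def)
  have J_t: "(J y has_real_derivative g (Phi y t) t) (at t within {0..})" if "0 \<le> t" for y t
    unfolding J_def
    by (intro has_real_derivative_integral_atLeast g_comp Phi_cont1 continuous_intros that) auto
  have Jy_t: "(Jy y has_real_derivative gx (Phi y t) t * E y y t) (at t within {0..})" if "0 \<le> t" for y t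
    unfolding Jy_def
    by (intro has_real_derivative_integral_atLeast gx_comp Phi_cont1 continuous_intros continuous_on_E_comp that) auto
  have Jy_cont: "continuous_on (UNIV \<times> {0..}) (\<lambda>(y, t). Jy y t)"
    unfolding Jy_def
    by (rule continuous_on_param_integral) (auto simp: split_beta
      intro!: gx_comp continuous_on_Phi_comp continuous_intros continuous_on_E_comp)
  have gP_cont: "continuous_on (A \<times> {0..}) (\<lambda>(y, t). g (Phi y t) t)" for A
    unfolding split_beta by (intro g_comp continuous_on_Phi_comp continuous_intros) auto
  have J_y: "((\<lambda>y. J y t) has_real_derivative Jy y t) (at y)" if t: "0 \<le> t" for y t
  proof -
    have "((\<lambda>y. integral (cbox 0 t) (\<lambda>s. g (Phi y s) s)) has_field_derivative
        integral (cbox 0 t) (\<lambda>s. gx (Phi y s) s * E y y s)) (at y within UNIV)"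
    proof (rule leibniz_rule_field_derivative)
      show "((\<lambda>y. g (Phi y s) s) has_real_derivative gx (Phi y s) s * E y y s) (at y within UNIV)"
        if "s \<in> cbox 0 t" for y s
        using that by (intro DERIV_chain2[OF dg] Phi_deriv_y) auto
      show "(\<lambda>s. g (Phi y s) s) integrable_on cbox 0 t" for y
        by (intro integrable_continuous g_comp continuous_intros continuous_on_subset[OF Phi_cont1]) auto
      show "continuous_on (UNIV \<times> cbox 0 t) (\<lambda>(y, s). gx (Phi y s) s * E y y s)"
        unfolding split_beta by (intro continuous_intros gx_comp continuous_on_Phi_comp continuous_on_E_comp) auto
    qed auto
    then show ?thesis by (simp add: J_def Jy_def)
  qed
  have Jcurve: "((\<lambda>\<tau>. J (\<gamma> \<tau>) \<tau>) has_real_derivative (d * Jy (\<gamma> t) t + g (Phi (\<gamma> t) t) t)) (at t within {0..})"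
    if "0 \<le> t" "(\<gamma> has_real_derivative d) (at t within {0..})" for \<gamma> d t
    unfolding has_real_derivative_iff_has_vector_derivative real_scaleR_def[symmetric]
    by (rule has_vector_derivative_along_curve[where A = UNIV and B = "{0..}" and q = "\<lambda>y t. g (Phi y t) t"])
      (use that J_t J_y gP_cont in \<open>auto simp: has_real_derivative_iff_has_vector_derivative[symmetric]\<close>)

  define \<mu> where "\<mu> = l 0 0"
  have \<mu>: "\<mu> > 0" using l0 by (simp add: \<mu>_def)
  \<comment> \<open>\<open>\<beta> t\<close> is the foot of the trajectory that enters at
    \<open>(0, t)\<close>, and \<open>c t\<close> below is the value that \<open>F\<close> must take
    there for \<open>w 0 t = b t\<close> to hold.\<close>
  define \<beta> where "\<beta> = Psi 0"
  define \<beta>' where "\<beta>' = (\<lambda>t. - l 0 t * Psix 0 t)"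
  have d\<beta>: "(\<beta> has_real_derivative \<beta>' t) (at t within {0..})" if "0 \<le> t" for t
    using Psi_deriv_t[OF that] by (simp add: \<beta>_def \<beta>'_def)
  have \<beta>_cont: "continuous_on {0..} \<beta>" by (simp add: \<beta>_def Psi_cont1)
  have \<beta>'_cont: "continuous_on {0..} \<beta>'"
    unfolding \<beta>'_def by (intro continuous_intros continuous_on_l_comp continuous_on_Psix_comp) auto
  define c where "c = (\<lambda>t. b t - J (\<beta> t) t)"
  define c' where "c' = (\<lambda>t. b' t - (\<beta>' t * Jy (\<beta> t) t + g 0 t))"
  have dc: "(c has_real_derivative c' t) (at t within {0..})" if t: "0 \<le> t" for t
    using Jcurve[OF t d\<beta>[OF t]] db[OF t] t unfolding c_def c'_def
    by (auto intro!: derivative_eq_intros simp: \<beta>_def)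
  have c'_cont: "continuous_on {0..} c'"
  proof -
    have "continuous_on {0..} (\<lambda>t. (\<lambda>(y, t). Jy y t) (\<beta> t, t))"
      by (rule continuous_on_compose2[OF Jy_cont]) (auto intro!: continuous_intros \<beta>_cont)
    then show ?thesis unfolding c'_def
      by (intro continuous_intros b' \<beta>'_cont g_comp) auto
  qed

  \<comment> \<open>One parameter runs through the boundary for \<open>t \<ge> 0\<close> and through
    the initial line for \<open>t < 0\<close>, the latter with speed \<open>\<mu> = l 0 0\<close> so
    that \<open>B\<close> is C1 at 0. The first-order corner condition says exactly that
    \<open>C\<close> is C1 there as well; then \<open>F\<close> is \<open>C\<close> composed with
    the inverse of \<open>B\<close>.\<close>
  define B where "B = (\<lambda>t. if 0 \<le> t then \<beta> t else - \<mu> * t)"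
  define B' where "B' = (\<lambda>t. if 0 \<le> t then \<beta>' t else - \<mu>)"
  define C where "C = (\<lambda>t. if 0 \<le> t then c t else phi (- \<mu> * t))"
  define C' where "C' = (\<lambda>t. if 0 \<le> t then c' t else - \<mu> * phi' (- \<mu> * t))"
  have dB: "(B has_real_derivative B' t) (at t)" for t
    unfolding B_def B'_def
    by (rule has_real_derivative_glue_at_0)
      (use d\<beta> in \<open>auto intro!: derivative_eq_intros simp: \<beta>_def \<beta>'_def \<mu>_def Psix_def\<close>)
  have B'_cont: "continuous_on UNIV B'"
    unfolding B'_def by (rule continuous_on_glue_at_0[OF \<beta>'_cont]) (auto simp: \<beta>'_def \<mu>_def Psix_def)
  have dphi2: "((\<lambda>t. phi (- \<mu> * t)) has_real_derivative - \<mu> * phi' (- \<mu> * t)) (at t within {..0})" for t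
  proof -
    have "((\<lambda>t. - \<mu> * t) has_real_derivative - \<mu>) (at t within {..0})"
      by (auto intro!: derivative_eq_intros)
    from DERIV_chain2[OF dphi this] show ?thesis by (simp add: mult.commute)
  qed
  have c_start: "c 0 = phi 0" "c' 0 = - \<mu> * phi' 0"
    using c0 c1 by (auto simp: c_def c'_def J0 Jy0 \<mu>_def)
  have dC: "(C has_real_derivative C' t) (at t)" for t
    unfolding C_def C'_def
    by (rule has_real_derivative_glue_at_0) (use dc dphi2 c_start in auto)
  have C'_cont: "continuous_on UNIV C'"
    unfolding C'_def
    by (rule continuous_on_glue_at_0)
      (auto simp: c'_cont c_start intro!: continuous_intros continuous_on_compose2[OF phi'])
  have B'_neg: "B' t < 0" for t using \<mu> l0[of t] by (auto simp: B'_def \<beta>'_def)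
  have B_dec: "B s > B t" if "s < t" for s t
    by (rule DERIV_neg_imp_decreasing[OF that]) (use dB B'_neg in blast)
  have B_inj: "inj B"
    by (rule injI) (metis B_dec linorder_neqE_linordered_idom order_less_irrefl)
  have B_isCont: "isCont B t" for t using dB DERIV_isCont by blast
  define \<theta> where "\<theta> = inv B"
  have \<theta>B [simp]: "\<theta> (B t) = t" for t using B_inj by (simp add: \<theta>_def)
  have \<theta>_cont: "isCont \<theta> (B t)" for t
    by (rule isCont_inverse_function[where d = 1]) (use B_isCont in auto)
  have d\<theta>: "(\<theta> has_real_derivative inverse (B' t)) (at (B t))" for t
  proof (rule DERIV_inverse_function[where a = "B (t + 1)" and b = "B (t - 1)"])
    show "(B has_real_derivative B' t) (at (\<theta> (B t)))" using dB by simp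
    show "B' t \<noteq> 0" using B'_neg[of t] by simp
    show "B (t + 1) < B t" "B t < B (t - 1)" using B_dec by auto
    show "isCont \<theta> (B t)" by (rule \<theta>_cont)
    fix y assume y: "B (t + 1) < y" "y < B (t - 1)"
    have "\<exists>s\<ge>t - 1. s \<le> t + 1 \<and> B s = y"
      by (rule IVT2) (use y B_isCont in auto)
    then show "B (\<theta> y) = y" by auto
  qed
  \<comment> \<open>The feet of the boundary points may stay bounded below as \<open>t\<close>
    grows, so \<open>F\<close> is treated only on the range of \<open>B\<close>. By the intermediate
    value theorem this range contains the foot of every \<open>(x, t)\<close> with
    \<open>x \<ge> 0\<close>.\<close>
  define Y where "Y = range B"
  have Y_pos: "y \<in> Y" "\<theta> y = - y / \<mu>" if "0 \<le> y" for y
  proof -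
    have eq: "B (- y / \<mu>) = y"
      using that \<mu> by (auto simp: B_def \<beta>_def field_simps)
    show "y \<in> Y" unfolding Y_def using eq by (metis rangeI)
    show "\<theta> y = - y / \<mu>" using \<theta>B[of "- y / \<mu>"] unfolding eq .
  qed
  have Y_Psi: "Psi x t \<in> Y" if "0 \<le> x" "0 \<le> t" for x t
  proof (cases "0 \<le> Psi x t")
    case False
    have "\<exists>s\<ge>0. s \<le> t \<and> B s = Psi x t"
    proof (rule IVT2)
      show "B t \<le> Psi x t" using Psi_mono[of t 0 x] that by (simp add: B_def \<beta>_def)
      show "Psi x t \<le> B 0" using False by (simp add: B_def \<beta>_def)
    qed (use that B_isCont in auto)
    then show ?thesis unfolding Y_def by (metis rangeI)
  qed (use Y_pos in auto)
  define F where "F = (\<lambda>y. C (\<theta> y))"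
  define F' where "F' = (\<lambda>y. C' (\<theta> y) * inverse (B' (\<theta> y)))"
  have dF: "(F has_real_derivative F' y) (at y)" if y: "y \<in> Y" for y
  proof -
    obtain t where t: "y = B t" using y by (auto simp: Y_def)
    show ?thesis unfolding F_def F'_def t
      using DERIV_chain2[OF dC d\<theta>[of t]] by simp
  qed
  have \<theta>_contY: "continuous_on Y \<theta>"
    unfolding Y_def by (rule continuous_at_imp_continuous_on) (use \<theta>_cont in auto)
  have F'_cont: "continuous_on Y F'"
    unfolding F'_def using B'_neg
    by (intro continuous_intros continuous_on_compose2[OF C'_cont \<theta>_contY]
        continuous_on_compose2[OF B'_cont \<theta>_contY]) (auto simp: less_imp_neq)
  have F_pos: "F y = phi y" if "0 \<le> y" for y
  proof (cases "y = 0")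
    case True then show ?thesis using Y_pos(2)[of 0] c_start by (simp add: F_def C_def)
  next
    case False
    then have "\<theta> y < 0" using Y_pos(2)[OF that] that \<mu> by simp
    then show ?thesis using Y_pos(2)[OF that] \<mu> by (simp add: F_def C_def)
  qed
  have F_\<beta>: "F (\<beta> t) = c t" if "0 \<le> t" for t
    using \<theta>B[of t] that by (simp add: F_def C_def B_def)

  define V where "V = (\<lambda>y t. F y + J y t)"
  define Vy where "Vy = (\<lambda>y t. F' y + Jy y t)"
  have V_y: "((\<lambda>y. V y t) has_real_derivative Vy y t) (at y)" if "0 \<le> t" "y \<in> Y" for y t
    unfolding V_def Vy_def using J_y[OF that(1)] dF[OF that(2)] by (auto intro!: derivative_eq_intros)
  have V_t: "(V y has_real_derivative g (Phi y t) t) (at t within {0..})" if "0 \<le> t" for y t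
    unfolding V_def using J_t[OF that] by (auto intro!: derivative_eq_intros)
  have Vy_cont: "continuous_on (Y \<times> {0..}) (\<lambda>(y, t). Vy y t)"
    unfolding Vy_def split_beta
    by (intro continuous_intros continuous_on_compose2[OF F'_cont]
        continuous_on_subset[OF Jy_cont[unfolded split_beta]]) auto
  define w where "w = (\<lambda>x t. V (Psi x t) t)"
  define wx where "wx = (\<lambda>x t. Vy (Psi x t) t * Psix x t)"
  have w_x: "((\<lambda>x. w x t) has_real_derivative wx x t) (at x)" if "0 \<le> x" "0 \<le> t" for x t
    unfolding w_def wx_def using that by (intro DERIV_chain2[OF V_y] Psi_deriv_x Y_Psi)
  have w_t: "(w x has_real_derivative g x t - l x t * wx x t) (at t within {0..})" if "0 \<le> x" "0 \<le> t" for x t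
  proof -
    have "((\<lambda>\<tau>. V (Psi x \<tau>) \<tau>) has_vector_derivative
        ((- l x t * Psix x t) *\<^sub>R Vy (Psi x t) t + g (Phi (Psi x t) t) t)) (at t within {0..})"
    proof (rule has_vector_derivative_along_curve[where A = Y and B = "{0..}" and q = "\<lambda>y t. g (Phi y t) t"])
      show "((\<lambda>y. V y t) has_vector_derivative Vy (Psi x t) t) (at (Psi x t) within Y)"
        using V_y[OF that(2) Y_Psi[OF that]]
        by (simp add: has_real_derivative_iff_has_vector_derivative has_vector_derivative_at_within)
    qed (use that V_t gP_cont Y_Psi Psi_deriv_t in \<open>auto simp: has_real_derivative_iff_has_vector_derivative[symmetric]\<close>)
    then show ?thesis
      using that by (simp add: w_def wx_def has_real_derivative_iff_has_vector_derivative algebra_simps)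
  qed
  have wx_cont: "continuous_on ({0..} \<times> {0..}) (\<lambda>(x, t). wx x t)"
  proof -
    have "continuous_on ({0..} \<times> {0..}) (\<lambda>p. (\<lambda>(y, t). Vy y t) (Psi (fst p) (snd p), snd p))"
      by (rule continuous_on_compose2[OF Vy_cont]) (auto intro!: continuous_intros continuous_on_Psi_comp Y_Psi)
    then show ?thesis
      unfolding wx_def split_beta by (auto intro!: continuous_intros continuous_on_Psix_comp)
  qed
  \<comment> \<open>With the foot \<open>y\<close> fixed, \<open>wx\<close> becomes
    \<open>Vy y \<tau> / E y y \<tau>\<close>, and both factors are differentiable in time. No
    second derivative in space is formed.\<close>
  have wx_along: "((\<lambda>\<tau>. wx (Phi (Psi x t) \<tau>) \<tau>) has_real_derivative gx x t - lx x t * wx x t) (at t within {0..})"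
    if "0 \<le> x" "0 \<le> t" for x t
  proof -
    define y where "y = Psi x t"
    have "((\<lambda>\<tau>. Vy y \<tau> / E y y \<tau>) has_real_derivative
       (gx (Phi y t) t * E y y t * E y y t - Vy y t * (dq (Phi y t) (Phi y t) t * E y y t)) / (E y y t * E y y t)) (at t within {0..})"
      using Jy_t[OF that(2)] E_deriv[OF that(2)] unfolding Vy_def
      by (auto intro!: derivative_eq_intros)
    also have "(gx (Phi y t) t * E y y t * E y y t - Vy y t * (dq (Phi y t) (Phi y t) t * E y y t)) / (E y y t * E y y t)
        = gx x t - lx x t * wx x t"
      using that by (simp add: y_def wx_def Psix_def field_simps)
    finally have "((\<lambda>\<tau>. Vy y \<tau> / E y y \<tau>) has_real_derivative gx x t - lx x t * wx x t) (at t within {0..})" .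
    then show ?thesis
      by (rule has_field_derivative_transform_within[where d = 1])
        (use that in \<open>auto simp: wx_def Psix_def y_def\<close>)
  qed
  have "w x 0 = phi x" if "0 \<le> x" for x using F_pos[OF that] by (simp add: w_def V_def J0)
  moreover have "w 0 t = b t" if "0 \<le> t" for t
    using F_\<beta>[OF that] by (simp add: w_def V_def c_def \<beta>_def)
  ultimately show ?thesis using w_x w_t wx_cont wx_along by (intro exI[of _ w] exI[of _ wx]) auto
qed

end

section \<open>From the half-line to the strip: extension of data, and reflection for negative
  speeds\<close>

definition clamp01 :: "real \<Rightarrow> real" where
  "clamp01 x = max 0 (min 1 x)"

lemma clamp01_in [simp]: "clamp01 x \<in> {0..1}" "0 \<le> clamp01 x" "clamp01 x \<le> 1"
  and clamp01_id [simp]: "0 \<le> x \<Longrightarrow> x \<le> 1 \<Longrightarrow> clamp01 x = x"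
  by (auto simp: clamp01_def)

lemma clamp01_cont: "continuous_on S clamp01"
  unfolding clamp01_def by (intro continuous_intros)

text \<open>Continuation by the tangents at the two ends. It is C1 on the line with derivative
  \<open>g'\<close> composed with \<open>clamp01\<close>, so every bound on \<open>g'\<close>
  survives.\<close>

definition affine_extension :: "(real \<Rightarrow> real) \<Rightarrow> (real \<Rightarrow> real) \<Rightarrow> real \<Rightarrow> real" where
  "affine_extension g g' x = g (clamp01 x) + (x - clamp01 x) * g' (clamp01 x)"

lemma affine_extension_eq [simp]: "0 \<le> x \<Longrightarrow> x \<le> 1 \<Longrightarrow> affine_extension g g' x = g x"
  by (simp add: affine_extension_def)

lemma has_real_derivative_affine_extension:
  assumes g: "\<And>x. x \<in> {0..1} \<Longrightarrow> (g has_real_derivative g' x) (at x within {0..1})"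
  shows "(affine_extension g g' has_real_derivative g' (clamp01 x)) (at x)"
proof -
  let ?h = "affine_extension g g'"
  have "(?h has_real_derivative g' (clamp01 x)) (at x within ({..0} \<union> {0..1}) \<union> {1..})"
  proof (intro has_real_derivative_Un_closed)
    assume x: "x \<in> {..0}"
    have "((\<lambda>x. g 0 + x * g' 0) has_real_derivative g' 0) (at x within {..0})"
      by (auto intro!: derivative_eq_intros)
    then show "(?h has_real_derivative g' (clamp01 x)) (at x within {..0})"
      by (rule has_field_derivative_transform_within[where d = 1, THEN DERIV_cong])
        (use x in \<open>auto simp: affine_extension_def clamp01_def\<close>)
  next
    assume x: "x \<in> {0..1}"
    show "(?h has_real_derivative g' (clamp01 x)) (at x within {0..1})"
      by (rule has_field_derivative_transform_within[OF g[OF x], where d = 1, THEN DERIV_cong]) (use x in auto)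
  next
    assume x: "x \<in> {1..}"
    have "((\<lambda>x. g 1 + (x - 1) * g' 1) has_real_derivative g' 1) (at x within {1..})"
      by (auto intro!: derivative_eq_intros)
    then show "(?h has_real_derivative g' (clamp01 x)) (at x within {1..})"
      by (rule has_field_derivative_transform_within[where d = 1, THEN DERIV_cong])
        (use x in \<open>auto simp: affine_extension_def clamp01_def\<close>)
  qed auto
  moreover have "({..0} \<union> {0..1}) \<union> {1..} = (UNIV :: real set)" by auto
  ultimately show ?thesis by simp
qed

text \<open>\<open>e\<close> is the inflow end. The last two conjuncts are the corner conditions of
  order zero and one at \<open>(e, 0)\<close>, the second being the value of the time derivative
  which the equation forces there.\<close>

definition transport_data where
  "transport_data l e g gx phi phi' b b' \<longleftrightarrow>
    strip_cont {0..} g \<and>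
    strip_cont {0..} gx \<and>
    (\<forall>x\<in>{0..1}. \<forall>t\<ge>0. ((\<lambda>x. g x t) has_real_derivative gx x t) (at x within {0..1})) \<and>
    (\<forall>x\<in>{0..1}. (phi has_real_derivative phi' x) (at x within {0..1})) \<and>
    continuous_on {0..1} phi' \<and>
    (\<forall>t\<ge>0. (b has_real_derivative b' t) (at t within {0..})) \<and>
    continuous_on {0..} b' \<and> b 0 = phi e \<and> b' 0 = g e 0 - l e 0 * phi' (e::real)"

text \<open>\<open>\<gamma> x t\<close> is the characteristic through \<open>(x, t)\<close>. The third derivative below is the \<open>x\<close>-derivative of the
  transport equation, which makes sense along characteristics although \<open>w\<close> is only \<open>C\<^sup>1\<close>.\<close>

definition transport_solution ::
  "(real \<Rightarrow> real \<Rightarrow> real) \<Rightarrow> (real \<Rightarrow> real \<Rightarrow> real) \<Rightarrow> (real \<Rightarrow> real \<Rightarrow> real \<Rightarrow> real) \<Rightarrow> real \<Rightarrow>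
   (real \<Rightarrow> real \<Rightarrow> real) \<Rightarrow> (real \<Rightarrow> real \<Rightarrow> real) \<Rightarrow> (real \<Rightarrow> real) \<Rightarrow> (real \<Rightarrow> real) \<Rightarrow>
   (real \<Rightarrow> real \<Rightarrow> real) \<Rightarrow> (real \<Rightarrow> real \<Rightarrow> real) \<Rightarrow> bool" where
  "transport_solution l lx \<gamma> e g gx phi b w wx \<longleftrightarrow>
    (\<forall>x\<in>{0..1}. \<forall>t\<ge>0.
      ((\<lambda>x. w x t) has_real_derivative wx x t) (at x within {0..1}) \<and>
      (w x has_real_derivative g x t - l x t * wx x t) (at t within {0..}) \<and>
      ((\<lambda>\<tau>. wx (\<gamma> x t \<tau>) \<tau>) has_real_derivative gx x t - lx x t * wx x t)
        (at t within strip_times (\<gamma> x t))) \<and>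
    strip_cont {0..} wx \<and>
    (\<forall>x\<in>{0..1}. w x 0 = phi x) \<and> (\<forall>t\<ge>0. w e t = b t)"

text \<open>Bundles the characteristics with solvability for all compatible data, so that the later
  arguments see the direction of propagation only through \<open>e\<close>.\<close>

definition transport_solvable where
  "transport_solvable l lx \<gamma> e \<longleftrightarrow>
    (\<forall>x\<in>{0..1}. \<forall>t\<ge>0. \<gamma> x t t = x \<and> (\<gamma> x t has_real_derivative l x t) (at t within {0..})) \<and>
    (\<forall>g gx phi phi' b b'. transport_data l e g gx phi phi' b b' \<longrightarrow>
      (\<exists>w wx. transport_solution l lx \<gamma> e g gx phi b w wx))"

lemma transport_solvable_rightward:
  assumes l: "strip_cont {0..} l"
    and lx: "strip_cont {0..} lx"
    and dl: "\<And>x t. x \<in> {0..1} \<Longrightarrow> 0 \<le> t \<Longrightarrow> ((\<lambda>x. l x t) has_real_derivative lx x t) (at x within {0..1})"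
    and pos: "\<And>x t. x \<in> {0..1} \<Longrightarrow> 0 \<le> t \<Longrightarrow> 0 < l x t"
  shows "\<exists>\<gamma>. transport_solvable l lx \<gamma> 0"
proof -
  have clamp_comp: "continuous_on (UNIV \<times> {0..}) (\<lambda>(x, t). f (clamp01 x) t)"
    if "strip_cont {0..} f" for f :: "real \<Rightarrow> real \<Rightarrow> real"
  proof -
    have "continuous_on (UNIV \<times> {0..}) (\<lambda>p. (\<lambda>(x, t). f x t) (clamp01 (fst p), snd p))"
      by (rule continuous_on_compose2[OF that])
        (auto intro!: continuous_intros continuous_on_compose2[OF clamp01_cont[of UNIV]])
    then show ?thesis by (simp add: split_beta)
  qed
  have ext_comp: "continuous_on (UNIV \<times> {0..}) (\<lambda>(x, t). affine_extension (\<lambda>x. f x t) (\<lambda>x. f' x t) x)"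
    if "strip_cont {0..} f" "strip_cont {0..} f'"
    for f f' :: "real \<Rightarrow> real \<Rightarrow> real"
    using clamp_comp[OF that(1)] clamp_comp[OF that(2)] unfolding affine_extension_def split_beta
    by (intro continuous_intros continuous_on_compose2[OF clamp01_cont[of UNIV]]) auto
  have "\<exists>K. \<forall>x t. 0 \<le> t \<longrightarrow> t \<le> T \<longrightarrow> \<bar>lx (clamp01 x) t\<bar> \<le> K" for T
  proof -
    have "bounded ((\<lambda>(x, t). lx x t) ` ({0..1} \<times> {0..T}))"
      by (intro compact_imp_bounded compact_continuous_image continuous_on_subset[OF lx] compact_Times) auto
    then obtain K where K: "\<And>p. p \<in> {0..1} \<times> {0..T} \<Longrightarrow> norm ((\<lambda>(x, t). lx x t) p) \<le> K"
      unfolding bounded_iff by blast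
    show ?thesis
      using K[of "(clamp01 _, _)"] by (intro exI[of _ K]) auto
  qed
  then obtain L where L: "\<And>x t T. 0 \<le> t \<Longrightarrow> t \<le> T \<Longrightarrow> \<bar>lx (clamp01 x) t\<bar> \<le> L T" by metis
  \<comment> \<open>The extended speed may change sign outside the strip; the construction on the
    half-line asks for its sign at \<open>x = 0\<close> only.\<close>
  define el where "el = (\<lambda>x t. affine_extension (\<lambda>x. l x t) (\<lambda>x. lx x t) x)"
  define elx where "elx = (\<lambda>x t. lx (clamp01 x) t)"
  interpret flow_field el elx L
  proof
    show "continuous_on (UNIV \<times> {0..}) (\<lambda>(x, t). el x t)" unfolding el_def by (rule ext_comp[OF l lx])
    show "continuous_on (UNIV \<times> {0..}) (\<lambda>(x, t). elx x t)" unfolding elx_def by (rule clamp_comp[OF lx])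
    show "((\<lambda>x. el x t) has_real_derivative elx x t) (at x)" if "0 \<le> t" for x t
      unfolding el_def elx_def by (rule has_real_derivative_affine_extension) (use dl that in auto)
    show "\<bar>elx x t\<bar> \<le> L T" if "0 \<le> t" "t \<le> T" for x t T
      unfolding elx_def using L that by auto
  qed
  have el: "el x t = l x t" "elx x t = lx x t" if "0 \<le> x" "x \<le> 1" for x t using that by (auto simp: el_def elx_def)
  define \<gamma> where "\<gamma> = (\<lambda>x t. Phi (Psi x t))"
  have "transport_solvable l lx \<gamma> 0"
    unfolding transport_solvable_def
  proof (intro conjI allI ballI impI)
    fix x t :: real assume x: "x \<in> {0..1}" and t: "0 \<le> t"
    show "\<gamma> x t t = x" using t by (simp add: \<gamma>_def)
    show "(\<gamma> x t has_real_derivative l x t) (at t within {0..})"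
      using Phi_deriv[OF t, of "Psi x t"] t x by (simp add: \<gamma>_def el)
  next
    fix g gx :: "real \<Rightarrow> real \<Rightarrow> real" and phi phi' b b' :: "real \<Rightarrow> real"
    assume "transport_data l 0 g gx phi phi' b b'"
    note D = this[unfolded transport_data_def]
    let ?g = "\<lambda>x t. affine_extension (\<lambda>x. g x t) (\<lambda>x. gx x t) x"
    have "\<exists>w wx. (\<forall>x\<ge>0. \<forall>t\<ge>0. ((\<lambda>x. w x t) has_real_derivative wx x t) (at x)) \<and>
        (\<forall>x\<ge>0. \<forall>t\<ge>0. (w x has_real_derivative ?g x t - el x t * wx x t) (at t within {0..})) \<and>
        continuous_on ({0..} \<times> {0..}) (\<lambda>(x, t). wx x t) \<and>
        (\<forall>x\<ge>0. w x 0 = affine_extension phi phi' x) \<and> (\<forall>t\<ge>0. w 0 t = b t) \<and>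
        (\<forall>x\<ge>0. \<forall>t\<ge>0. ((\<lambda>\<tau>. wx (Phi (Psi x t) \<tau>) \<tau>) has_real_derivative
          gx (clamp01 x) t - elx x t * wx x t) (at t within {0..}))"
    proof (rule transport_rightward[where g = ?g and gx = "\<lambda>x t. gx (clamp01 x) t"
          and phi = "affine_extension phi phi'" and phi' = "\<lambda>x. phi' (clamp01 x)" and b = b and b' = b'])
      show "0 < el 0 t" if "0 \<le> t" for t using pos[of 0 t] that by (simp add: el)
      show "continuous_on (UNIV \<times> {0..}) (\<lambda>(x, t). ?g x t)" using D by (intro ext_comp) auto
      show "continuous_on (UNIV \<times> {0..}) (\<lambda>(x, t). gx (clamp01 x) t)" using D by (intro clamp_comp) auto
      show "((\<lambda>x. ?g x t) has_real_derivative gx (clamp01 x) t) (at x)" if "0 \<le> t" for x t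
        by (rule has_real_derivative_affine_extension) (use D that in auto)
      show "(affine_extension phi phi' has_real_derivative phi' (clamp01 x)) (at x)" for x
        by (rule has_real_derivative_affine_extension) (use D in auto)
      show "continuous_on UNIV (\<lambda>x. phi' (clamp01 x))"
        using D by (intro continuous_on_compose2[OF _ clamp01_cont[of UNIV], of "{0..1}" phi']) auto
      show "(b has_real_derivative b' t) (at t within {0..})" if "0 \<le> t" for t using D that by blast
      show "continuous_on {0..} b'" using D by blast
      show "b 0 = affine_extension phi phi' 0" using D by simp
      show "b' 0 = ?g 0 0 - el 0 0 * phi' (clamp01 0)" using D by (simp add: el)
    qed
    then obtain w wx where w1: "\<forall>x\<ge>0. \<forall>t\<ge>0. ((\<lambda>x. w x t) has_real_derivative wx x t) (at x)"
      and w2: "\<forall>x\<ge>0. \<forall>t\<ge>0. (w x has_real_derivative ?g x t - el x t * wx x t) (at t within {0..})"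
      and w3: "continuous_on ({0..} \<times> {0..}) (\<lambda>(x, t). wx x t)"
      and w4: "\<forall>x\<ge>0. w x 0 = affine_extension phi phi' x" "\<forall>t\<ge>0. w 0 t = b t"
      and w5: "\<forall>x\<ge>0. \<forall>t\<ge>0. ((\<lambda>\<tau>. wx (Phi (Psi x t) \<tau>) \<tau>) has_real_derivative
          gx (clamp01 x) t - elx x t * wx x t) (at t within {0..})"
      by (elim exE conjE)
    have "transport_solution l lx \<gamma> 0 g gx phi b w wx"
      unfolding transport_solution_def
    proof (intro conjI ballI allI impI)
      fix x t :: real assume x: "x \<in> {0..1}" and t: "0 \<le> t"
      show "((\<lambda>x. w x t) has_real_derivative wx x t) (at x within {0..1})"
        by (rule has_field_derivative_at_within) (use w1 x t in auto)
      show "(w x has_real_derivative g x t - l x t * wx x t) (at t within {0..})"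
        using w2[rule_format, of x t] x t by (simp add: el)
      have "((\<lambda>\<tau>. wx (\<gamma> x t \<tau>) \<tau>) has_real_derivative gx x t - lx x t * wx x t) (at t within {0..})"
        using w5[rule_format, of x t] x t by (simp add: el \<gamma>_def)
      then show "((\<lambda>\<tau>. wx (\<gamma> x t \<tau>) \<tau>) has_real_derivative gx x t - lx x t * wx x t)
        (at t within strip_times (\<gamma> x t))"
        by (rule has_field_derivative_subset) auto
    next
      show "strip_cont {0..} wx"
        by (rule continuous_on_subset[OF w3]) auto
    qed (use w4 in auto)
    then show "\<exists>w wx. transport_solution l lx \<gamma> 0 g gx phi b w wx" by blast
  qed
  then show ?thesis by blast
qed

lemma has_real_derivative_reflect:
  assumes "(f has_real_derivative D) (at (1 - x) within {0..1})"
  shows "((\<lambda>x. f (1 - x)) has_real_derivative - D) (at x within {0..1})"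
proof -
  have "(\<lambda>x. 1 - x) ` {0..1} = {0..1::real}" by (auto intro!: image_eqI[of _ _ "1 - _"])
  then have "(f \<circ> (\<lambda>x. 1 - x) has_real_derivative D * (- 1)) (at x within {0..1})"
    using assms by (intro DERIV_image_chain) (auto intro!: derivative_eq_intros)
  then show ?thesis by (simp add: o_def)
qed

lemma continuous_on_reflect:
  fixes f :: "real \<Rightarrow> real \<Rightarrow> real"
  assumes "strip_cont {0..} f"
  shows "strip_cont {0..} (\<lambda>x t. f (1 - x) t)"
proof -
  have "continuous_on ({0..1} \<times> {0..}) (\<lambda>p. (\<lambda>(x, t). f x t) (1 - fst p, snd p))"
    by (rule continuous_on_compose2[OF assms]) (auto intro!: continuous_intros)
  then show ?thesis by (simp add: split_beta)
qed

text \<open>The reflection of \<open>x\<close> to \<open>1 - x\<close> turns the negative speed into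
  the positive speed \<open>- l (1 - x) t\<close>. Derivatives of data and solution in
  \<open>x\<close> change sign; the slope of the speed does not, because the speed is negated
  too.\<close>

lemma transport_solvable_leftward:
  assumes l: "strip_cont {0..} l"
    and lx: "strip_cont {0..} lx"
    and dl: "\<And>x t. x \<in> {0..1} \<Longrightarrow> 0 \<le> t \<Longrightarrow> ((\<lambda>x. l x t) has_real_derivative lx x t) (at x within {0..1})"
    and neg: "\<And>x t. x \<in> {0..1} \<Longrightarrow> 0 \<le> t \<Longrightarrow> l x t < 0"
  shows "\<exists>\<gamma>. transport_solvable l lx \<gamma> 1"
proof -
  have "\<exists>\<gamma>. transport_solvable (\<lambda>x t. - l (1 - x) t) (\<lambda>x t. lx (1 - x) t) \<gamma> 0"
  proof (rule transport_solvable_rightward)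
    show "strip_cont {0..} (\<lambda>x t. - l (1 - x) t)"
      using continuous_on_minus[OF continuous_on_reflect[OF l]] by (simp add: split_beta)
    show "((\<lambda>x. - l (1 - x) t) has_real_derivative lx (1 - x) t) (at x within {0..1})"
      if "x \<in> {0..1}" "0 \<le> t" for x t
      using DERIV_minus[OF has_real_derivative_reflect[OF dl[of "1 - x" t]]] that by simp
  qed (use continuous_on_reflect[OF lx] neg in auto)
  then obtain \<gamma> where \<gamma>: "transport_solvable (\<lambda>x t. - l (1 - x) t) (\<lambda>x t. lx (1 - x) t) \<gamma> 0" by blast
  define \<delta> where "\<delta> = (\<lambda>x t \<tau>. 1 - \<gamma> (1 - x) t \<tau>)"
  have "transport_solvable l lx \<delta> 1"
    unfolding transport_solvable_def
  proof (intro conjI allI ballI impI)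
    fix x t :: real assume x: "x \<in> {0..1}" and t: "0 \<le> t"
    have *: "\<gamma> (1 - x) t t = 1 - x" "(\<gamma> (1 - x) t has_real_derivative - l x t) (at t within {0..})"
      using \<gamma> x t unfolding transport_solvable_def by (auto dest!: bspec[of _ _ "1 - x"])
    show "\<delta> x t t = x" using * by (simp add: \<delta>_def)
    show "(\<delta> x t has_real_derivative l x t) (at t within {0..})"
      unfolding \<delta>_def using * by (auto intro!: derivative_eq_intros)
  next
    fix g gx :: "real \<Rightarrow> real \<Rightarrow> real" and phi phi' b b' :: "real \<Rightarrow> real"
    assume "transport_data l 1 g gx phi phi' b b'"
    note D = this[unfolded transport_data_def]
    have "transport_data (\<lambda>x t. - l (1 - x) t) 0 (\<lambda>x t. g (1 - x) t) (\<lambda>x t. - gx (1 - x) t)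
      (\<lambda>x. phi (1 - x)) (\<lambda>x. - phi' (1 - x)) b b'"
      unfolding transport_data_def
    proof (intro conjI ballI allI impI)
      show "strip_cont {0..} (\<lambda>x t. g (1 - x) t)"
        using D by (intro continuous_on_reflect) blast
      have "strip_cont {0..} gx" using D by blast
      from continuous_on_minus[OF continuous_on_reflect[OF this]]
      show "strip_cont {0..} (\<lambda>x t. - gx (1 - x) t)" by (simp add: split_beta)
      show "((\<lambda>x. g (1 - x) t) has_real_derivative - gx (1 - x) t) (at x within {0..1})"
        if "x \<in> {0..1}" "0 \<le> t" for x t
        using that D by (intro has_real_derivative_reflect) auto
      show "((\<lambda>x. phi (1 - x)) has_real_derivative - phi' (1 - x)) (at x within {0..1})"
        if "x \<in> {0..1}" for x
        using that D by (intro has_real_derivative_reflect) auto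
      show "continuous_on {0..1} (\<lambda>x. - phi' (1 - x))"
        using D by (intro continuous_intros continuous_on_compose2[of "{0..1}" phi' _ "\<lambda>x. 1 - x"]) auto
    qed (use D in auto)
    then obtain w wx where "transport_solution (\<lambda>x t. - l (1 - x) t) (\<lambda>x t. lx (1 - x) t) \<gamma> 0
      (\<lambda>x t. g (1 - x) t) (\<lambda>x t. - gx (1 - x) t) (\<lambda>x. phi (1 - x)) b w wx"
      using \<gamma> unfolding transport_solvable_def by blast
    note W = this[unfolded transport_solution_def]
    have "transport_solution l lx \<delta> 1 g gx phi b (\<lambda>x t. w (1 - x) t) (\<lambda>x t. - wx (1 - x) t)"
      unfolding transport_solution_def
    proof (intro conjI ballI allI impI)
      fix x t :: real assume x: "x \<in> {0..1}" and t: "0 \<le> t"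
      then have x': "1 - x \<in> {0..1}" by auto
      have W': "((\<lambda>x. w x t) has_real_derivative wx (1 - x) t) (at (1 - x) within {0..1})"
        "(w (1 - x) has_real_derivative g x t + l x t * wx (1 - x) t) (at t within {0..})"
        "((\<lambda>\<tau>. wx (\<gamma> (1 - x) t \<tau>) \<tau>) has_real_derivative - gx x t - lx x t * wx (1 - x) t)
          (at t within strip_times (\<gamma> (1 - x) t))"
        using bspec[OF conjunct1[OF W] x'] t by auto
      show "((\<lambda>x. w (1 - x) t) has_real_derivative - wx (1 - x) t) (at x within {0..1})"
        by (rule has_real_derivative_reflect[OF W'(1)])
      show "(w (1 - x) has_real_derivative g x t - l x t * - wx (1 - x) t) (at t within {0..})"
        using W'(2) by simp
      have S: "strip_times (\<delta> x t) = strip_times (\<gamma> (1 - x) t)"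
        by (auto simp: \<delta>_def)
      show "((\<lambda>\<tau>. - wx (1 - \<delta> x t \<tau>) \<tau>) has_real_derivative gx x t - lx x t * - wx (1 - x) t)
        (at t within strip_times (\<delta> x t))"
        unfolding S using DERIV_minus[OF W'(3)] by (simp add: \<delta>_def add.commute)
    next
      have "strip_cont {0..} wx" using W by blast
      from continuous_on_minus[OF continuous_on_reflect[OF this]]
      show "strip_cont {0..} (\<lambda>x t. - wx (1 - x) t)" by (simp add: split_beta)
    qed (use W in auto)
    then show "\<exists>w wx. transport_solution l lx \<delta> 1 g gx phi b w wx" by blast
  qed
  then show ?thesis by blast
qed

section \<open>Weighted estimates\<close>

text \<open>Backwards in time the curve moves towards the inflow end. Strict monotonicity at
  \<open>t\<close> keeps it from crossing the outflow end, even if \<open>x\<close> lies on it, and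
  continuity keeps it off the inflow end for a short time.\<close>

lemma backward_curve_in_strip:
  fixes \<gamma> :: "real \<Rightarrow> real"
  assumes e: "e = 0 \<or> e = 1" and x: "x \<in> {0..1}" "x \<noteq> e" and t: "0 < t"
    and \<gamma>: "\<gamma> t = x" "(\<gamma> has_real_derivative d) (at t within {0..})" and d: "0 < (1 - 2 * e) * d"
  shows "\<exists>\<delta>>0. \<forall>h. 0 < h \<longrightarrow> h < \<delta> \<longrightarrow> 0 \<le> t - h \<and> \<gamma> (t - h) \<in> {0..1}"
proof -
  have "continuous (at t within {0..}) \<gamma>" using \<gamma>(2) by (rule DERIV_continuous)
  moreover have "0 < \<bar>x - e\<bar>" using x by simp
  ultimately obtain r where r: "0 < r" "\<And>s. 0 \<le> s \<Longrightarrow> \<bar>s - t\<bar> < r \<Longrightarrow> \<bar>\<gamma> s - x\<bar> < \<bar>x - e\<bar>"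
    unfolding continuous_within_eps_delta dist_real_def \<gamma>(1)[symmetric] by (metis atLeast_iff)
  show ?thesis
  proof (cases "e = 0")
    case True
    obtain q where q: "0 < q" "\<And>h. 0 < h \<Longrightarrow> t - h \<in> {0..} \<Longrightarrow> h < q \<Longrightarrow> \<gamma> (t - h) < \<gamma> t"
      using has_real_derivative_pos_inc_left[OF \<gamma>(2)] d True by auto
    have "0 \<le> t - h \<and> \<gamma> (t - h) \<in> {0..1}" if h: "0 < h" "h < min t (min r q)" for h
      using q(2)[of h] r(2)[of "t - h"] h x True \<gamma>(1) by (auto simp: abs_if split: if_splits)
    then show ?thesis using t r q by (intro exI[of _ "min t (min r q)"]) auto
  next
    case False
    then have e1: "e = 1" using e by simp
    obtain q where q: "0 < q" "\<And>h. 0 < h \<Longrightarrow> t - h \<in> {0..} \<Longrightarrow> h < q \<Longrightarrow> \<gamma> t < \<gamma> (t - h)"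
      using has_real_derivative_neg_dec_left[OF \<gamma>(2)] d e1 by auto
    have "0 \<le> t - h \<and> \<gamma> (t - h) \<in> {0..1}" if h: "0 < h" "h < min t (min r q)" for h
      using q(2)[of h] r(2)[of "t - h"] h x e1 \<gamma>(1) by (auto simp: abs_if split: if_splits)
    then show ?thesis using t r q by (intro exI[of _ "min t (min r q)"]) auto
  qed
qed

text \<open>\<open>1 - 2 * e\<close> is the sign of the speed and \<open>1 - e\<close> the outflow
  end, so the exponent is \<open>- M * t\<close> at the outflow end and \<open>- a - M * t\<close>
  at the inflow end.\<close>

definition weight :: "real \<Rightarrow> real \<Rightarrow> real \<Rightarrow> real \<Rightarrow> real \<Rightarrow> real" where
  "weight M a e x t = exp (a * (1 - 2 * e) * (x - (1 - e)) - M * t)"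

lemma weight_pos [simp]: "0 < weight M a e x t"
  by (simp add: weight_def)

lemma weight_nonneg [simp]: "0 \<le> weight M a e x t"
  by (simp add: weight_def)

lemma weight_bounds:
  assumes e: "e = 0 \<or> e = (1::real)" and "0 \<le> a" "0 \<le> M" "x \<in> {0..1}" "0 \<le> t" "t \<le> T"
  shows "weight M a e x t \<le> exp (- M * t)" "exp (- a - M * t) \<le> weight M a e x t"
    "weight M a e x t \<le> 1" "exp (- a - M * T) \<le> weight M a e x t"
proof -
  have "- a \<le> a * (1 - 2 * e) * (x - (1 - e))" "a * (1 - 2 * e) * (x - (1 - e)) \<le> 0"
    using e assms by (auto simp: mult_le_0_iff algebra_simps mult_left_le)
  moreover have "0 \<le> M * t" "M * t \<le> M * T" using assms by (auto intro: mult_left_mono)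
  ultimately show "weight M a e x t \<le> exp (- M * t)" "exp (- a - M * t) \<le> weight M a e x t"
    "weight M a e x t \<le> 1" "exp (- a - M * T) \<le> weight M a e x t"
    by (auto simp: weight_def)
qed

text \<open>At a positive maximum the derivative of the weighted function along the characteristic, taken
  backwards in time, is nonnegative; the weight turns this into a bound.\<close>

lemma transport_max_principle:
  fixes w :: "real \<Rightarrow> real \<Rightarrow> real"
  assumes e: "e = 0 \<or> e = 1" and T: "0 \<le> T"
    and w: "strip_cont {0..T} w"
    and \<gamma>: "\<And>x t. x \<in> {0..1} \<Longrightarrow> 0 \<le> t \<Longrightarrow> \<gamma> x t t = x"
      "\<And>x t. x \<in> {0..1} \<Longrightarrow> 0 \<le> t \<Longrightarrow> (\<gamma> x t has_real_derivative l x t) (at t within {0..})"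
    and speed: "\<And>x t. x \<in> {0..1} \<Longrightarrow> 0 \<le> t \<Longrightarrow> t \<le> T \<Longrightarrow> 0 < (1 - 2 * e) * l x t"
      "\<And>x t. x \<in> {0..1} \<Longrightarrow> 0 \<le> t \<Longrightarrow> t \<le> T \<Longrightarrow> (1 - 2 * e) * l x t \<le> \<Lambda>"
    and along: "\<And>x t. x \<in> {0..1} \<Longrightarrow> x \<noteq> e \<Longrightarrow> 0 < t \<Longrightarrow> t \<le> T \<Longrightarrow>
      \<exists>G. ((\<lambda>\<tau>. w (\<gamma> x t \<tau>) \<tau>) has_real_derivative G) (at t within strip_times (\<gamma> x t)) \<and>
        weight M a e x t * \<bar>G\<bar> \<le> N + c * (weight M a e x t * \<bar>w x t\<bar>)"
    and init: "\<And>x. x \<in> {0..1} \<Longrightarrow> weight M a e x 0 * \<bar>w x 0\<bar> \<le> K"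
    and inflow: "\<And>t. 0 < t \<Longrightarrow> t \<le> T \<Longrightarrow> weight M a e e t * \<bar>w e t\<bar> \<le> K"
    and a: "0 \<le> a" and M: "0 < M - a * \<Lambda> - c" and N: "N \<le> K * (M - a * \<Lambda> - c)"
    and xt: "x \<in> {0..1}" "0 \<le> t" "t \<le> T"
  shows "weight M a e x t * \<bar>w x t\<bar> \<le> K"
proof -
  have K: "0 \<le> K"
    by (rule order_trans[OF _ init[of 0]]) auto
  \<comment> \<open>The sign \<open>\<sigma>\<close> treats \<open>w\<close> and \<open>- w\<close>
    together; the absolute value would not be differentiable along the characteristic.\<close>
  have main: "weight M a e x t * (\<sigma> * w x t) \<le> K" if \<sigma>: "\<bar>\<sigma>\<bar> = 1" for \<sigma>
  proof -
    define W where "W = (\<lambda>x t. weight M a e x t * (\<sigma> * w x t))"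
    have "strip_cont {0..T} W"
      using w unfolding W_def weight_def split_beta by (intro continuous_intros) auto
    moreover have "compact ({0..1::real} \<times> {0..T})" "{0..1::real} \<times> {0..T} \<noteq> {}"
      using T by (auto intro: compact_Times)
    ultimately obtain z where z: "z \<in> {0..1} \<times> {0..T}"
      "\<And>p. p \<in> {0..1} \<times> {0..T} \<Longrightarrow> (\<lambda>(x, t). W x t) p \<le> (\<lambda>(x, t). W x t) z"
      using continuous_attains_sup by metis
    obtain y s where ys: "z = (y, s)" "y \<in> {0..1}" "0 \<le> s" "s \<le> T" using z(1) by auto
    have max: "W x t \<le> W y s" if "x \<in> {0..1}" "0 \<le> t" "t \<le> T" for x t
      using z(2)[of "(x, t)"] that ys by auto
    have W_abs: "W x t \<le> weight M a e x t * \<bar>w x t\<bar>" for x t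
      unfolding W_def using \<sigma> by (intro mult_left_mono) (auto simp: abs_if split: if_splits)
    have "W y s \<le> K"
    proof (rule ccontr)
      assume gt: "\<not> W y s \<le> K"
      have s: "0 < s" using gt init[OF ys(2)] W_abs[of y s] ys(3) by (cases "s = 0") auto
      have ye: "y \<noteq> e" using gt inflow[OF s ys(4)] W_abs[of y s] by auto
      let ?A = "strip_times (\<gamma> y s)"
      obtain G where G: "((\<lambda>\<tau>. w (\<gamma> y s \<tau>) \<tau>) has_real_derivative G) (at s within ?A)"
        "weight M a e y s * \<bar>G\<bar> \<le> N + c * (weight M a e y s * \<bar>w y s\<bar>)"
        using along[OF ys(2) ye s ys(4)] by blast
      have gs: "\<gamma> y s s = y" using \<gamma>(1)[OF ys(2,3)] .
      have dg: "(\<gamma> y s has_real_derivative l y s) (at s within ?A)"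
        by (rule has_field_derivative_subset[OF \<gamma>(2)[OF ys(2,3)]]) auto
      \<comment> \<open>The logarithmic derivative of the weight along the characteristic is
        \<open>a\<close> times the absolute speed minus \<open>M\<close>, hence at most
        \<open>a * \<Lambda> - M\<close>. This negative contribution has to beat \<open>N\<close>
        and the term with \<open>c\<close>.\<close>
      define D where "D = weight M a e y s * ((a * ((1 - 2 * e) * l y s) - M) * (\<sigma> * w y s) + \<sigma> * G)"
      have dW: "((\<lambda>\<tau>. W (\<gamma> y s \<tau>) \<tau>) has_real_derivative D) (at s within ?A)"
        unfolding W_def weight_def
        by (rule derivative_eq_intros G(1) dg refl)+ (simp add: D_def weight_def gs algebra_simps)
      have "\<bar>W y s\<bar> = weight M a e y s * \<bar>w y s\<bar>"
        using \<sigma> by (simp add: W_def abs_mult)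
      then have Wabs: "weight M a e y s * \<bar>w y s\<bar> = W y s" using gt K by simp
      have "D = (a * ((1 - 2 * e) * l y s) - M) * W y s + weight M a e y s * (\<sigma> * G)"
        by (simp add: D_def W_def algebra_simps)
      also have "\<dots> \<le> (a * \<Lambda> - M) * W y s + (N + c * W y s)"
      proof (rule add_mono)
        show "(a * ((1 - 2 * e) * l y s) - M) * W y s \<le> (a * \<Lambda> - M) * W y s"
          using gt K a speed(2)[OF ys(2-4)] by (intro mult_right_mono diff_mono mult_left_mono) auto
        have "\<sigma> * G \<le> \<bar>G\<bar>" using \<sigma> by (auto simp: abs_if split: if_splits)
        then have "weight M a e y s * (\<sigma> * G) \<le> weight M a e y s * \<bar>G\<bar>"
          by (intro mult_left_mono) auto
        then show "weight M a e y s * (\<sigma> * G) \<le> N + c * W y s" using G(2) unfolding Wabs by linarith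
      qed
      also have "\<dots> = N - (M - a * \<Lambda> - c) * W y s" by (simp add: algebra_simps)
      also have "\<dots> < 0"
      proof -
        have "K * (M - a * \<Lambda> - c) < (M - a * \<Lambda> - c) * W y s"
          using gt M by (simp add: mult.commute)
        then show ?thesis using N by linarith
      qed
      finally have "D < 0" .
      \<comment> \<open>A negative derivative means larger values at slightly earlier times on the
        characteristic, and these points still lie in the strip, against maximality of
        \<open>W y s\<close>.\<close>
      then obtain q where q: "0 < q" "\<And>h. 0 < h \<Longrightarrow> s - h \<in> ?A \<Longrightarrow> h < q \<Longrightarrow> W (\<gamma> y s s) s < W (\<gamma> y s (s - h)) (s - h)"
        using has_real_derivative_neg_dec_left[OF dW] by blast
      obtain r where r: "0 < r" "\<And>h. 0 < h \<Longrightarrow> h < r \<Longrightarrow> 0 \<le> s - h \<and> \<gamma> y s (s - h) \<in> {0..1}"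
        using backward_curve_in_strip[OF e ys(2) ye s gs \<gamma>(2)[OF ys(2,3)] speed(1)[OF ys(2-4)]] by blast
      define h where "h = min q r / 2"
      have h: "0 < h" "h < q" "h < r" using q r by (auto simp: h_def)
      have "W y s < W (\<gamma> y s (s - h)) (s - h)" using q(2)[of h] r(2)[of h] h gs by auto
      moreover have "W (\<gamma> y s (s - h)) (s - h) \<le> W y s"
        using r(2)[of h] h ys by (intro max) auto
      ultimately show False by simp
    qed
    then show ?thesis using max[OF xt] by (simp add: W_def)
  qed
  show ?thesis
  proof (cases "0 \<le> w x t")
    case True then show ?thesis using main[of 1] by simp
  next
    case False then show ?thesis using main[of "-1"] by simp
  qed
qed

text \<open>The common form of all estimates of one step from \<open>z\<close> to \<open>w\<close>:
  \<open>c\<close> weighs the new function itself, \<open>F\<close> the old one at the same point,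
  \<open>H\<close> the old one at the outflow ends, and \<open>\<epsilon>\<close> collects the
  perturbations. It applies to differences of iterates and also to their
  \<open>x\<close>-derivatives.\<close>

definition transport_ineq ::
  "real \<Rightarrow> ('n::finite \<Rightarrow> real) \<Rightarrow> ('n \<Rightarrow> real \<Rightarrow> real \<Rightarrow> real \<Rightarrow> real) \<Rightarrow> real \<Rightarrow> real \<Rightarrow> real \<Rightarrow> real \<Rightarrow>
   (real \<Rightarrow> real \<Rightarrow> real ^ 'n) \<Rightarrow> (real \<Rightarrow> real \<Rightarrow> real ^ 'n) \<Rightarrow> bool" where
  "transport_ineq T e \<gamma> c F H \<epsilon> w z \<longleftrightarrow>
    strip_cont {0..T} w \<and>
    (\<forall>i. \<forall>x\<in>{0..1}. \<forall>t\<in>{0<..T}. x \<noteq> e i \<longrightarrow>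
      (\<exists>G. ((\<lambda>\<tau>. w (\<gamma> i x t \<tau>) \<tau> $ i) has_real_derivative G) (at t within strip_times (\<gamma> i x t)) \<and>
        \<bar>G\<bar> \<le> c * \<bar>w x t $ i\<bar> + F * (\<Sum>j\<in>UNIV. \<bar>z x t $ j\<bar>) + \<epsilon>)) \<and>
    (\<forall>i. \<forall>x\<in>{0..1}. \<bar>w x 0 $ i\<bar> \<le> \<epsilon>) \<and>
    (\<forall>i. \<forall>t\<in>{0<..T}. \<bar>w (e i) t $ i\<bar> \<le> H * (\<Sum>j\<in>UNIV. \<bar>z (1 - e j) t $ j\<bar>) + \<epsilon>)"

section \<open>The contraction in the weighted sup norm and its consequences\<close>

locale strip_system =
  fixes T :: real and e :: "'n::finite \<Rightarrow> real" and \<gamma> :: "'n \<Rightarrow> real \<Rightarrow> real \<Rightarrow> real \<Rightarrow> real"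
    and l :: "'n \<Rightarrow> real \<Rightarrow> real \<Rightarrow> real" and \<Lambda> c F H :: real
  assumes T: "0 \<le> T" and e: "\<And>i. e i = 0 \<or> e i = 1"
    and \<gamma>_start: "\<And>i x t. x \<in> {0..1} \<Longrightarrow> 0 \<le> t \<Longrightarrow> \<gamma> i x t t = x"
    and \<gamma>_deriv: "\<And>i x t. x \<in> {0..1} \<Longrightarrow> 0 \<le> t \<Longrightarrow> (\<gamma> i x t has_real_derivative l i x t) (at t within {0..})"
    and speed_pos: "\<And>i x t. x \<in> {0..1} \<Longrightarrow> 0 \<le> t \<Longrightarrow> t \<le> T \<Longrightarrow> 0 < (1 - 2 * e i) * l i x t"
    and speed_le: "\<And>i x t. x \<in> {0..1} \<Longrightarrow> 0 \<le> t \<Longrightarrow> t \<le> T \<Longrightarrow> (1 - 2 * e i) * l i x t \<le> \<Lambda>"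
    and c: "0 \<le> c" and F: "0 \<le> F" and H: "0 \<le> H"
begin

text \<open>\<open>a\<close> makes \<open>exp (- a) * (H * n)\<close> at most 1/2, where
  \<open>n\<close> is the number of components; the summand 1 under the logarithm gives
  \<open>a \<ge> 0\<close>. \<open>M\<close> is chosen so that \<open>M - a * \<Lambda> - c\<close>
  equals \<open>2 * F * n * exp a + 1\<close>: the first part halves the interior influence of the
  old function, the 1 absorbs \<open>\<epsilon>\<close> and keeps the difference positive.\<close>

definition a :: real where "a = ln (2 * H * real CARD('n) + 1)"
definition M :: real where "M = a * \<Lambda> + c + 2 * F * real CARD('n) * exp a + 1"
definition wt :: "'n \<Rightarrow> real \<Rightarrow> real \<Rightarrow> real" where "wt i = weight M a (e i)"

lemma \<Lambda>_nonneg: "0 \<le> \<Lambda>"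
proof -
  have "0 < (1 - 2 * e undefined) * l undefined 0 0" "(1 - 2 * e undefined) * l undefined 0 0 \<le> \<Lambda>"
    using T by (auto intro: speed_pos speed_le)
  then show ?thesis by linarith
qed

lemma a_nonneg: "0 \<le> a"
  using H by (simp add: a_def)

lemma exp_a: "exp (- a) * (H * real CARD('n)) \<le> 1 / 2"
  using H by (simp add: a_def exp_minus field_simps add_pos_nonneg)

lemma M_nonneg: "0 \<le> M"
  using a_nonneg \<Lambda>_nonneg c F by (simp add: M_def)

lemma wt_pos [simp]: "0 < wt i x t" by (simp add: wt_def)

lemma wt_nonneg [simp]: "0 \<le> wt i x t" by (simp add: wt_def)

lemma wt_bounds:
  assumes "x \<in> {0..1}" "0 \<le> t" "t \<le> T"
  shows "wt i x t \<le> exp (- M * t)" "exp (- a - M * t) \<le> wt i x t" "wt i x t \<le> 1"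
    "exp (- a - M * T) \<le> wt i x t"
  using weight_bounds[OF e a_nonneg M_nonneg assms] by (auto simp: wt_def)

definition wbound :: "real \<Rightarrow> (real \<Rightarrow> real \<Rightarrow> real ^ 'n) \<Rightarrow> bool" where
  "wbound B z \<longleftrightarrow> (\<forall>i. \<forall>x\<in>{0..1}. \<forall>t\<in>{0..T}. wt i x t * \<bar>z x t $ i\<bar> \<le> B)"

lemma wbound_mono: "wbound B z \<Longrightarrow> B \<le> B' \<Longrightarrow> wbound B' z"
  unfolding wbound_def by (meson order_trans)

lemma wboundD: "wbound B z \<Longrightarrow> x \<in> {0..1} \<Longrightarrow> 0 \<le> t \<Longrightarrow> t \<le> T \<Longrightarrow> \<bar>z x t $ i\<bar> \<le> B * exp (a + M * T)"
proof -
  assume a: "wbound B z" "x \<in> {0..1}" "0 \<le> t" "t \<le> T"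
  have "exp (- a - M * T) * \<bar>z x t $ i\<bar> \<le> wt i x t * \<bar>z x t $ i\<bar>"
    using wt_bounds(4)[OF a(2-4)] by (intro mult_right_mono) auto
  also have "\<dots> \<le> B" using a by (auto simp: wbound_def)
  finally have "exp (a + M * T) * (exp (- a - M * T) * \<bar>z x t $ i\<bar>) \<le> exp (a + M * T) * B"
    by (intro mult_left_mono) auto
  moreover have "exp (a + M * T) * (exp (- a - M * T) * r) = r" for r
    by (simp flip: mult.assoc exp_add)
  ultimately show ?thesis by (simp only: mult.commute)
qed

lemma wbound_nonneg: "wbound B z \<Longrightarrow> 0 \<le> B"
proof -
  assume "wbound B z"
  then have "wt undefined 0 0 * \<bar>z 0 0 $ undefined\<bar> \<le> B" using T by (auto simp: wbound_def)
  then show "0 \<le> B" by (rule order_trans[rotated]) simp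
qed

lemma wboundI:
  assumes "\<And>i x t. x \<in> {0..1} \<Longrightarrow> 0 \<le> t \<Longrightarrow> t \<le> T \<Longrightarrow> \<bar>z x t $ i\<bar> \<le> B"
  shows "wbound B z"
  unfolding wbound_def
proof (intro allI ballI)
  fix i x t assume xt: "x \<in> {0..1::real}" "t \<in> {0..T}"
  have "wt i x t * \<bar>z x t $ i\<bar> \<le> 1 * \<bar>z x t $ i\<bar>"
    using wt_bounds(3)[of x t i] xt by (intro mult_right_mono) auto
  then show "wt i x t * \<bar>z x t $ i\<bar> \<le> B" using assms[of x t i] xt by auto
qed

text \<open>The maximum principle with \<open>K = B / 2 + \<epsilon>\<close>. At the inflow end the
  weight ratio gives the factor 1/2, in the interior the size of \<open>M\<close> does.\<close>

lemma wbound_step: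
  assumes ineq: "transport_ineq T e \<gamma> c F H \<epsilon> w z" and B: "wbound B z" and \<epsilon>: "0 \<le> \<epsilon>"
  shows "wbound (B / 2 + \<epsilon>) w"
  unfolding wbound_def
proof (intro allI ballI)
  fix i x t assume xt: "x \<in> {0..1::real}" "t \<in> {0..T}"
  let ?n = "real CARD('n)"
  note I = ineq[unfolded transport_ineq_def]
  note B0 = wbound_nonneg[OF B]
  \<comment> \<open>The components carry different weights, growing in opposite directions; at a
    common point their ratio is at most \<open>exp a\<close>, which is where this factor in
    \<open>M\<close> comes from.\<close>
  have zB: "wt i x t * (\<Sum>j\<in>UNIV. \<bar>z x t $ j\<bar>) \<le> ?n * (exp a * B)"
    if "x \<in> {0..1}" "0 \<le> t" "t \<le> T" for x t i
  proof -
    have "wt i x t * \<bar>z x t $ j\<bar> \<le> exp a * B" for j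
    proof -
      have "wt i x t \<le> exp (- M * t)" by (rule wt_bounds[OF that])
      also have "\<dots> = exp a * exp (- a - M * t)" by (simp add: exp_add[symmetric])
      also have "\<dots> \<le> exp a * wt j x t"
        using wt_bounds(2)[OF that] by (intro mult_left_mono) auto
      finally have "wt i x t * \<bar>z x t $ j\<bar> \<le> exp a * wt j x t * \<bar>z x t $ j\<bar>"
        by (intro mult_right_mono) auto
      also have "\<dots> = exp a * (wt j x t * \<bar>z x t $ j\<bar>)" by simp
      also have "\<dots> \<le> exp a * B"
        using B that by (intro mult_left_mono) (auto simp: wbound_def)
      finally show ?thesis .
    qed
    then show ?thesis
      unfolding sum_distrib_left
      using sum_bounded_above[of UNIV "\<lambda>j. wt i x t * \<bar>z x t $ j\<bar>" "exp a * B"] by simp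
  qed
  show "wt i x t * \<bar>w x t $ i\<bar> \<le> B / 2 + \<epsilon>"
    unfolding wt_def
  proof (rule transport_max_principle[where \<gamma> = "\<gamma> i" and l = "l i" and T = T and w = "\<lambda>x t. w x t $ i"
        and \<Lambda> = \<Lambda> and c = c and N = "F * (?n * (exp a * B)) + \<epsilon>"])
    show "e i = 0 \<or> e i = 1" by (rule e)
    have "strip_cont {0..T} w" using I by blast
    from continuous_on_component[OF this, of i]
    show "strip_cont {0..T} (\<lambda>x t. w x t $ i)" by (simp add: split_beta)
    fix x t assume xt: "x \<in> {0..1}" "x \<noteq> e i" "0 < t" "t \<le> T"
    then obtain G where G: "((\<lambda>\<tau>. w (\<gamma> i x t \<tau>) \<tau> $ i) has_real_derivative G) (at t within strip_times (\<gamma> i x t))"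
        "\<bar>G\<bar> \<le> c * \<bar>w x t $ i\<bar> + F * (\<Sum>j\<in>UNIV. \<bar>z x t $ j\<bar>) + \<epsilon>"
      using I[THEN conjunct2, THEN conjunct1, THEN spec, of i, THEN bspec, of x, THEN bspec, of t] by auto
    have "wt i x t * \<bar>G\<bar> \<le> wt i x t * (c * \<bar>w x t $ i\<bar> + F * (\<Sum>j\<in>UNIV. \<bar>z x t $ j\<bar>) + \<epsilon>)"
      using G(2) by (intro mult_left_mono) auto
    also have "\<dots> = c * (wt i x t * \<bar>w x t $ i\<bar>) + F * (wt i x t * (\<Sum>j\<in>UNIV. \<bar>z x t $ j\<bar>)) + wt i x t * \<epsilon>"
      by (simp add: algebra_simps)
    also have "\<dots> \<le> c * (wt i x t * \<bar>w x t $ i\<bar>) + F * (?n * (exp a * B)) + 1 * \<epsilon>"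
      using zB[of x t i] F c \<epsilon> xt wt_bounds(3)[of x t i] by (intro add_mono mult_left_mono mult_right_mono) auto
    finally show "\<exists>G. ((\<lambda>\<tau>. w (\<gamma> i x t \<tau>) \<tau> $ i) has_real_derivative G) (at t within strip_times (\<gamma> i x t)) \<and>
        weight M a (e i) x t * \<bar>G\<bar> \<le> F * (?n * (exp a * B)) + \<epsilon> + c * (weight M a (e i) x t * \<bar>w x t $ i\<bar>)"
      using G(1) by (intro exI[of _ G]) (auto simp: wt_def)
  next
    fix x :: real assume x: "x \<in> {0..1}"
    have "wt i x 0 * \<bar>w x 0 $ i\<bar> \<le> 1 * \<epsilon>"
      using I x wt_bounds(3)[of x 0 i] T by (intro mult_mono) auto
    then show "weight M a (e i) x 0 * \<bar>w x 0 $ i\<bar> \<le> B / 2 + \<epsilon>" using B0 by (simp add: wt_def)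
  next
    fix t assume t: "0 < t" "t \<le> T"
    have e01: "e j \<in> {0..1}" "1 - e j \<in> {0..1}" for j using e[of j] by auto
    \<comment> \<open>No loss \<open>exp a\<close> occurs here: each component is taken at its own
      outflow end, where all weights equal \<open>exp (- M * t)\<close>.\<close>
    have zb: "exp (- M * t) * (\<Sum>j\<in>UNIV. \<bar>z (1 - e j) t $ j\<bar>) \<le> ?n * B"
    proof -
      have "exp (- M * t) * \<bar>z (1 - e j) t $ j\<bar> \<le> B" for j
      proof -
        have "wt j (1 - e j) t * \<bar>z (1 - e j) t $ j\<bar> \<le> B"
          using B t e01(2)[of j] unfolding wbound_def by (meson atLeastAtMost_iff less_imp_le)
        then show ?thesis by (simp add: wt_def weight_def)
      qed
      then show ?thesis
        unfolding sum_distrib_left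
        using sum_bounded_above[of UNIV "\<lambda>j. exp (- M * t) * \<bar>z (1 - e j) t $ j\<bar>" B] by simp
    qed
    have we: "wt i (e i) t = exp (- a) * exp (- M * t)"
      using e[of i] by (auto simp: wt_def weight_def exp_add[symmetric])
    have "wt i (e i) t * \<bar>w (e i) t $ i\<bar> \<le> wt i (e i) t * (H * (\<Sum>j\<in>UNIV. \<bar>z (1 - e j) t $ j\<bar>) + \<epsilon>)"
      using I t by (intro mult_left_mono) auto
    also have "\<dots> = exp (- a) * H * (exp (- M * t) * (\<Sum>j\<in>UNIV. \<bar>z (1 - e j) t $ j\<bar>)) + wt i (e i) t * \<epsilon>"
      by (simp add: we algebra_simps)
    also have "\<dots> \<le> exp (- a) * H * (?n * B) + 1 * \<epsilon>"
      using zb H \<epsilon> t e01(1)[of i] wt_bounds(3)[of "e i" t i] by (intro add_mono mult_left_mono mult_right_mono) auto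
    also have "exp (- a) * H * (?n * B) = exp (- a) * (H * ?n) * B" by simp
    also have "\<dots> \<le> 1 / 2 * B" using exp_a B0 by (intro mult_right_mono) auto
    finally show "weight M a (e i) (e i) t * \<bar>w (e i) t $ i\<bar> \<le> B / 2 + \<epsilon>" by (simp add: wt_def)
  next
    have m: "M - a * \<Lambda> - c = 2 * F * ?n * exp a + 1" by (simp add: M_def)
    show "0 < M - a * \<Lambda> - c" unfolding m using F by (simp add: add_nonneg_pos)
    have "0 \<le> \<epsilon> * (2 * F * ?n * exp a)" using \<epsilon> F by simp
    then show "F * (?n * (exp a * B)) + \<epsilon> \<le> (B / 2 + \<epsilon>) * (M - a * \<Lambda> - c)"
      unfolding m using B0 by (simp add: algebra_simps)
  qed (use T \<gamma>_start \<gamma>_deriv speed_pos speed_le a_nonneg xt in auto)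
qed

lemma continuous_wbound:
  assumes "strip_cont {0..T} z"
  shows "\<exists>B. wbound B z"
proof -
  have "bounded ((\<lambda>(x, t). z x t) ` ({0..1} \<times> {0..T}))"
    by (intro compact_imp_bounded compact_continuous_image assms compact_Times) auto
  then obtain B where B: "\<And>p. p \<in> {0..1} \<times> {0..T} \<Longrightarrow> norm ((\<lambda>(x, t). z x t) p) \<le> B"
    unfolding bounded_iff by blast
  have "wbound B z"
  proof (rule wboundI)
    fix i x t assume "x \<in> {0..1::real}" "0 \<le> t" "t \<le> T"
    then show "\<bar>z x t $ i\<bar> \<le> B"
      using B[of "(x, t)"] component_le_norm_cart[of "z x t" i] by auto
  qed
  then show ?thesis by blast
qed

lemma transport_ineq_geometric:
  assumes "\<And>m. transport_ineq T e \<gamma> c F H 0 (z (Suc m)) (z m)" and "wbound B (z 0)"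
  shows "wbound (B / 2 ^ m) (z m)"
proof (induction m)
  case (Suc m)
  from wbound_step[OF assms(1) Suc] show ?case by (simp add: mult.commute)
qed (use assms in auto)

text \<open>A function that is its own successor has its weighted bound halved arbitrarily
  often.\<close>

lemma transport_ineq_unique:
  assumes ineq: "transport_ineq T e \<gamma> c F H 0 w w" and xt: "x \<in> {0..1}" "0 \<le> t" "t \<le> T"
  shows "w x t = 0"
proof -
  obtain B where "wbound B w"
    using continuous_wbound ineq unfolding transport_ineq_def by blast
  then have B: "wbound (B / 2 ^ m) w" for m
    using transport_ineq_geometric[of "\<lambda>_. w" B m] ineq by simp
  have "\<bar>w x t $ i\<bar> \<le> 0" for i
  proof (rule LIMSEQ_le_const)
    show "(\<lambda>m. B / 2 ^ m * exp (a + M * T)) \<longlonglongrightarrow> 0"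
      using tendsto_mult_left_zero[OF LIMSEQ_divide_realpow_zero[of 2 B]] by simp
    show "\<exists>N. \<forall>m\<ge>N. \<bar>w x t $ i\<bar> \<le> B / 2 ^ m * exp (a + M * T)"
      using wboundD[OF B xt] by blast
  qed
  then show ?thesis by (simp add: vec_eq_iff)
qed

text \<open>\<open>max B (2 * \<epsilon>)\<close> is not increased by the map taking
  \<open>B\<close> to \<open>B / 2 + \<epsilon>\<close>.\<close>

lemma transport_ineq_bounded:
  assumes "\<And>m. transport_ineq T e \<gamma> c F H \<epsilon> (z (Suc m)) (z m)" and z0: "wbound B (z 0)" and \<epsilon>: "0 \<le> \<epsilon>"
  shows "wbound (max B (2 * \<epsilon>)) (z m)"
proof (induction m)
  case 0
  show ?case using z0 unfolding wbound_def by (auto simp: le_max_iff_disj)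
next
  case (Suc m)
  have "max B (2 * \<epsilon>) / 2 + \<epsilon> \<le> max B (2 * \<epsilon>)" by linarith
  with wbound_step[OF assms(1) Suc \<epsilon>] show ?case by (rule wbound_mono)
qed

text \<open>The perturbation is small only for late indices, and without a rate. So the bound
  \<open>B\<close> is accepted at a late index \<open>m0\<close> and then contracted, uniformly in
  the gap \<open>k\<close>.\<close>

lemma transport_ineq_Cauchy:
  assumes ineq: "\<And>\<delta>. 0 < \<delta> \<Longrightarrow> \<exists>m0. \<forall>m\<ge>m0. \<forall>k. transport_ineq T e \<gamma> c F H \<delta>
      (\<lambda>x t. p (Suc m + k) x t - p (Suc m) x t) (\<lambda>x t. p (m + k) x t - p m x t)"
    and B: "\<And>m. wbound B (p m)" and \<eta>: "0 < \<eta>"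
  shows "\<exists>m0. \<forall>m\<ge>m0. \<forall>k. wbound \<eta> (\<lambda>x t. p (m + k) x t - p m x t)"
proof -
  note B0 = wbound_nonneg[OF B]
  obtain m0 where m0: "\<And>m k. m \<ge> m0 \<Longrightarrow> transport_ineq T e \<gamma> c F H (\<eta> / 4)
      (\<lambda>x t. p (Suc m + k) x t - p (Suc m) x t) (\<lambda>x t. p (m + k) x t - p m x t)"
    using ineq[of "\<eta> / 4"] \<eta> by auto
  \<comment> \<open>The map \<open>b / 2 + \<eta> / 4\<close> has the fixed point
    \<open>\<eta> / 2\<close>, and the excess over it halves with each step; \<open>2 * B\<close>
    bounds the difference of two functions at the start.\<close>
  have main: "wbound (2 * B / 2 ^ j + \<eta> / 2) (\<lambda>x t. p (m0 + j + k) x t - p (m0 + j) x t)" for j k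
  proof (induction j)
    case 0
    show ?case
      unfolding wbound_def
    proof (intro allI ballI)
      fix i x t assume xt: "x \<in> {0..1::real}" "t \<in> {0..T}"
      have "wt i x t * \<bar>(p (m0 + 0 + k) x t - p (m0 + 0) x t) $ i\<bar>
          \<le> wt i x t * (\<bar>p (m0 + k) x t $ i\<bar> + \<bar>p m0 x t $ i\<bar>)"
        by (intro mult_left_mono) (auto simp: less_imp_le)
      also have "\<dots> \<le> B + B"
        unfolding distrib_left using B xt by (intro add_mono) (auto simp: wbound_def)
      finally show "wt i x t * \<bar>(p (m0 + 0 + k) x t - p (m0 + 0) x t) $ i\<bar> \<le> 2 * B / 2 ^ 0 + \<eta> / 2"
        using \<eta> by simp
    qed
  next
    case (Suc j)
    have "2 * B / 2 ^ Suc j + \<eta> / 2 = (2 * B / 2 ^ j + \<eta> / 2) / 2 + \<eta> / 4"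
      by (simp add: field_simps)
    then show ?case
      using wbound_step[OF m0[of "m0 + j" k] Suc] \<eta> by simp
  qed
  have "(\<lambda>j. 2 * B / 2 ^ j) \<longlonglongrightarrow> 0" by (rule LIMSEQ_divide_realpow_zero) simp
  then have "\<forall>\<^sub>F j in sequentially. 2 * B / 2 ^ j < \<eta> / 2"
    by (rule order_tendstoD(2)) (use \<eta> in simp)
  then obtain j0 where j0: "\<And>j. j \<ge> j0 \<Longrightarrow> 2 * B / 2 ^ j < \<eta> / 2"
    unfolding eventually_sequentially by blast
  show ?thesis
  proof (intro exI allI impI)
    fix m k assume "m0 + j0 \<le> m"
    then have "wbound (2 * B / 2 ^ (m - m0) + \<eta> / 2) (\<lambda>x t. p (m + k) x t - p m x t)" "2 * B / 2 ^ (m - m0) < \<eta> / 2"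
      using main[of "m - m0" k] j0[of "m - m0"] by auto
    then show "wbound \<eta> (\<lambda>x t. p (m + k) x t - p m x t)"
      by (elim wbound_mono) linarith
  qed
qed

end

section \<open>Convergence of linear recursions\<close>

text \<open>Boundedness is included because it places all values in one compact ball, where a
  continuous map is uniformly continuous; without it the notion would not survive composition as in
  \<open>ucb_compose\<close>.\<close>

definition ucb :: "'a set \<Rightarrow> (nat \<Rightarrow> 'a \<Rightarrow> 'b::real_normed_vector) \<Rightarrow> bool" where
  "ucb X U \<longleftrightarrow> uniformly_Cauchy_on X U \<and> (\<exists>C. \<forall>m. \<forall>x\<in>X. norm (U m x) \<le> C)"

lemma ucb_compose:
  fixes \<Phi> :: "'a::metric_space \<Rightarrow> 'b::euclidean_space \<Rightarrow> 'c::real_normed_vector"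
  assumes X: "compact X" and \<Phi>: "continuous_on (X \<times> UNIV) (\<lambda>(x, y). \<Phi> x y)" and U: "ucb X U"
  shows "ucb X (\<lambda>m x. \<Phi> x (U m x))"
proof -
  obtain C where C: "\<And>m x. x \<in> X \<Longrightarrow> norm (U m x) \<le> C" using U by (auto simp: ucb_def)
  let ?K = "X \<times> cball (0::'b) C"
  have K: "compact ?K" using X by (intro compact_Times compact_cball)
  have c: "continuous_on ?K (\<lambda>(x, y). \<Phi> x y)" by (rule continuous_on_subset[OF \<Phi>]) auto
  have inK: "(x, U m x) \<in> ?K" if "x \<in> X" for x m using C that by auto
  show ?thesis
    unfolding ucb_def
  proof
    have "bounded ((\<lambda>(x, y). \<Phi> x y) ` ?K)"
      by (intro compact_imp_bounded compact_continuous_image c K)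
    then obtain D where "\<And>p. p \<in> ?K \<Longrightarrow> norm ((\<lambda>(x, y). \<Phi> x y) p) \<le> D"
      unfolding bounded_iff by blast
    then show "\<exists>C. \<forall>m. \<forall>x\<in>X. norm (\<Phi> x (U m x)) \<le> C"
      using inK by (intro exI[of _ D]) fastforce
    show "uniformly_Cauchy_on X (\<lambda>m x. \<Phi> x (U m x))"
      unfolding uniformly_Cauchy_on_def
    proof (intro allI impI)
      fix \<epsilon> :: real assume "0 < \<epsilon>"
      then obtain \<delta> where \<delta>: "0 < \<delta>"
        "\<And>p p'. p \<in> ?K \<Longrightarrow> p' \<in> ?K \<Longrightarrow> dist p' p < \<delta> \<Longrightarrow> dist ((\<lambda>(x, y). \<Phi> x y) p') ((\<lambda>(x, y). \<Phi> x y) p) < \<epsilon>"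
        using uniformly_continuous_onE[OF compact_uniformly_continuous[OF c K]] by metis
      obtain M where M: "\<And>x m n. x \<in> X \<Longrightarrow> M \<le> m \<Longrightarrow> M \<le> n \<Longrightarrow> dist (U m x) (U n x) < \<delta>"
        using U \<delta>(1) unfolding ucb_def uniformly_Cauchy_on_def by blast
      have "dist (\<Phi> x (U m x)) (\<Phi> x (U n x)) < \<epsilon>" if "x \<in> X" "M \<le> m" "M \<le> n" for x m n
        using \<delta>(2)[OF inK[OF that(1)] inK[OF that(1)], of m n] M[OF that] by (simp add: dist_Pair_Pair)
      then show "\<exists>M. \<forall>x\<in>X. \<forall>m\<ge>M. \<forall>n\<ge>M. dist (\<Phi> x (U m x)) (\<Phi> x (U n x)) < \<epsilon>" by blast
    qed
  qed
qed

lemma ucb_Pair: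
  assumes "ucb X U" "ucb X V" shows "ucb X (\<lambda>m x. (U m x, V m x))"
  unfolding ucb_def
proof
  obtain C where "\<And>m x. x \<in> X \<Longrightarrow> norm (U m x) \<le> C" using assms(1) by (auto simp: ucb_def)
  moreover obtain D where "\<And>m x. x \<in> X \<Longrightarrow> norm (V m x) \<le> D" using assms(2) by (auto simp: ucb_def)
  ultimately show "\<exists>C. \<forall>m. \<forall>x\<in>X. norm (U m x, V m x) \<le> C"
    by (intro exI[of _ "C + D"] allI ballI order_trans[OF norm_Pair_le] add_mono)
  show "uniformly_Cauchy_on X (\<lambda>m x. (U m x, V m x))"
    unfolding uniformly_Cauchy_on_def
  proof (intro allI impI)
    fix \<epsilon> :: real assume \<epsilon>: "0 < \<epsilon>"
    obtain M where M: "\<And>x m n. x \<in> X \<Longrightarrow> M \<le> m \<Longrightarrow> M \<le> n \<Longrightarrow> dist (U m x) (U n x) < \<epsilon> / 2"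
      using assms(1) half_gt_zero[OF \<epsilon>] unfolding ucb_def uniformly_Cauchy_on_def by blast
    obtain N where N: "\<And>x m n. x \<in> X \<Longrightarrow> N \<le> m \<Longrightarrow> N \<le> n \<Longrightarrow> dist (V m x) (V n x) < \<epsilon> / 2"
      using assms(2) half_gt_zero[OF \<epsilon>] unfolding ucb_def uniformly_Cauchy_on_def by blast
    have "dist (U m x, V m x) (U n x, V n x) < \<epsilon>" if "x \<in> X" "max M N \<le> m" "max M N \<le> n" for x m n
    proof -
      have "dist (U m x, V m x) (U n x, V n x) \<le> dist (U m x) (U n x) + dist (V m x) (V n x)"
        unfolding dist_Pair_Pair by (rule order_trans[OF sqrt_sum_squares_le_sum]) auto
      then show ?thesis using M[of x m n] N[of x m n] that by simp
    qed
    then show "\<exists>M. \<forall>x\<in>X. \<forall>m\<ge>M. \<forall>n\<ge>M. dist (U m x, V m x) (U n x, V n x) < \<epsilon>" by blast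
  qed
qed

lemma ucb_reparam:
  assumes "ucb X U" "\<And>y. y \<in> Y \<Longrightarrow> g y \<in> X" shows "ucb Y (\<lambda>m y. U m (g y))"
  using assms unfolding ucb_def uniformly_Cauchy_on_def by meson

lemma ucb_Suc:
  assumes "ucb X U" shows "ucb X (\<lambda>m. U (Suc m))"
  using assms unfolding ucb_def uniformly_Cauchy_on_def by (meson le_Suc_eq)

lemma ucb_geometric:
  fixes f :: "nat \<Rightarrow> 'a \<Rightarrow> 'b::banach"
  assumes step: "\<And>m x. x \<in> X \<Longrightarrow> norm (f (Suc m) x - f m x) \<le> C / 2 ^ m"
    and start: "\<And>x. x \<in> X \<Longrightarrow> norm (f 0 x) \<le> D"
  shows "ucb X f"
  unfolding ucb_def
proof
  have "uniform_limit X f (\<lambda>x. f 0 x + (\<Sum>m. f (Suc m) x - f m x)) sequentially"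
    by (rule uniform_limit_of_geometric_steps) (rule step)
  then show "uniformly_Cauchy_on X f"
    unfolding uniformly_convergent_eq_Cauchy[symmetric] uniformly_convergent_on_def by blast
  \<comment> \<open>The bracket is the sum of \<open>C / 2 ^ j\<close> over
    \<open>j < m\<close>.\<close>
  have "norm (f m x) \<le> D + (2 * C - 2 * C / 2 ^ m)" if "x \<in> X" for m x
  proof (induction m)
    case (Suc m)
    have "norm (f (Suc m) x) \<le> norm (f m x) + norm (f (Suc m) x - f m x)"
      by (metis add_diff_cancel_left' diff_add_cancel norm_triangle_ineq add.commute)
    also have "\<dots> \<le> D + (2 * C - 2 * C / 2 ^ m) + C / 2 ^ m" using Suc step[OF that] by (intro add_mono)
    finally show ?case by (simp add: field_simps)
  qed (use start that in auto)
  moreover have "0 \<le> 2 * C / 2 ^ m" if "x \<in> X" for x m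
    using order_trans[OF norm_ge_zero step[OF that, of 0]] by simp
  ultimately have "norm (f m x) \<le> D + 2 * C" if "x \<in> X" for m x
    using that by (smt (verit, best))
  then show "\<exists>C. \<forall>m. \<forall>x\<in>X. norm (f m x) \<le> C" by blast
qed

lemma ucb_limit:
  fixes U :: "nat \<Rightarrow> 'a \<Rightarrow> 'b::banach"
  assumes "ucb X U" shows "uniform_limit X U (\<lambda>x. lim (\<lambda>m. U m x)) sequentially"
  using assms unfolding ucb_def uniformly_convergent_eq_Cauchy[symmetric] uniformly_convergent_uniform_limit_iff
  by blast

lemma has_vector_derivative_limit:
  fixes f :: "nat \<Rightarrow> real \<Rightarrow> 'b::banach"
  assumes S: "convex S" "x \<in> S"
    and f: "\<And>n x. x \<in> S \<Longrightarrow> (f n has_vector_derivative f' n x) (at x within S)"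
    and f': "uniform_limit S f' g' sequentially"
    and g: "\<And>x. x \<in> S \<Longrightarrow> (\<lambda>n. f n x) \<longlonglongrightarrow> g x"
  shows "(g has_vector_derivative g' x) (at x within S)"
proof -
  have d: "(f n has_derivative (\<lambda>h. h *\<^sub>R f' n x)) (at x within S)" if "x \<in> S" for n x
    using f[OF that] by (simp add: has_vector_derivative_def)
  have "\<forall>\<^sub>F n in sequentially. \<forall>x\<in>S. \<forall>h. norm (h *\<^sub>R f' n x - h *\<^sub>R g' x) \<le> \<epsilon> * norm h"
    if "0 < \<epsilon>" for \<epsilon>
    using uniform_limitD[OF f' that]
  proof eventually_elim
    case (elim n)
    have "norm (h *\<^sub>R f' n x - h *\<^sub>R g' x) \<le> \<epsilon> * norm h" if "x \<in> S" for x h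
    proof -
      have "norm (f' n x - g' x) \<le> \<epsilon>" using elim that by (auto simp: dist_norm less_imp_le)
      then have "\<bar>h\<bar> * norm (f' n x - g' x) \<le> \<bar>h\<bar> * \<epsilon>" by (intro mult_left_mono) auto
      then show ?thesis by (simp flip: scaleR_right_diff_distrib add: mult.commute)
    qed
    then show ?case by blast
  qed
  note has_derivative_sequence[where f = f and f' = "\<lambda>n x h. h *\<^sub>R f' n x" and g' = "\<lambda>x h. h *\<^sub>R g' x",
      OF S(1) d this S(2) g[OF S(2)]]
  then obtain k where k: "\<And>x. x \<in> S \<Longrightarrow> (\<lambda>n. f n x) \<longlonglongrightarrow> k x"
    "\<And>x. x \<in> S \<Longrightarrow> (k has_vector_derivative g' x) (at x within S)"
    by (auto simp: has_vector_derivative_def)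
  have "k x = g x" if "x \<in> S" for x using LIMSEQ_unique[OF k(1)[OF that] g[OF that]] .
  then show ?thesis
    using has_vector_derivative_transform[OF S(2) _ k(2)[OF S(2)], of g] by metis
qed

lemma has_vector_derivative_vec_iff:
  fixes f :: "real \<Rightarrow> real ^ 'n::finite"
  shows "(f has_vector_derivative D) (at x within S) \<longleftrightarrow>
    (\<forall>i. ((\<lambda>x. f x $ i) has_real_derivative D $ i) (at x within S))"
  unfolding has_vector_derivative_def has_derivative_componentwise_within[of f] has_field_derivative_def
  by (auto simp: Basis_vec_def inner_axis mult.commute[of _ "D $ _"] fun_eq_iff)

lemma inner_le_sum:
  fixes v w :: "real ^ 'n::finite"
  assumes "norm v \<le> K" shows "\<bar>v \<bullet> w\<bar> \<le> K * (\<Sum>j\<in>UNIV. \<bar>w $ j\<bar>)"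
proof -
  have "\<bar>v \<bullet> w\<bar> \<le> norm v * norm w" by (rule Cauchy_Schwarz_ineq2)
  also have "\<dots> \<le> K * (\<Sum>j\<in>UNIV. \<bar>w $ j\<bar>)"
    using assms norm_le_l1_cart[of w] order_trans[OF norm_ge_zero assms] by (intro mult_mono) auto
  finally show ?thesis .
qed

text \<open>The vector \<open>v(t)\<close> of the boundary conditions, written without reference to
  the numbering of the components; see \<open>outflow_eq_glue\<close>.\<close>

definition outflow :: "('n::finite \<Rightarrow> real) \<Rightarrow> (real \<Rightarrow> real \<Rightarrow> real ^ 'n) \<Rightarrow> real \<Rightarrow> real ^ 'n" where
  "outflow e u t = (\<chi> j. u (1 - e j) t $ j)"

lemma outflow_nth [simp]: "outflow e u t $ j = u (1 - e j) t $ j"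
  by (simp add: outflow_def)

context strip_system begin

lemma wbound_norm:
  assumes "wbound B z" "x \<in> {0..1}" "0 \<le> t" "t \<le> T"
  shows "norm (z x t) \<le> real CARD('n) * (B * exp (a + M * T))"
proof -
  have "norm (z x t) \<le> (\<Sum>i\<in>UNIV. \<bar>z x t $ i\<bar>)" by (rule norm_le_l1_cart)
  also have "\<dots> \<le> real CARD('n) * (B * exp (a + M * T))"
    using sum_bounded_above[of UNIV "\<lambda>i. \<bar>z x t $ i\<bar>" "B * exp (a + M * T)"] wboundD[OF assms] by simp
  finally show ?thesis .
qed

lemma ucb_of_transport_ineq:
  fixes u :: "nat \<Rightarrow> real \<Rightarrow> real \<Rightarrow> real ^ 'n"
  assumes c: "\<And>m. strip_cont {0..T} (u m)"
    and ineq: "\<And>m. transport_ineq T e \<gamma> c F H 0 (\<lambda>x t. u (Suc (Suc m)) x t - u (Suc m) x t)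
      (\<lambda>x t. u (Suc m) x t - u m x t)"
  shows "ucb ({0..1} \<times> {0..T}) (\<lambda>m (x, t). u m x t)"
proof -
  let ?K = "real CARD('n) * exp (a + M * T)"
  have "strip_cont {0..T} (\<lambda>x t. u (Suc 0) x t - u 0 x t)"
    using c[of "Suc 0"] c[of 0] unfolding split_beta by (intro continuous_intros)
  then obtain B where B: "wbound B (\<lambda>x t. u (Suc 0) x t - u 0 x t)" using continuous_wbound by blast
  obtain D where D: "wbound D (u 0)" using continuous_wbound[OF c] by blast
  have "wbound (B / 2 ^ m) (\<lambda>x t. u (Suc m) x t - u m x t)" for m
    by (rule transport_ineq_geometric[where z = "\<lambda>m x t. u (Suc m) x t - u m x t"]) (use ineq B in auto)
  from wbound_norm[OF this] wbound_norm[OF D] show ?thesis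
    by (intro ucb_geometric[where C = "?K * B" and D = "?K * D"]) (auto simp: mult_ac)
qed

text \<open>First the iterates are bounded, with \<open>r\<close>, \<open>s\<close> and the initial
  values as perturbations. Then the difference of two iterates satisfies the same inequality, the
  perturbation now being the change of the coefficients times that bound. The term with
  \<open>lx\<close> involves the new iterate and goes into \<open>c\<close>.\<close>

lemma linear_transport_ucb:
  fixes p :: "nat \<Rightarrow> real \<Rightarrow> real \<Rightarrow> real ^ 'n"
    and A :: "'n \<Rightarrow> nat \<Rightarrow> real \<times> real \<Rightarrow> real ^ 'n" and r :: "'n \<Rightarrow> nat \<Rightarrow> real \<times> real \<Rightarrow> real"
    and B :: "'n \<Rightarrow> nat \<Rightarrow> real \<Rightarrow> real ^ 'n" and s :: "'n \<Rightarrow> nat \<Rightarrow> real \<Rightarrow> real"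
  assumes p: "\<And>m. strip_cont {0..T} (p m)"
    and along: "\<And>i m x t. x \<in> {0..1} \<Longrightarrow> 0 < t \<Longrightarrow> t \<le> T \<Longrightarrow>
      ((\<lambda>\<tau>. p (Suc m) (\<gamma> i x t \<tau>) \<tau> $ i) has_real_derivative
        r i m (x, t) + A i m (x, t) \<bullet> p m x t - lx i x t * p (Suc m) x t $ i)
        (at t within strip_times (\<gamma> i x t))"
    and inflow: "\<And>i m t. 0 < t \<Longrightarrow> t \<le> T \<Longrightarrow> p (Suc m) (e i) t $ i = s i m t + B i m t \<bullet> outflow e (p m) t"
    and init: "\<And>m x. x \<in> {0..1} \<Longrightarrow> p m x 0 = p 0 x 0"
    and coeffs: "\<And>i. ucb ({0..1} \<times> {0..T}) (r i)" "\<And>i. ucb ({0..1} \<times> {0..T}) (A i)" "\<And>i. ucb {0..T} (s i)" "\<And>i. ucb {0..T} (B i)"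
    and A: "\<And>i m z. z \<in> {0..1} \<times> {0..T} \<Longrightarrow> norm (A i m z) \<le> F"
    and B: "\<And>i m t. t \<in> {0..T} \<Longrightarrow> norm (B i m t) \<le> H"
    and lx: "\<And>i x t. x \<in> {0..1} \<Longrightarrow> 0 \<le> t \<Longrightarrow> t \<le> T \<Longrightarrow> \<bar>lx i x t\<bar> \<le> c"
  shows "ucb ({0..1} \<times> {0..T}) (\<lambda>m (x, t). p m x t)"
proof -
  have inQ: "(x, t) \<in> {0..1} \<times> {0..T}" if "x \<in> {0..1}" "0 \<le> t" "t \<le> T" for x t using that by auto
  obtain D where D: "wbound D (p 0)" using continuous_wbound[OF p] by blast
  have "\<forall>i. \<exists>C. \<forall>m. \<forall>z\<in>{0..1} \<times> {0..T}. norm (r i m z) \<le> C" "\<forall>i. \<exists>C. \<forall>m. \<forall>t\<in>{0..T}. norm (s i m t) \<le> C"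
    using coeffs by (auto simp: ucb_def)
  then obtain Cr Cs where Crs: "\<And>i m z. z \<in> {0..1} \<times> {0..T} \<Longrightarrow> \<bar>r i m z\<bar> \<le> Cr i" "\<And>i m t. t \<in> {0..T} \<Longrightarrow> \<bar>s i m t\<bar> \<le> Cs i"
    unfolding choice_iff real_norm_def by blast
  have Crs0: "0 \<le> Cr i" "0 \<le> Cs i" for i
    using order_trans[OF abs_ge_zero Crs(1)[of "(0, 0)" i]] order_trans[OF abs_ge_zero Crs(2)[of 0 i]] T
    by auto
  \<comment> \<open>Dominates the initial values, after removal of the weight from the bound
    \<open>D\<close>, and all \<open>r\<close> and \<open>s\<close>; sums over the components
    replace maxima.\<close>
  define \<epsilon> where "\<epsilon> = D * exp (a + M * T) + (\<Sum>i\<in>UNIV. Cr i) + (\<Sum>i\<in>UNIV. Cs i)"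
  have sums: "Cr i \<le> (\<Sum>i\<in>UNIV. Cr i)" "Cs i \<le> (\<Sum>i\<in>UNIV. Cs i)" for i
    using Crs0 by (auto intro!: member_le_sum)
  have D0: "0 \<le> D * exp (a + M * T)" using wbound_nonneg[OF D] by simp
  have \<epsilon>: "0 \<le> \<epsilon>" "D * exp (a + M * T) \<le> \<epsilon>" "\<And>i. Cr i \<le> \<epsilon>" "\<And>i. Cs i \<le> \<epsilon>"
  proof -
    have nn: "0 \<le> (\<Sum>i\<in>UNIV. Cr i)" "0 \<le> (\<Sum>i\<in>UNIV. Cs i)" using Crs0 by (auto intro: sum_nonneg)
    show "0 \<le> \<epsilon>" "D * exp (a + M * T) \<le> \<epsilon>" unfolding \<epsilon>_def using D0 nn by linarith+
    show "Cr i \<le> \<epsilon>" "Cs i \<le> \<epsilon>" for i unfolding \<epsilon>_def using D0 nn sums[of i] by linarith+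
  qed
  have bdd_ineq: "transport_ineq T e \<gamma> c F H \<epsilon> (p (Suc m)) (p m)" for m
    unfolding transport_ineq_def
  proof (intro conjI allI ballI impI exI)
    show "strip_cont {0..T} (p (Suc m))" by (rule p)
  next
    fix i x t assume "x \<in> {0..1::real}" "t \<in> {0<..T}" "x \<noteq> e i"
    then have xt: "x \<in> {0..1}" "0 < t" "t \<le> T" "0 \<le> t" by auto
    show "((\<lambda>\<tau>. p (Suc m) (\<gamma> i x t \<tau>) \<tau> $ i) has_real_derivative
        r i m (x, t) + A i m (x, t) \<bullet> p m x t - lx i x t * p (Suc m) x t $ i)
        (at t within strip_times (\<gamma> i x t))"
      by (rule along[OF xt(1-3)])
    have "\<bar>r i m (x, t)\<bar> \<le> \<epsilon>" using Crs(1)[OF inQ[OF xt(1,4,3)]] \<epsilon>(3) order_trans by blast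
    moreover have "\<bar>A i m (x, t) \<bullet> p m x t\<bar> \<le> F * (\<Sum>j\<in>UNIV. \<bar>p m x t $ j\<bar>)"
      by (rule inner_le_sum[OF A[OF inQ[OF xt(1,4,3)]]])
    moreover have "\<bar>lx i x t * p (Suc m) x t $ i\<bar> \<le> c * \<bar>p (Suc m) x t $ i\<bar>"
      unfolding abs_mult using lx[OF xt(1,4,3)] by (intro mult_right_mono) auto
    ultimately show "\<bar>r i m (x, t) + A i m (x, t) \<bullet> p m x t - lx i x t * p (Suc m) x t $ i\<bar>
        \<le> c * \<bar>p (Suc m) x t $ i\<bar> + F * (\<Sum>j\<in>UNIV. \<bar>p m x t $ j\<bar>) + \<epsilon>" by linarith
  next
    fix i x assume x: "x \<in> {0..1::real}"
    show "\<bar>p (Suc m) x 0 $ i\<bar> \<le> \<epsilon>"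
      unfolding init[OF x, of "Suc m"] using wboundD[OF D x, of 0 i] T \<epsilon>(2) by linarith
  next
    fix i t assume t: "t \<in> {0<..T}"
    have "\<bar>s i m t\<bar> \<le> \<epsilon>" using Crs(2)[of t i m] \<epsilon>(4)[of i] t by simp
    moreover have "\<bar>B i m t \<bullet> outflow e (p m) t\<bar> \<le> H * (\<Sum>j\<in>UNIV. \<bar>outflow e (p m) t $ j\<bar>)"
      using t by (intro inner_le_sum B) auto
    ultimately show "\<bar>p (Suc m) (e i) t $ i\<bar> \<le> H * (\<Sum>j\<in>UNIV. \<bar>p m (1 - e j) t $ j\<bar>) + \<epsilon>"
      using t by (simp add: inflow outflow_def)
  qed
  define R where "R = max D (2 * \<epsilon>)"
  have R: "wbound R (p m)" for m
    unfolding R_def by (rule transport_ineq_bounded[OF bdd_ineq D \<epsilon>(1)])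
  define R' where "R' = real CARD('n) * (R * exp (a + M * T))"
  have R': "norm (p m x t) \<le> R'" if "x \<in> {0..1}" "0 \<le> t" "t \<le> T" for m x t
    unfolding R'_def by (rule wbound_norm[OF R that])
  have R'0: "0 \<le> R'" using order_trans[OF norm_ge_zero R'[of 0 0 0]] T by simp
  have outR: "\<bar>v \<bullet> outflow e (p m) t\<bar> \<le> norm v * (real CARD('n) * R')" if "0 \<le> t" "t \<le> T" for v m t
  proof -
    have "\<bar>outflow e (p m) t $ j\<bar> \<le> R'" for j
    proof -
      have "1 - e j \<in> {0..1}" using e[of j] by auto
      then have "norm (p m (1 - e j) t) \<le> R'" using R' that by blast
      then show ?thesis
        using component_le_norm_cart[of "p m (1 - e j) t" j] by (simp add: outflow_def)
    qed
    then have "(\<Sum>j\<in>UNIV. \<bar>outflow e (p m) t $ j\<bar>) \<le> real CARD('n) * R'"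
      using sum_bounded_above[of UNIV "\<lambda>j. \<bar>outflow e (p m) t $ j\<bar>" R'] by simp
    then show ?thesis
      by (intro order_trans[OF inner_le_sum[OF order_refl]] mult_left_mono) auto
  qed
  have "\<exists>m0. \<forall>m\<ge>m0. \<forall>k. transport_ineq T e \<gamma> c F H \<delta>
      (\<lambda>x t. p (Suc m + k) x t - p (Suc m) x t) (\<lambda>x t. p (m + k) x t - p m x t)" if \<delta>: "0 < \<delta>" for \<delta>
  proof -
    \<comment> \<open>If every coefficient changes by less than \<open>\<eta>\<close>, then each of
      \<open>\<eta>\<close>, \<open>\<eta> * R'\<close> and \<open>\<eta> * (n * R')\<close>, with
      \<open>n\<close> the number of components, is at most \<open>\<delta> / 2\<close>. The
      interior inequality and the inflow inequality each contain two such errors.\<close>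
    define \<eta> where "\<eta> = \<delta> / 2 / (1 + R' + real CARD('n) * R')"
    have den: "0 < 1 + R' + real CARD('n) * R'" using R'0 by (simp add: add_pos_nonneg)
    have \<eta>: "0 < \<eta>" using \<delta> den by (simp add: \<eta>_def)
    have \<eta>': "\<eta> * (1 + R' + real CARD('n) * R') = \<delta> / 2" 
    proof -
      have "y \<noteq> 0 \<Longrightarrow> x / y * y = x" for x y :: real by simp
      then show ?thesis unfolding \<eta>_def using den by (metis less_irrefl)
    qed
    have "\<eta> \<le> \<delta> / 2" "\<eta> * R' \<le> \<delta> / 2" "\<eta> * (real CARD('n) * R') \<le> \<delta> / 2"
      unfolding \<eta>'[symmetric] using \<eta> R'0 by (simp_all add: distrib_left)
    note \<eta>le = this
    have "\<forall>i. \<exists>N. (\<forall>m\<ge>N. \<forall>n\<ge>N. (\<forall>z\<in>{0..1} \<times> {0..T}. dist (r i m z) (r i n z) < \<eta> \<and> dist (A i m z) (A i n z) < \<eta>) \<and>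
        (\<forall>t\<in>{0..T}. dist (s i m t) (s i n t) < \<eta> \<and> dist (B i m t) (B i n t) < \<eta>))"
    proof
      fix i
      obtain N1 where N1: "\<forall>z\<in>{0..1} \<times> {0..T}. \<forall>m\<ge>N1. \<forall>n\<ge>N1. dist (r i m z) (r i n z) < \<eta>"
        using coeffs(1)[of i] \<eta> unfolding ucb_def uniformly_Cauchy_on_def by blast
      obtain N2 where N2: "\<forall>z\<in>{0..1} \<times> {0..T}. \<forall>m\<ge>N2. \<forall>n\<ge>N2. dist (A i m z) (A i n z) < \<eta>"
        using coeffs(2)[of i] \<eta> unfolding ucb_def uniformly_Cauchy_on_def by blast
      obtain N3 where N3: "\<forall>t\<in>{0..T}. \<forall>m\<ge>N3. \<forall>n\<ge>N3. dist (s i m t) (s i n t) < \<eta>"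
        using coeffs(3)[of i] \<eta> unfolding ucb_def uniformly_Cauchy_on_def by blast
      obtain N4 where N4: "\<forall>t\<in>{0..T}. \<forall>m\<ge>N4. \<forall>n\<ge>N4. dist (B i m t) (B i n t) < \<eta>"
        using coeffs(4)[of i] \<eta> unfolding ucb_def uniformly_Cauchy_on_def by blast
      show "\<exists>N. (\<forall>m\<ge>N. \<forall>n\<ge>N. (\<forall>z\<in>{0..1} \<times> {0..T}. dist (r i m z) (r i n z) < \<eta> \<and> dist (A i m z) (A i n z) < \<eta>) \<and>
        (\<forall>t\<in>{0..T}. dist (s i m t) (s i n t) < \<eta> \<and> dist (B i m t) (B i n t) < \<eta>))"
        using N1 N2 N3 N4 by (intro exI[of _ "max (max N1 N2) (max N3 N4)"]) simp
    qed
    then obtain N where N: "\<And>i m n z. N i \<le> m \<Longrightarrow> N i \<le> n \<Longrightarrow> z \<in> {0..1} \<times> {0..T} \<Longrightarrow> dist (r i m z) (r i n z) < \<eta> \<and> dist (A i m z) (A i n z) < \<eta>"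
      "\<And>i m n t. N i \<le> m \<Longrightarrow> N i \<le> n \<Longrightarrow> t \<in> {0..T} \<Longrightarrow> dist (s i m t) (s i n t) < \<eta> \<and> dist (B i m t) (B i n t) < \<eta>"
      unfolding choice_iff by blast
    show ?thesis
    proof (intro exI allI impI)
      fix m k assume "(\<Sum>i\<in>UNIV. N i) \<le> m"
      then have Nm: "N i \<le> m" "N i \<le> m + k" for i
        using member_le_sum[of i UNIV N] by auto
      show "transport_ineq T e \<gamma> c F H \<delta>
          (\<lambda>x t. p (Suc m + k) x t - p (Suc m) x t) (\<lambda>x t. p (m + k) x t - p m x t)"
        unfolding transport_ineq_def
      proof (intro conjI allI ballI impI exI)
        show "strip_cont {0..T} (\<lambda>x t. p (Suc m + k) x t - p (Suc m) x t)"
          using p[of "Suc m + k"] p[of "Suc m"] unfolding split_beta by (intro continuous_intros)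
      next
        fix i x t assume "x \<in> {0..1::real}" "t \<in> {0<..T}" "x \<noteq> e i"
        then have xt: "x \<in> {0..1}" "0 < t" "t \<le> T" "0 \<le> t" by auto
        note z = inQ[OF xt(1,4,3)]
        let ?G = "(r i (m + k) (x, t) + A i (m + k) (x, t) \<bullet> p (m + k) x t - lx i x t * p (Suc (m + k)) x t $ i)
            - (r i m (x, t) + A i m (x, t) \<bullet> p m x t - lx i x t * p (Suc m) x t $ i)"
        show "((\<lambda>\<tau>. (p (Suc m + k) (\<gamma> i x t \<tau>) \<tau> - p (Suc m) (\<gamma> i x t \<tau>) \<tau>) $ i) has_real_derivative ?G)
            (at t within strip_times (\<gamma> i x t))"
          using DERIV_diff[OF along[OF xt(1-3), of "m + k" i] along[OF xt(1-3), of m i]] by simp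
        \<comment> \<open>The difference of the products is split so that the change of
          \<open>p\<close> meets a bounded coefficient, estimated by \<open>F\<close>, and the
          change of the coefficient meets a bounded \<open>p\<close>.\<close>
        have eq: "?G = (r i (m + k) (x, t) - r i m (x, t)) + A i (m + k) (x, t) \<bullet> (p (m + k) x t - p m x t)
            + (A i (m + k) (x, t) - A i m (x, t)) \<bullet> p m x t - lx i x t * (p (Suc m + k) x t - p (Suc m) x t) $ i"
          by (simp add: algebra_simps inner_diff_left inner_diff_right)
        have "\<bar>r i (m + k) (x, t) - r i m (x, t)\<bar> \<le> \<delta> / 2"
          using N(1)[OF Nm(2)[of i] Nm(1)[of i] z] \<eta>le(1) unfolding dist_real_def by linarith
        moreover have "\<bar>A i (m + k) (x, t) \<bullet> (p (m + k) x t - p m x t)\<bar> \<le> F * (\<Sum>j\<in>UNIV. \<bar>(p (m + k) x t - p m x t) $ j\<bar>)"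
          by (rule inner_le_sum[OF A[OF z]])
        moreover have "\<bar>(A i (m + k) (x, t) - A i m (x, t)) \<bullet> p m x t\<bar> \<le> \<delta> / 2"
        proof -
          have "\<bar>(A i (m + k) (x, t) - A i m (x, t)) \<bullet> p m x t\<bar>
              \<le> norm (A i (m + k) (x, t) - A i m (x, t)) * norm (p m x t)" by (rule Cauchy_Schwarz_ineq2)
          also have "\<dots> \<le> \<eta> * R'"
            using N(1)[OF Nm(2)[of i] Nm(1)[of i] z] R'[OF xt(1,4,3), of m] \<eta>
            by (intro mult_mono) (auto simp: dist_norm less_imp_le)
          finally show ?thesis using \<eta>le(2) by linarith
        qed
        moreover have "\<bar>lx i x t * (p (Suc m + k) x t - p (Suc m) x t) $ i\<bar> \<le> c * \<bar>(p (Suc m + k) x t - p (Suc m) x t) $ i\<bar>"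
          unfolding abs_mult using lx[OF xt(1,4,3)] by (intro mult_right_mono) auto
        ultimately show "\<bar>?G\<bar> \<le> c * \<bar>(p (Suc m + k) x t - p (Suc m) x t) $ i\<bar>
            + F * (\<Sum>j\<in>UNIV. \<bar>(p (m + k) x t - p m x t) $ j\<bar>) + \<delta>"
          unfolding eq by linarith
      next
        fix i x assume x: "x \<in> {0..1::real}"
        show "\<bar>(p (Suc m + k) x 0 - p (Suc m) x 0) $ i\<bar> \<le> \<delta>"
          using init[OF x, of "Suc m + k"] init[OF x, of "Suc m"] \<delta> by simp
      next
        fix i t assume "t \<in> {0<..T}"
        then have t: "0 < t" "t \<le> T" "0 \<le> t" "t \<in> {0..T}" by auto
        have outd: "(outflow e (p (m + k)) t - outflow e (p m) t) $ j = (p (m + k) (1 - e j) t - p m (1 - e j) t) $ j" for j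
          by (simp add: outflow_def)
        have "(p (Suc m + k) (e i) t - p (Suc m) (e i) t) $ i = (s i (m + k) t - s i m t)
            + B i (m + k) t \<bullet> (outflow e (p (m + k)) t - outflow e (p m) t) + (B i (m + k) t - B i m t) \<bullet> outflow e (p m) t"
          using inflow[OF t(1,2), of "m + k" i] inflow[OF t(1,2), of m i]
          by (simp add: inner_diff_left inner_diff_right)
        moreover have "\<bar>s i (m + k) t - s i m t\<bar> \<le> \<delta> / 2"
          using N(2)[OF Nm(2)[of i] Nm(1)[of i] t(4)] \<eta>le(1) unfolding dist_real_def by linarith
        moreover have "\<bar>B i (m + k) t \<bullet> (outflow e (p (m + k)) t - outflow e (p m) t)\<bar>
            \<le> H * (\<Sum>j\<in>UNIV. \<bar>(outflow e (p (m + k)) t - outflow e (p m) t) $ j\<bar>)"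
          by (rule inner_le_sum[OF B[OF t(4)]])
        moreover have "\<bar>(B i (m + k) t - B i m t) \<bullet> outflow e (p m) t\<bar> \<le> \<delta> / 2"
        proof -
          have "\<bar>(B i (m + k) t - B i m t) \<bullet> outflow e (p m) t\<bar> \<le> norm (B i (m + k) t - B i m t) * (real CARD('n) * R')"
            by (rule outR[OF t(3,2)])
          also have "\<dots> \<le> \<eta> * (real CARD('n) * R')"
            using N(2)[OF Nm(2)[of i] Nm(1)[of i] t(4)] R'0 by (intro mult_right_mono) (auto simp: dist_norm less_imp_le)
          finally show ?thesis using \<eta>le(3) by linarith
        qed
        ultimately show "\<bar>(p (Suc m + k) (e i) t - p (Suc m) (e i) t) $ i\<bar>
            \<le> H * (\<Sum>j\<in>UNIV. \<bar>(p (m + k) (1 - e j) t - p m (1 - e j) t) $ j\<bar>) + \<delta>"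
          unfolding outd by linarith
      qed
    qed
  qed
  note Cauchy = transport_ineq_Cauchy[OF this R]
  show ?thesis
    unfolding ucb_def
  proof
    show "\<exists>C. \<forall>m. \<forall>z\<in>{0..1} \<times> {0..T}. norm ((\<lambda>(x, t). p m x t) z) \<le> C"
      using R' by (intro exI[of _ R']) auto
    show "uniformly_Cauchy_on ({0..1} \<times> {0..T}) (\<lambda>m (x, t). p m x t)"
    proof (rule uniformly_Cauchy_onI')
      fix \<delta> :: real assume \<delta>: "0 < \<delta>"
      let ?K = "real CARD('n) * exp (a + M * T)"
      have K: "0 < ?K" by simp
      obtain m0 where m0: "\<And>m k. m0 \<le> m \<Longrightarrow> wbound (\<delta> / 2 / ?K) (\<lambda>x t. p (m + k) x t - p m x t)"
        using Cauchy[of "\<delta> / 2 / ?K"] \<delta> K by (meson divide_pos_pos half_gt_zero)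
      have "dist (p m x t) (p n x t) < \<delta>" if "x \<in> {0..1}" "0 \<le> t" "t \<le> T" "m0 \<le> m" "m < n" for m n x t
      proof -
        have "norm (p (m + (n - m)) x t - p m x t) \<le> real CARD('n) * (\<delta> / 2 / ?K * exp (a + M * T))"
          by (rule wbound_norm[OF m0[OF that(4)] that(1-3)])
        also have "\<dots> = \<delta> / 2" by simp
        finally show ?thesis using that(5) \<delta> by (simp add: dist_norm norm_minus_commute)
      qed
      then show "\<exists>M. \<forall>z\<in>{0..1} \<times> {0..T}. \<forall>m\<ge>M. \<forall>n>m. dist ((\<lambda>(x, t). p m x t) z) ((\<lambda>(x, t). p n x t) z) < \<delta>"
        by (intro exI[of _ m0]) auto
    qed
  qed
qed

end

section \<open>The iteration\<close>

lemma continuous_on_vec_nth_iff: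
  fixes g :: "'s::topological_space \<Rightarrow> real ^ 'm::finite"
  shows "continuous_on S g \<longleftrightarrow> (\<forall>i. continuous_on S (\<lambda>s. g s $ i))"
proof
  assume "\<forall>i. continuous_on S (\<lambda>s. g s $ i)"
  then have "continuous_on S (\<lambda>s. \<chi> i. g s $ i)" by (intro continuous_on_vec_lambda) blast
  then show "continuous_on S g" by simp
qed (auto intro: continuous_on_component)

lemma continuous_on_strip_local:
  fixes g :: "real \<Rightarrow> real \<Rightarrow> 'b::metric_space"
  assumes "\<And>T. 0 \<le> T \<Longrightarrow> strip_cont {0..T} g"
  shows "strip_cont {0..} g"
  unfolding continuous_on_eq_continuous_within
proof
  fix z :: "real \<times> real" assume z: "z \<in> {0..1} \<times> {0..}"
  have "at z within {0..1} \<times> {0..snd z + 1} = at z within {0..1} \<times> {0..}"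
    by (rule at_within_nhd[where S = "UNIV \<times> {..<snd z + 1}"]) (auto simp: mem_Times_iff intro: open_Times)
  moreover have "continuous (at z within {0..1} \<times> {0..snd z + 1}) (\<lambda>(x, t). g x t)"
    using assms[of "snd z + 1"] z by (auto simp: continuous_on_eq_continuous_within)
  ultimately show "continuous (at z within {0..1} \<times> {0..}) (\<lambda>(x, t). g x t)" by simp
qed

lemma at_within_atLeast_neq_bot: "0 \<le> (t::real) \<Longrightarrow> at t within {0..} \<noteq> bot"
  using islimpt_subset[of t "{t..t+1}" "{0..}"] by (simp add: trivial_limit_within islimpt_Icc)

lemma at_within_unit_neq_bot: "x \<in> {0..1::real} \<Longrightarrow> at x within {0..1} \<noteq> bot"
  by (simp add: trivial_limit_within islimpt_Icc)

lemma C1_inD: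
  assumes "C1_in S P g"
  shows "s \<in> S \<Longrightarrow> p \<in> P \<Longrightarrow>
      ((\<lambda>s. g s p) has_vector_derivative vector_derivative (\<lambda>s. g s p) (at s within S)) (at s within S)"
    and "continuous_on (S \<times> P) (\<lambda>(s, p). vector_derivative (\<lambda>s. g s p) (at s within S))"
  using assms unfolding C1_in_def differentiable_on_def by (auto simp: vector_derivative_works[symmetric])

lemma C1_inI:
  assumes "\<And>s p. s \<in> S \<Longrightarrow> p \<in> P \<Longrightarrow> ((\<lambda>s. g s p) has_vector_derivative g' s p) (at s within S)"
    and "continuous_on (S \<times> P) (\<lambda>(s, p). g' s p)" and "\<And>s. s \<in> S \<Longrightarrow> at s within S \<noteq> bot"
  shows "C1_in S P g"
  unfolding C1_in_def
proof
  show "\<forall>p\<in>P. (\<lambda>s. g s p) differentiable_on S"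
    using assms(1) unfolding differentiable_on_def by (blast intro: differentiableI_vector)
  have "vector_derivative (\<lambda>s. g s p) (at s within S) = g' s p" if "s \<in> S" "p \<in> P" for s p
    using assms(3)[OF that(1)] assms(1)[OF that] by (rule vector_derivative_within)
  then show "continuous_on (S \<times> P) (\<lambda>(s, p). vector_derivative (\<lambda>s. g s p) (at s within S))"
    by (intro continuous_on_eq[OF assms(2)]) auto
qed

lemma continuous_on_swap_args:
  assumes "continuous_on (A \<times> B) (\<lambda>(a, b). g a b)"
  shows "continuous_on (B \<times> A) (\<lambda>(b, a). g a b)"
proof -
  have "continuous_on (B \<times> A) (\<lambda>z. (\<lambda>(a, b). g a b) (snd z, fst z))"
    by (rule continuous_on_compose2[OF assms]) (auto intro!: continuous_intros)
  then show ?thesis by (simp add: split_beta)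
qed

text \<open>The component \<open>i\<close> enters the strip at \<open>x = e i\<close> and leaves it at \<open>x = 1 - e i\<close>.\<close>

locale hyperbolic_problem =
  fixes e :: "'n::finite \<Rightarrow> real" and lam lamx :: "real \<Rightarrow> real \<Rightarrow> real ^ 'n"
    and f fx :: "real \<Rightarrow> real \<Rightarrow> real ^ 'n \<Rightarrow> real ^ 'n" and phi phi' :: "real \<Rightarrow> real ^ 'n"
    and h ht :: "real \<Rightarrow> real ^ 'n \<Rightarrow> real ^ 'n"
  assumes e: "\<And>i. e i = 0 \<or> e i = 1"
    and lam_cont: "strip_cont {0..} lam"
    and lamx_cont: "strip_cont {0..} lamx"
    and lam_deriv: "\<And>x t. x \<in> {0..1} \<Longrightarrow> 0 \<le> t \<Longrightarrow>
      ((\<lambda>x. lam x t) has_vector_derivative lamx x t) (at x within {0..1})"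
    and lam_sign: "\<And>i x t. x \<in> {0..1} \<Longrightarrow> 0 \<le> t \<Longrightarrow> 0 < (1 - 2 * e i) * lam x t $ i"
    and f_cont: "continuous_on (({0..1} \<times> {0..}) \<times> UNIV) (\<lambda>((x, t), y). f x t y)"
    and fx_cont: "continuous_on (({0..1} \<times> {0..}) \<times> UNIV) (\<lambda>((x, t), y). fx x t y)"
    and f_dx: "\<And>x t y. x \<in> {0..1} \<Longrightarrow> 0 \<le> t \<Longrightarrow>
      ((\<lambda>x. f x t y) has_vector_derivative fx x t y) (at x within {0..1})"
    and f_dy: "\<And>i x t y j. x \<in> {0..1} \<Longrightarrow> 0 \<le> t \<Longrightarrow>
      (\<lambda>s. f x t (y + s *\<^sub>R axis j 1) $ i) differentiable (at 0)"
    and f_grad: "\<And>i. continuous_on (({0..1} \<times> {0..}) \<times> UNIV) (\<lambda>((x, t), y). grad (\<lambda>y. f x t y $ i) y)"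
    and f_grad_bound: "\<And>T. \<exists>K. \<forall>i x t y. x \<in> {0..1} \<longrightarrow> 0 \<le> t \<longrightarrow> t \<le> T \<longrightarrow> norm (grad (\<lambda>y. f x t y $ i) y) \<le> K"
    and h_dt: "\<And>t z. 0 \<le> t \<Longrightarrow> ((\<lambda>t. h t z) has_vector_derivative ht t z) (at t within {0..})"
    and ht_cont: "continuous_on ({0..} \<times> UNIV) (\<lambda>(t, z). ht t z)"
    and h_dz: "\<And>i t z j. 0 \<le> t \<Longrightarrow> (\<lambda>s. h t (z + s *\<^sub>R axis j 1) $ i) differentiable (at 0)"
    and h_grad: "\<And>i. continuous_on ({0..} \<times> UNIV) (\<lambda>(t, z). grad (\<lambda>z. h t z $ i) z)"
    and h_grad_bound: "\<And>T. \<exists>K. \<forall>i t z. 0 \<le> t \<longrightarrow> t \<le> T \<longrightarrow> norm (grad (\<lambda>z. h t z $ i) z) \<le> K"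
    and phi_deriv: "\<And>x. x \<in> {0..1} \<Longrightarrow> (phi has_vector_derivative phi' x) (at x within {0..1})"
    and phi'_cont: "continuous_on {0..1} phi'"
    and compat0: "\<And>i. phi (e i) $ i = h 0 (\<chi> j. phi (1 - e j) $ j) $ i"
    and compat1: "\<And>i. f (e i) 0 (phi (e i)) $ i - lam (e i) 0 $ i * phi' (e i) $ i =
      ht 0 (\<chi> j. phi (1 - e j) $ j) $ i + grad (\<lambda>z. h 0 z $ i) (\<chi> j. phi (1 - e j) $ j) \<bullet>
        (\<chi> j. f (1 - e j) 0 (phi (1 - e j)) $ j - lam (1 - e j) 0 $ j * phi' (1 - e j) $ j)"
begin

section \<open>One step of the iteration\<close>

definition gf where "gf i x t y = grad (\<lambda>y. f x t y $ i) y"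
definition gh where "gh i t z = grad (\<lambda>z. h t z $ i) z"
definition q0 :: "real \<Rightarrow> real ^ 'n" where
  "q0 x = (\<chi> i. f x 0 (phi x) $ i - lam x 0 $ i * phi' x $ i)"

lemma e_in [simp]: "0 \<le> e i" "e i \<le> 1"
  using e[of i] by auto

lemma lam_nonzero: "x \<in> {0..1} \<Longrightarrow> 0 \<le> t \<Longrightarrow> lam x t $ i \<noteq> 0"
  using lam_sign[of x t i] by auto

lemma continuous_on_comps:
  fixes S :: "'s::topological_space set"
  assumes "continuous_on S a" "continuous_on S b" "\<And>s. s \<in> S \<Longrightarrow> a s \<in> {0..1::real}" "\<And>s. s \<in> S \<Longrightarrow> (0::real) \<le> b s"
  shows "continuous_on S (\<lambda>s. lam (a s) (b s))" "continuous_on S (\<lambda>s. lamx (a s) (b s))"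
    and "continuous_on S c \<Longrightarrow> continuous_on S (\<lambda>s. f (a s) (b s) (c s))"
    and "continuous_on S c \<Longrightarrow> continuous_on S (\<lambda>s. fx (a s) (b s) (c s))"
    and "continuous_on S c \<Longrightarrow> continuous_on S (\<lambda>s. gf i (a s) (b s) (c s))"
    and "continuous_on S c \<Longrightarrow> continuous_on S (\<lambda>s. ht (b s) (c s))"
    and "continuous_on S c \<Longrightarrow> continuous_on S (\<lambda>s. gh i (b s) (c s))"
proof -
  have ab: "continuous_on S (\<lambda>s. (a s, b s))" "(\<lambda>s. (a s, b s)) ` S \<subseteq> {0..1} \<times> {0..}"
    using assms by (auto intro!: continuous_on_Pair)
  show "continuous_on S (\<lambda>s. lam (a s) (b s))" "continuous_on S (\<lambda>s. lamx (a s) (b s))"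
    using continuous_on_compose2[OF lam_cont ab] continuous_on_compose2[OF lamx_cont ab] by simp_all
  assume c: "continuous_on S c"
  have abc: "continuous_on S (\<lambda>s. ((a s, b s), c s))" "(\<lambda>s. ((a s, b s), c s)) ` S \<subseteq> ({0..1} \<times> {0..}) \<times> UNIV"
    and bc: "continuous_on S (\<lambda>s. (b s, c s))" "(\<lambda>s. (b s, c s)) ` S \<subseteq> {0..} \<times> UNIV"
    using assms c by (auto intro!: continuous_on_Pair)
  show "continuous_on S (\<lambda>s. f (a s) (b s) (c s))" "continuous_on S (\<lambda>s. fx (a s) (b s) (c s))"
    "continuous_on S (\<lambda>s. gf i (a s) (b s) (c s))"
    using continuous_on_compose2[OF f_cont abc] continuous_on_compose2[OF fx_cont abc]
      continuous_on_compose2[OF f_grad[of i] abc] by (simp_all add: gf_def)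
  show "continuous_on S (\<lambda>s. ht (b s) (c s))" "continuous_on S (\<lambda>s. gh i (b s) (c s))"
    using continuous_on_compose2[OF ht_cont bc] continuous_on_compose2[OF h_grad[of i] bc] by (simp_all add: gh_def)
qed

lemma f_diff:
  assumes "x \<in> {0..1}" "0 \<le> t" "\<And>y. norm (gf i x t y) \<le> K"
  shows "\<bar>f x t y $ i - f x t z $ i\<bar> \<le> K * norm (y - z)"
  using assms f_dy continuous_on_comps(5)[of UNIV "\<lambda>_. x" "\<lambda>_. t" "\<lambda>y. y" i]
  by (intro grad_lipschitz[where F = "\<lambda>y. f x t y $ i"]) (auto simp: gf_def continuous_on_const continuous_on_id)

lemma h_diff:
  assumes "0 \<le> t" "\<And>y. norm (gh i t y) \<le> K"
  shows "\<bar>h t y $ i - h t z $ i\<bar> \<le> K * norm (y - z)"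
  using assms h_dz continuous_on_comps(7)[of UNIV "\<lambda>_. 0" "\<lambda>_. t" "\<lambda>y. y" i]
  by (intro grad_lipschitz[where F = "\<lambda>y. h t y $ i"]) (auto simp: gh_def continuous_on_const continuous_on_id)

lemma chain_f:
  assumes xt: "x \<in> {0..1}" "0 \<le> t" and u: "(u has_vector_derivative p) (at x within {0..1})"
  shows "((\<lambda>x. f x t (u x) $ i) has_real_derivative fx x t (u x) $ i + gf i x t (u x) \<bullet> p) (at x within {0..1})"
  unfolding gf_def
proof (rule has_derivative_chain_scalar_grad[where F = "\<lambda>x y. f x t y $ i" and Fs = "\<lambda>x y. fx x t y $ i"])
  show "((\<lambda>r. f r t y $ i) has_real_derivative fx r t y $ i) (at r within {0..1})" if "r \<in> {0..1}" for r y
    using f_dx[OF that xt(2), of y] by (simp add: has_vector_derivative_vec_iff)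
  show "continuous_on ({0..1} \<times> UNIV) (\<lambda>(r, y). fx r t y $ i)"
    unfolding split_beta by (intro continuous_intros continuous_on_comps) (use xt in auto)
  show "continuous_on UNIV (grad (\<lambda>y. f x t y $ i))"
    using continuous_on_comps(5)[of UNIV "\<lambda>_. x" "\<lambda>_. t" "\<lambda>y. y" i] xt
    by (auto simp: gf_def continuous_on_const continuous_on_id)
qed (use xt u f_dy in auto)

lemma chain_h:
  assumes t: "0 \<le> t" and v: "(v has_vector_derivative q) (at t within {0..})"
  shows "((\<lambda>t. h t (v t) $ i) has_real_derivative ht t (v t) $ i + gh i t (v t) \<bullet> q) (at t within {0..})"
  unfolding gh_def
proof (rule has_derivative_chain_scalar_grad[where F = "\<lambda>t z. h t z $ i" and Fs = "\<lambda>t z. ht t z $ i"])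
  show "((\<lambda>r. h r z $ i) has_real_derivative ht r z $ i) (at r within {0..})" if "r \<in> {0..}" for r z
    using h_dt[of r z] that by (simp add: has_vector_derivative_vec_iff)
  show "continuous_on ({0..} \<times> UNIV) (\<lambda>(r, z). ht r z $ i)"
    using continuous_on_component[OF ht_cont, of i] by (simp add: split_beta)
  show "continuous_on UNIV (grad (\<lambda>z. h t z $ i))"
    using continuous_on_comps(7)[of UNIV "\<lambda>_. 0" "\<lambda>_. t" "\<lambda>y. y" i] t
    by (auto simp: gh_def continuous_on_const continuous_on_id)
qed (use t v h_dz in auto)

definition evolves where
  "evolves u w p q \<longleftrightarrow>
    (\<forall>x\<in>{0..1}. \<forall>t\<ge>0. ((\<lambda>x. w x t) has_vector_derivative p x t) (at x within {0..1}) \<and>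
      (w x has_vector_derivative q x t) (at t within {0..})) \<and>
    strip_cont {0..} p \<and> strip_cont {0..} q \<and>
    (\<forall>x\<in>{0..1}. \<forall>t>0. \<forall>i. q x t $ i = f x t (u x t) $ i - lam x t $ i * p x t $ i) \<and>
    (\<forall>i. \<forall>t>0. w (e i) t $ i = h t (outflow e u t) $ i) \<and> (\<forall>x\<in>{0..1}. w x 0 = phi x)"

lemma evolvesD:
  assumes "evolves u w p q"
  shows "x \<in> {0..1} \<Longrightarrow> 0 \<le> t \<Longrightarrow> ((\<lambda>x. w x t) has_vector_derivative p x t) (at x within {0..1})"
    and "x \<in> {0..1} \<Longrightarrow> 0 \<le> t \<Longrightarrow> (w x has_vector_derivative q x t) (at t within {0..})"
    and "strip_cont {0..} p" "strip_cont {0..} q"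
    and "x \<in> {0..1} \<Longrightarrow> 0 < t \<Longrightarrow> q x t $ i = f x t (u x t) $ i - lam x t $ i * p x t $ i"
    and "0 < t \<Longrightarrow> w (e i) t $ i = h t (outflow e u t) $ i"
    and "x \<in> {0..1} \<Longrightarrow> w x 0 = phi x"
    and "strip_cont {0..} w"
proof -
  note E = assms[unfolded evolves_def]
  show 1: "((\<lambda>x. w x t) has_vector_derivative p x t) (at x within {0..1})" if "x \<in> {0..1}" "0 \<le> t" for x t using E that by blast
  show 2: "(w x has_vector_derivative q x t) (at t within {0..})" if "x \<in> {0..1}" "0 \<le> t" for x t using E that by blast
  show "strip_cont {0..} p" using E by blast
  show 3: "strip_cont {0..} q" using E by blast
  show "x \<in> {0..1} \<Longrightarrow> 0 < t \<Longrightarrow> q x t $ i = f x t (u x t) $ i - lam x t $ i * p x t $ i" using E by blast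
  show "0 < t \<Longrightarrow> w (e i) t $ i = h t (outflow e u t) $ i" using E by blast
  show "x \<in> {0..1} \<Longrightarrow> w x 0 = phi x" using E by blast
  show "strip_cont {0..} w"
    by (rule continuous_on_of_partials[OF _ 1 2 3]) auto
qed

lemma solvable_exists:
  "\<exists>\<gamma>. \<forall>i. transport_solvable (\<lambda>x t. lam x t $ i) (\<lambda>x t. lamx x t $ i) (\<gamma> i) (e i)"
proof -
  have "\<exists>\<gamma>. transport_solvable (\<lambda>x t. lam x t $ i) (\<lambda>x t. lamx x t $ i) \<gamma> (e i)" for i
  proof -
    have c: "strip_cont {0..} (\<lambda>x t. lam x t $ i)" "strip_cont {0..} (\<lambda>x t. lamx x t $ i)"
      using continuous_on_component[OF lam_cont, of i] continuous_on_component[OF lamx_cont, of i] by (simp_all add: split_beta)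
    have d: "((\<lambda>x. lam x t $ i) has_real_derivative lamx x t $ i) (at x within {0..1})" if "x \<in> {0..1}" "0 \<le> t" for x t
      using lam_deriv[OF that] by (simp add: has_vector_derivative_vec_iff)
    consider "e i = 0" | "e i = 1" using e by blast
    then show ?thesis
    proof cases
      case 1
      have pos: "0 < lam x t $ i" if "x \<in> {0..1}" "0 \<le> t" for x t using lam_sign[OF that, of i] 1 by simp
      show ?thesis unfolding 1 by (rule transport_solvable_rightward[OF c d pos])
    next
      case 2
      have neg: "lam x t $ i < 0" if "x \<in> {0..1}" "0 \<le> t" for x t using lam_sign[OF that, of i] 2 by simp
      show ?thesis unfolding 2 by (rule transport_solvable_leftward[OF c d neg])
    qed
  qed
  then show ?thesis by metis
qed

definition \<gamma> :: "'n \<Rightarrow> real \<Rightarrow> real \<Rightarrow> real \<Rightarrow> real" where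
  "\<gamma> = (SOME \<gamma>. \<forall>i. transport_solvable (\<lambda>x t. lam x t $ i) (\<lambda>x t. lamx x t $ i) (\<gamma> i) (e i))"

lemma \<gamma>: "transport_solvable (\<lambda>x t. lam x t $ i) (\<lambda>x t. lamx x t $ i) (\<gamma> i) (e i)"
  unfolding \<gamma>_def using someI_ex[OF solvable_exists] by blast

lemma \<gamma>_start: "x \<in> {0..1} \<Longrightarrow> 0 \<le> t \<Longrightarrow> \<gamma> i x t t = x"
  and \<gamma>_deriv: "x \<in> {0..1} \<Longrightarrow> 0 \<le> t \<Longrightarrow> (\<gamma> i x t has_real_derivative lam x t $ i) (at t within {0..})"
  using \<gamma>[of i] unfolding transport_solvable_def by auto

text \<open>What an iterate must fulfil for the next inflow data to be compatible. The first-order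
  condition involves its time derivative only through the outflow vector at time 0, hence only at
  the corners \<open>x = 0\<close> and \<open>x = 1\<close>.\<close>

definition admissible where
  "admissible u p q \<longleftrightarrow>
    (\<forall>x\<in>{0..1}. \<forall>t\<ge>0. ((\<lambda>x. u x t) has_vector_derivative p x t) (at x within {0..1}) \<and>
      (u x has_vector_derivative q x t) (at t within {0..})) \<and>
    strip_cont {0..} p \<and> strip_cont {0..} q \<and>
    (\<forall>x\<in>{0..1}. u x 0 = phi x) \<and> q 0 0 = q0 0 \<and> q 1 0 = q0 1"

text \<open>The \<open>x\<close>-derivative of the equation of the step, with \<open>p\<close>
  belonging to the old iterate and \<open>w\<close> standing for the derivative of the new one. It
  is expressed along the characteristics, so no second derivatives occur.\<close>

definition along where
  "along u p w \<longleftrightarrow> (\<forall>i. \<forall>x\<in>{0..1}. \<forall>t\<ge>0.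
    ((\<lambda>\<tau>. w (\<gamma> i x t \<tau>) \<tau> $ i) has_real_derivative
      fx x t (u x t) $ i + gf i x t (u x t) \<bullet> p x t - lamx x t $ i * w x t $ i)
      (at t within strip_times (\<gamma> i x t)))"

lemma outflow_deriv:
  assumes "\<And>x. x \<in> {0..1} \<Longrightarrow> (u x has_vector_derivative q x t) (at t within {0..})"
  shows "(outflow e u has_vector_derivative outflow e q t) (at t within {0..})"
  using assms[of "1 - e _"] by (simp add: has_vector_derivative_vec_iff)

lemma outflow_cont:
  assumes "strip_cont {0..} u"
  shows "continuous_on {0..} (outflow e u)"
proof -
  have "continuous_on {0..} (\<lambda>t. (\<lambda>(x, t). u x t) (1 - e j, t))" for j
    by (rule continuous_on_compose2[OF assms]) (auto intro!: continuous_intros)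
  then show ?thesis
    unfolding continuous_on_vec_nth_iff[of _ "outflow e u"] by (auto intro!: continuous_on_component)
qed

lemma step_exists:
  assumes adm: "admissible u p q"
  shows "\<exists>w pw qw. admissible w pw qw \<and> evolves u w pw qw \<and> along u p pw \<and> (\<forall>x\<in>{0..1}. qw x 0 = q0 x)"
proof -
  note A = adm[unfolded admissible_def]
  have u_x: "((\<lambda>x. u x t) has_vector_derivative p x t) (at x within {0..1})" if "x \<in> {0..1}" "0 \<le> t" for x t using A that by blast
  have u_t: "(u x has_vector_derivative q x t) (at t within {0..})" if "x \<in> {0..1}" "0 \<le> t" for x t using A that by blast
  have p: "strip_cont {0..} p" and q: "strip_cont {0..} q"
    and u0: "\<And>x. x \<in> {0..1} \<Longrightarrow> u x 0 = phi x" and corner: "q 0 0 = q0 0" "q 1 0 = q0 1" using A by blast+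
  have u: "strip_cont {0..} u"
    by (rule continuous_on_of_partials[OF _ u_x u_t q]) auto
  note u' = u[unfolded split_beta] and p' = p[unfolded split_beta]
  have v0: "outflow e u 0 = (\<chi> j. phi (1 - e j) $ j)"
    by (simp add: vec_eq_iff u0)
  have q0e: "q (e i) 0 = q0 (e i)" "q (1 - e i) 0 = q0 (1 - e i)" for i using e[of i] corner by auto
  have v0': "outflow e q 0 = (\<chi> j. q0 (1 - e j) $ j)"
    by (simp add: vec_eq_iff q0e)
  have "\<exists>w wx. transport_solution (\<lambda>x t. lam x t $ i) (\<lambda>x t. lamx x t $ i) (\<gamma> i) (e i)
      (\<lambda>x t. f x t (u x t) $ i) (\<lambda>x t. fx x t (u x t) $ i + gf i x t (u x t) \<bullet> p x t)
      (\<lambda>x. phi x $ i) (\<lambda>t. h t (outflow e u t) $ i) w wx" for i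
  proof -
    have "transport_data (\<lambda>x t. lam x t $ i) (e i)
      (\<lambda>x t. f x t (u x t) $ i) (\<lambda>x t. fx x t (u x t) $ i + gf i x t (u x t) \<bullet> p x t)
      (\<lambda>x. phi x $ i) (\<lambda>x. phi' x $ i) (\<lambda>t. h t (outflow e u t) $ i)
      (\<lambda>t. ht t (outflow e u t) $ i + gh i t (outflow e u t) \<bullet> outflow e q t)"
      unfolding transport_data_def
    proof (intro conjI ballI allI impI)
      show "strip_cont {0..} (\<lambda>x t. f x t (u x t) $ i)"
        unfolding split_beta by (intro continuous_intros continuous_on_comps u') auto
      show "strip_cont {0..} (\<lambda>x t. fx x t (u x t) $ i + gf i x t (u x t) \<bullet> p x t)"
        unfolding split_beta by (intro continuous_intros continuous_on_comps u' p') auto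
      show "((\<lambda>x. f x t (u x t) $ i) has_real_derivative fx x t (u x t) $ i + gf i x t (u x t) \<bullet> p x t) (at x within {0..1})"
        if "x \<in> {0..1}" "0 \<le> t" for x t
        by (rule chain_f[OF that u_x[OF that]])
      show "((\<lambda>x. phi x $ i) has_real_derivative phi' x $ i) (at x within {0..1})" if "x \<in> {0..1}" for x
        using phi_deriv[OF that] by (simp add: has_vector_derivative_vec_iff)
      show "continuous_on {0..1} (\<lambda>x. phi' x $ i)" by (intro continuous_on_component phi'_cont)
      show "((\<lambda>t. h t (outflow e u t) $ i) has_real_derivative
          ht t (outflow e u t) $ i + gh i t (outflow e u t) \<bullet> outflow e q t) (at t within {0..})" if "0 \<le> t" for t
        by (rule chain_h[OF that outflow_deriv]) (use u_t that in auto)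
      show "continuous_on {0..} (\<lambda>t. ht t (outflow e u t) $ i + gh i t (outflow e u t) \<bullet> outflow e q t)"
        by (intro continuous_intros continuous_on_comps[where a = "\<lambda>_. 0"] outflow_cont u q) auto
      show "h 0 (outflow e u 0) $ i = phi (e i) $ i" unfolding v0 by (rule compat0[symmetric])
      \<comment> \<open>By admissibility the outflow of \<open>q\<close> at time 0 is the vector
        \<open>v'(0)\<close> of the problem, so the corner condition of the transport problem is the
        first-order compatibility condition.\<close>
      show "ht 0 (outflow e u 0) $ i + gh i 0 (outflow e u 0) \<bullet> outflow e q 0
          = f (e i) 0 (u (e i) 0) $ i - lam (e i) 0 $ i * phi' (e i) $ i"
        unfolding v0 v0' q0_def gh_def using compat1[of i] u0[of "e i"] by simp
    qed
    then show ?thesis using \<gamma>[of i] unfolding transport_solvable_def by blast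
  qed
  note ex = this
  let ?TS = "\<lambda>i. transport_solution (\<lambda>x t. lam x t $ i) (\<lambda>x t. lamx x t $ i) (\<gamma> i) (e i)
      (\<lambda>x t. f x t (u x t) $ i) (\<lambda>x t. fx x t (u x t) $ i + gf i x t (u x t) \<bullet> p x t)
      (\<lambda>x. phi x $ i) (\<lambda>t. h t (outflow e u t) $ i)"
  define W where "W = (\<lambda>i. SOME w. \<exists>wx. ?TS i w wx)"
  define Wx where "Wx = (\<lambda>i. SOME wx. ?TS i (W i) wx)"
  have W: "transport_solution (\<lambda>x t. lam x t $ i) (\<lambda>x t. lamx x t $ i) (\<gamma> i) (e i)
      (\<lambda>x t. f x t (u x t) $ i) (\<lambda>x t. fx x t (u x t) $ i + gf i x t (u x t) \<bullet> p x t)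
      (\<lambda>x. phi x $ i) (\<lambda>t. h t (outflow e u t) $ i) (W i) (Wx i)" for i
  proof -
    have "\<exists>wx. ?TS i (W i) wx" using someI_ex[OF ex[of i]] unfolding W_def by assumption
    from someI_ex[OF this] show ?thesis unfolding Wx_def by assumption
  qed
  note W = W[unfolded transport_solution_def]
  define w where "w = (\<lambda>x t. \<chi> i. W i x t)"
  define pw where "pw = (\<lambda>x t. \<chi> i. Wx i x t)"
  define qw where "qw = (\<lambda>x t. \<chi> i. f x t (u x t) $ i - lam x t $ i * Wx i x t)"
  have w_x: "((\<lambda>x. w x t) has_vector_derivative pw x t) (at x within {0..1})"
    and w_t: "(w x has_vector_derivative qw x t) (at t within {0..})" if "x \<in> {0..1}" "0 \<le> t" for x t
    unfolding has_vector_derivative_vec_iff w_def pw_def qw_def using W that by auto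
  have Wxc: "continuous_on ({0..1} \<times> {0..}) (\<lambda>z. Wx i (fst z) (snd z))" for i
    using W[of i] by (simp add: split_beta)
  have pwc: "strip_cont {0..} pw"
    unfolding pw_def split_beta by (intro continuous_on_vec_lambda Wxc)
  have qwc: "strip_cont {0..} qw"
    unfolding qw_def split_beta
    by (intro continuous_on_vec_lambda continuous_intros continuous_on_comps u' Wxc) auto
  have w0: "w x 0 = phi x" if "x \<in> {0..1}" for x
    using W that by (auto simp: w_def vec_eq_iff)
  \<comment> \<open>At time 0 the space derivative of \<open>w\<close> is that of the initial
    values; this turns the equation at \<open>t = 0\<close> into \<open>qw x 0 = q0 x\<close> and so
    hands admissibility on to the next step.\<close>
  have pw0: "pw x 0 = phi' x" if "x \<in> {0..1}" for x
  proof -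
    have "(phi has_vector_derivative pw x 0) (at x within {0..1})"
      by (rule has_vector_derivative_transform[OF that _ w_x[OF that order_refl]]) (simp add: w0)
    moreover have "at x within {0..1} \<noteq> bot"
      using that by (simp add: trivial_limit_within islimpt_Icc)
    ultimately show ?thesis
      using vector_derivative_unique_within phi_deriv[OF that] by blast
  qed
  have qw0: "qw x 0 = q0 x" if "x \<in> {0..1}" for x
    unfolding qw_def q0_def u0[OF that] pw0[OF that, symmetric] pw_def by simp
  have "admissible w pw qw"
    unfolding admissible_def using w_x w_t pwc qwc w0 qw0 by auto
  moreover have "evolves u w pw qw"
    unfolding evolves_def using w_x w_t pwc qwc w0 W by (auto simp: qw_def pw_def w_def)
  moreover have "along u p pw"
    unfolding along_def pw_def using W by simp
  ultimately show ?thesis using qw0 by blast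
qed

text \<open>\<open>q0\<close> contains \<open>phi'\<close> and is only continuous, so a start linear
  in time with slope \<open>q0 x\<close> need not be C1. The slope interpolates affinely between the
  two corner values instead.\<close>

lemma admissible_start: "\<exists>u p q. admissible u p q"
proof (intro exI)
  have "((\<lambda>x. phi x + t *\<^sub>R ((1 - x) *\<^sub>R q0 0 + x *\<^sub>R q0 1)) has_vector_derivative phi' x + t *\<^sub>R (q0 1 - q0 0)) (at x within {0..1})"
    if "x \<in> {0..1}" for x t
    using phi_deriv[OF that] by (auto intro!: derivative_eq_intros simp: algebra_simps)
  moreover have "((\<lambda>t. phi x + t *\<^sub>R ((1 - x) *\<^sub>R q0 0 + x *\<^sub>R q0 1)) has_vector_derivative ((1 - x) *\<^sub>R q0 0 + x *\<^sub>R q0 1)) (at t within {0..})"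
    for x t
    by (auto intro!: derivative_eq_intros)
  moreover have "strip_cont {0..} (\<lambda>x t. phi' x + t *\<^sub>R (q0 1 - q0 0))"
    unfolding split_beta by (intro continuous_intros continuous_on_compose2[OF phi'_cont]) auto
  moreover have "continuous_on ({0..1} \<times> {0..}) (\<lambda>(x, t::real). (1 - x) *\<^sub>R q0 0 + x *\<^sub>R q0 1)"
    unfolding split_beta by (intro continuous_intros)
  ultimately show "admissible (\<lambda>x t. phi x + t *\<^sub>R ((1 - x) *\<^sub>R q0 0 + x *\<^sub>R q0 1)) (\<lambda>x t. phi' x + t *\<^sub>R (q0 1 - q0 0))
      (\<lambda>x t. (1 - x) *\<^sub>R q0 0 + x *\<^sub>R q0 1)"
    unfolding admissible_def by auto
qed

lemma iteration_exists:
  "\<exists>U P R. \<forall>m. admissible (U m) (P m) (R m) \<and> evolves (U m) (U (Suc m)) (P (Suc m)) (R (Suc m)) \<and>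
    along (U m) (P m) (P (Suc m)) \<and> (\<forall>x\<in>{0..1}. R (Suc m) x 0 = q0 x)"
proof -
  let ?P = "\<lambda>(m::nat) s. admissible (fst s) (fst (snd s)) (snd (snd s))"
  let ?Q = "\<lambda>(m::nat) s r. evolves (fst s) (fst r) (fst (snd r)) (snd (snd r)) \<and>
    along (fst s) (fst (snd s)) (fst (snd r)) \<and> (\<forall>x\<in>{0..1}. snd (snd r) x 0 = q0 x)"
  have "\<exists>g. \<forall>m. ?P m (g m) \<and> ?Q m (g m) (g (Suc m))"
  proof (rule dependent_nat_choice[where P = ?P and Q = ?Q])
    show "\<exists>s. ?P 0 s" using admissible_start by auto
    show "\<exists>r. ?P (Suc m) r \<and> ?Q m s r" if "?P m s" for m s
      using step_exists[OF that] by auto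
  qed
  then obtain g where "\<forall>m. ?P m (g m) \<and> ?Q m (g m) (g (Suc m))" by blast
  then show ?thesis
    by (intro exI[of _ "\<lambda>m. fst (g m)"] exI[of _ "\<lambda>m. fst (snd (g m))"] exI[of _ "\<lambda>m. snd (snd (g m))"]) blast
qed

text \<open>Compactness of the slab bounds the speeds and their slopes. The bounds on the gradients
  hold for all values of the unknown, so the same constants serve every iterate and every
  solution.\<close>

lemma constants_exist:
  obtains \<Lambda> c F H where "0 \<le> c" "0 \<le> F" "0 \<le> H"
    "\<And>i x t. x \<in> {0..1} \<Longrightarrow> 0 \<le> t \<Longrightarrow> t \<le> T \<Longrightarrow> (1 - 2 * e i) * lam x t $ i \<le> \<Lambda>"
    "\<And>i x t. x \<in> {0..1} \<Longrightarrow> 0 \<le> t \<Longrightarrow> t \<le> T \<Longrightarrow> \<bar>lamx x t $ i\<bar> \<le> c"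
    "\<And>i x t y. x \<in> {0..1} \<Longrightarrow> 0 \<le> t \<Longrightarrow> t \<le> T \<Longrightarrow> norm (gf i x t y) \<le> F"
    "\<And>i t z. 0 \<le> t \<Longrightarrow> t \<le> T \<Longrightarrow> norm (gh i t z) \<le> H"
proof -
  have bdd: "\<exists>K. \<forall>x t. x \<in> {0..1} \<longrightarrow> 0 \<le> t \<longrightarrow> t \<le> T \<longrightarrow> norm (g x t) \<le> K"
    if "strip_cont {0..} g" for g :: "real \<Rightarrow> real \<Rightarrow> real ^ 'n"
  proof -
    have "bounded ((\<lambda>(x, t). g x t) ` ({0..1} \<times> {0..T}))"
      by (intro compact_imp_bounded compact_continuous_image continuous_on_subset[OF that] compact_Times) auto
    then obtain K where K: "\<And>p. p \<in> {0..1} \<times> {0..T} \<Longrightarrow> norm ((\<lambda>(x, t). g x t) p) \<le> K"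
      unfolding bounded_iff by blast
    have "norm (g x t) \<le> K" if "x \<in> {0..1}" "0 \<le> t" "t \<le> T" for x t using K[of "(x, t)"] that by simp
    then show ?thesis by blast
  qed
  obtain \<Lambda> where \<Lambda>: "\<And>x t. x \<in> {0..1} \<Longrightarrow> 0 \<le> t \<Longrightarrow> t \<le> T \<Longrightarrow> norm (lam x t) \<le> \<Lambda>" using bdd[OF lam_cont] by blast
  obtain c where c: "\<And>x t. x \<in> {0..1} \<Longrightarrow> 0 \<le> t \<Longrightarrow> t \<le> T \<Longrightarrow> norm (lamx x t) \<le> c" using bdd[OF lamx_cont] by blast
  obtain F where F: "\<And>i x t y. x \<in> {0..1} \<Longrightarrow> 0 \<le> t \<Longrightarrow> t \<le> T \<Longrightarrow> norm (gf i x t y) \<le> F"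
    using f_grad_bound[of T] unfolding gf_def by blast
  obtain H where H: "\<And>i t z. 0 \<le> t \<Longrightarrow> t \<le> T \<Longrightarrow> norm (gh i t z) \<le> H"
    using h_grad_bound[of T] unfolding gh_def by blast
  show ?thesis
  proof (rule that[of "max 0 c" "max 0 F" "max 0 H" \<Lambda>])
    show "(1 - 2 * e i) * lam x t $ i \<le> \<Lambda>" if "x \<in> {0..1}" "0 \<le> t" "t \<le> T" for i x t
      using \<Lambda>[OF that] component_le_norm_cart[of "lam x t" i] e[of i] by (auto simp: abs_le_iff)
    show "\<bar>lamx x t $ i\<bar> \<le> max 0 c" if "x \<in> {0..1}" "0 \<le> t" "t \<le> T" for i x t
      using c[OF that] component_le_norm_cart[of "lamx x t" i] by linarith
    show "norm (gf i x t y) \<le> max 0 F" if "x \<in> {0..1}" "0 \<le> t" "t \<le> T" for i x t y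
      using F[OF that, of i y] by linarith
    show "norm (gh i t z) \<le> max 0 H" if "0 \<le> t" "t \<le> T" for i t z
      using H[OF that, of i z] by linarith
  qed auto
qed

lemma strip_systemI:
  assumes "0 \<le> T" "0 \<le> c" "0 \<le> F" "0 \<le> H"
    "\<And>i x t. x \<in> {0..1} \<Longrightarrow> 0 \<le> t \<Longrightarrow> t \<le> T \<Longrightarrow> (1 - 2 * e i) * lam x t $ i \<le> \<Lambda>"
  shows "strip_system T e \<gamma> (\<lambda>i x t. lam x t $ i) \<Lambda> c F H"
  by unfold_locales (use assms e \<gamma>_start \<gamma>_deriv lam_sign in auto)

lemma diff_ineq:
  assumes u: "evolves u1 w1 p1 q1" "evolves u2 w2 p2 q2"
    and F: "\<And>i x t y. x \<in> {0..1} \<Longrightarrow> 0 \<le> t \<Longrightarrow> t \<le> T \<Longrightarrow> norm (gf i x t y) \<le> F" "0 \<le> F"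
    and H: "\<And>i t z. 0 \<le> t \<Longrightarrow> t \<le> T \<Longrightarrow> norm (gh i t z) \<le> H" "0 \<le> H"
    and c: "0 \<le> c"
  shows "transport_ineq T e \<gamma> c F H 0 (\<lambda>x t. w1 x t - w2 x t) (\<lambda>x t. u1 x t - u2 x t)"
  unfolding transport_ineq_def
proof (intro conjI allI ballI impI)
  note D1 = evolvesD[OF u(1)] and D2 = evolvesD[OF u(2)]
  have "strip_cont {0..T} w1" "strip_cont {0..T} w2"
    by (rule continuous_on_subset[OF D1(8)] continuous_on_subset[OF D2(8)], force)+
  then show "strip_cont {0..T} (\<lambda>x t. w1 x t - w2 x t)"
    unfolding split_beta by (intro continuous_intros)
  fix i x t assume "x \<in> {0..1::real}" "t \<in> {0<..T}" "x \<noteq> e i"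
  then have xt: "x \<in> {0..1}" "0 < t" "t \<le> T" "0 \<le> t" by auto
  let ?A = "strip_times (\<gamma> i x t)"
  have gx: "\<gamma> i x t t = x" by (rule \<gamma>_start[OF xt(1,4)])
  have gd: "(\<gamma> i x t has_real_derivative lam x t $ i) (at t within ?A)"
    by (rule has_field_derivative_subset[OF \<gamma>_deriv[OF xt(1,4)]]) auto
  have along: "((\<lambda>\<tau>. w (\<gamma> i x t \<tau>) \<tau> $ i) has_real_derivative f x t (u x t) $ i) (at t within ?A)"
    if D: "evolves u w p q" for u w p q
  proof -
    note D = evolvesD[OF that]
    have "((\<lambda>\<tau>. w (\<gamma> i x t \<tau>) \<tau>) has_vector_derivative (lam x t $ i *\<^sub>R p x t + q (\<gamma> i x t t) t)) (at t within ?A)"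
      by (rule has_vector_derivative_along_curve[where A = "{0..1}" and B = "{0..}"])
        (use xt gd gx D in auto)
    then have "((\<lambda>\<tau>. w (\<gamma> i x t \<tau>) \<tau> $ i) has_real_derivative lam x t $ i * p x t $ i + q x t $ i) (at t within ?A)"
      unfolding has_vector_derivative_vec_iff gx by simp
    then show ?thesis using D(5)[OF xt(1,2), of i] by simp
  qed
  show "\<exists>G. ((\<lambda>\<tau>. (w1 (\<gamma> i x t \<tau>) \<tau> - w2 (\<gamma> i x t \<tau>) \<tau>) $ i) has_real_derivative G) (at t within ?A) \<and>
     \<bar>G\<bar> \<le> c * \<bar>(w1 x t - w2 x t) $ i\<bar> + F * (\<Sum>j\<in>UNIV. \<bar>(u1 x t - u2 x t) $ j\<bar>) + 0"
  proof (intro exI conjI)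
    show "((\<lambda>\<tau>. (w1 (\<gamma> i x t \<tau>) \<tau> - w2 (\<gamma> i x t \<tau>) \<tau>) $ i) has_real_derivative
        f x t (u1 x t) $ i - f x t (u2 x t) $ i) (at t within ?A)"
      using DERIV_diff[OF along[OF u(1)] along[OF u(2)]] by simp
    have "\<bar>f x t (u1 x t) $ i - f x t (u2 x t) $ i\<bar> \<le> F * norm (u1 x t - u2 x t)"
      by (rule f_diff[OF xt(1,4) F(1)[OF xt(1,4,3)]])
    also have "\<dots> \<le> F * (\<Sum>j\<in>UNIV. \<bar>(u1 x t - u2 x t) $ j\<bar>)"
      by (intro mult_left_mono norm_le_l1_cart F)
    finally show "\<bar>f x t (u1 x t) $ i - f x t (u2 x t) $ i\<bar>
        \<le> c * \<bar>(w1 x t - w2 x t) $ i\<bar> + F * (\<Sum>j\<in>UNIV. \<bar>(u1 x t - u2 x t) $ j\<bar>) + 0"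
      using mult_nonneg_nonneg[OF c abs_ge_zero[of "(w1 x t - w2 x t) $ i"]] by linarith
  qed
next
  fix i x assume "x \<in> {0..1::real}"
  then show "\<bar>(w1 x 0 - w2 x 0) $ i\<bar> \<le> 0"
    using evolvesD(7)[OF u(1)] evolvesD(7)[OF u(2)] by simp
next
  fix i t assume "t \<in> {0<..T}"
  then have t: "0 < t" "t \<le> T" "0 \<le> t" by auto
  have "\<bar>(w1 (e i) t - w2 (e i) t) $ i\<bar> = \<bar>h t (outflow e u1 t) $ i - h t (outflow e u2 t) $ i\<bar>"
    using evolvesD(6)[OF u(1) t(1)] evolvesD(6)[OF u(2) t(1)] by simp
  also have "\<dots> \<le> H * norm (outflow e u1 t - outflow e u2 t)"
    by (rule h_diff[OF t(3) H(1)[OF t(3,2)]])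
  also have "\<dots> \<le> H * (\<Sum>j\<in>UNIV. \<bar>(outflow e u1 t - outflow e u2 t) $ j\<bar>)"
    by (intro mult_left_mono norm_le_l1_cart H)
  finally show "\<bar>(w1 (e i) t - w2 (e i) t) $ i\<bar> \<le> H * (\<Sum>j\<in>UNIV. \<bar>(u1 (1 - e j) t - u2 (1 - e j) t) $ j\<bar>) + 0"
    by simp
qed

lemma evolves_unique:
  assumes u: "evolves u u p q" and w: "evolves w w p' q'" and xt: "x \<in> {0..1}" "0 \<le> t"
  shows "w x t = u x t"
proof -
  obtain \<Lambda> c F H where C: "0 \<le> c" "0 \<le> F" "0 \<le> H"
    "\<And>i x s. x \<in> {0..1} \<Longrightarrow> 0 \<le> s \<Longrightarrow> s \<le> t \<Longrightarrow> (1 - 2 * e i) * lam x s $ i \<le> \<Lambda>"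
    "\<And>i x s. x \<in> {0..1} \<Longrightarrow> 0 \<le> s \<Longrightarrow> s \<le> t \<Longrightarrow> \<bar>lamx x s $ i\<bar> \<le> c"
    "\<And>i x s y. x \<in> {0..1} \<Longrightarrow> 0 \<le> s \<Longrightarrow> s \<le> t \<Longrightarrow> norm (gf i x s y) \<le> F"
    "\<And>i s z. 0 \<le> s \<Longrightarrow> s \<le> t \<Longrightarrow> norm (gh i s z) \<le> H"
    by (rule constants_exist[where T = t]) (rule that)
  interpret S: strip_system t e \<gamma> "\<lambda>i x t. lam x t $ i" \<Lambda> c F H
    by (rule strip_systemI[OF xt(2) C(1-4)])
  have "w x t - u x t = 0"
    by (rule S.transport_ineq_unique[OF diff_ineq[OF w u C(6) C(2) C(7) C(3) C(1)] xt]) auto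
  then show ?thesis by simp
qed

section \<open>The inflow values of the space derivatives\<close>

text \<open>A pair \<open>y\<close> holds the boundary values at \<open>x = 0\<close> and \<open>x = 1\<close>.\<close>

definition inside :: "'n \<Rightarrow> (real ^ 'n) \<times> (real ^ 'n) \<Rightarrow> real ^ 'n" where
  "inside i y = (if e i = 0 then fst y else snd y)"

definition outside :: "'n \<Rightarrow> (real ^ 'n) \<times> (real ^ 'n) \<Rightarrow> real ^ 'n" where
  "outside i y = (if e i = 0 then snd y else fst y)"

lemma inside_outside: "inside i (u 0 t, u 1 t) = u (e i) t" "outside i (u 0 t, u 1 t) = u (1 - e i) t"
  using e[of i] by (auto simp: inside_def outside_def)

lemma inside_outside_cont: "continuous_on S y \<Longrightarrow> continuous_on S (\<lambda>s. inside i (y s))"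
  "continuous_on S y \<Longrightarrow> continuous_on S (\<lambda>s. outside i (y s))"
  by (cases "e i = 0"; simp add: inside_def outside_def continuous_on_fst continuous_on_snd)+

text \<open>Differentiating the inflow condition in \<open>t\<close> and eliminating the time derivatives with the equations
  of two successive steps expresses the inflow value of \<open>\<partial>\<^sub>x u\<^sub>i\<close> affinely in its previous outflow values.\<close>

definition inflow_const where
  "inflow_const i t y = (f (e i) t (inside i (snd y)) $ i - ht t (\<chi> j. outside j (snd y) $ j) $ i
    - gh i t (\<chi> j. outside j (snd y) $ j) \<bullet> (\<chi> j. f (1 - e j) t (outside j (fst y)) $ j)) / lam (e i) t $ i"

definition inflow_linear where
  "inflow_linear i t y = (1 / lam (e i) t $ i) *\<^sub>R (\<chi> j. gh i t (\<chi> j. outside j y $ j) $ j * lam (1 - e j) t $ j)"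

lemma inflow_const_cont: "continuous_on ({0..T} \<times> UNIV) (\<lambda>(t, y). inflow_const i t y)"
  unfolding inflow_const_def split_beta
  by (intro continuous_intros continuous_on_comps continuous_on_comps(6,7)[where a = "\<lambda>_. 0"]
      continuous_on_vec_lambda inside_outside_cont) (auto simp: lam_nonzero)

lemma inflow_linear_cont: "continuous_on ({0..T} \<times> UNIV) (\<lambda>(t, y). inflow_linear i t y)"
  unfolding inflow_linear_def split_beta
  by (intro continuous_intros continuous_on_comps continuous_on_comps(6,7)[where a = "\<lambda>_. 0"]
      continuous_on_vec_lambda inside_outside_cont) (auto simp: lam_nonzero)

text \<open>Three successive functions enter: the time derivative of \<open>w\<close> at the inflow
  end comes from the equation frozen at \<open>u\<close>, and that of \<open>u\<close> at the
  outflow ends from the equation frozen at \<open>u0\<close>. Dividing by the speed, which does not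
  vanish, isolates \<open>p\<close>.\<close>

lemma inflow_derivative:
  assumes w0: "evolves u0 u p0 q0'" and w1: "evolves u w p q" and t: "0 < t"
  shows "p (e i) t $ i = inflow_const i t ((u0 0 t, u0 1 t), (u 0 t, u 1 t)) +
    inflow_linear i t (u 0 t, u 1 t) \<bullet> outflow e p0 t"
proof -
  let ?v = "outflow e u t"
  have v: "(\<chi> j. outside j (u 0 t, u 1 t) $ j) = ?v"
    by (simp add: vec_eq_iff inside_outside)
  have t0: "0 \<le> t" using t by simp
  have att: "at t within {0..} = at t" using t by (intro at_within_interior) auto
  have "((\<lambda>t. h t (outflow e u t) $ i) has_real_derivative ht t ?v $ i + gh i t ?v \<bullet> outflow e q0' t) (at t within {0..})"
    by (rule chain_h[OF t0 outflow_deriv]) (use evolvesD(2)[OF w0] t0 in auto)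
  \<comment> \<open>The inflow condition is known for positive times only; the radius
    \<open>d = t\<close> stays among them.\<close>
  then have "((\<lambda>t. w (e i) t $ i) has_real_derivative ht t ?v $ i + gh i t ?v \<bullet> outflow e q0' t) (at t within {0..})"
    by (rule has_field_derivative_transform_within[where d = t])
      (use t evolvesD(6)[OF w1] in \<open>auto simp: dist_real_def\<close>)
  moreover have "((\<lambda>t. w (e i) t $ i) has_real_derivative q (e i) t $ i) (at t within {0..})"
    using evolvesD(2)[OF w1, of "e i" t] t0 by (simp add: has_vector_derivative_vec_iff)
  ultimately have q: "q (e i) t $ i = ht t ?v $ i + gh i t ?v \<bullet> outflow e q0' t"
    unfolding att by (rule DERIV_unique[symmetric])
  have q': "outflow e q0' t = (\<chi> j. f (1 - e j) t (u0 (1 - e j) t) $ j) - (\<chi> j. lam (1 - e j) t $ j * outflow e p0 t $ j)"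
    using evolvesD(5)[OF w0 _ t] by (simp add: vec_eq_iff)
  have lin: "gh i t ?v \<bullet> (\<chi> j. lam (1 - e j) t $ j * outflow e p0 t $ j)
      = (\<chi> j. gh i t ?v $ j * lam (1 - e j) t $ j) \<bullet> outflow e p0 t"
    by (simp add: inner_vec_def mult.assoc)
  have "lam (e i) t $ i * p (e i) t $ i = f (e i) t (u (e i) t) $ i - q (e i) t $ i"
    using evolvesD(5)[OF w1, of "e i" t i] t by simp
  also have "\<dots> = f (e i) t (u (e i) t) $ i - ht t ?v $ i - gh i t ?v \<bullet> (\<chi> j. f (1 - e j) t (u0 (1 - e j) t) $ j)
      + (\<chi> j. gh i t ?v $ j * lam (1 - e j) t $ j) \<bullet> outflow e p0 t"
    unfolding q q' lin[symmetric] inner_diff_right by simp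
  finally have "p (e i) t $ i = (f (e i) t (u (e i) t) $ i - ht t ?v $ i - gh i t ?v \<bullet> (\<chi> j. f (1 - e j) t (u0 (1 - e j) t) $ j)
      + (\<chi> j. gh i t ?v $ j * lam (1 - e j) t $ j) \<bullet> outflow e p0 t) / lam (e i) t $ i"
    using lam_nonzero[of "e i" t i] t0 by (simp add: eq_divide_eq mult.commute)
  then show ?thesis
    unfolding inflow_const_def inflow_linear_def fst_conv snd_conv v
    unfolding inside_outside
    by (simp add: add_divide_distrib)
qed

text \<open>On each slab \<open>U\<close> converges by contraction. Its limit makes the coefficients
  of the recursion for the space derivatives converge, so these converge as well, and the equation
  then yields the time derivatives.\<close>

lemma evolves_exists: "\<exists>u p q. evolves u u p q"
proof -
  obtain U P R where it: "\<And>m. admissible (U m) (P m) (R m) \<and> evolves (U m) (U (Suc m)) (P (Suc m)) (R (Suc m)) \<and>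
    along (U m) (P m) (P (Suc m)) \<and> (\<forall>x\<in>{0..1}. R (Suc m) x 0 = q0 x)"
    using iteration_exists by blast
  have ev: "evolves (U m) (U (Suc m)) (P (Suc m)) (R (Suc m))"
    and al: "along (U m) (P m) (P (Suc m))" and R0: "x \<in> {0..1} \<Longrightarrow> R (Suc m) x 0 = q0 x" for m x
    using it[of m] by auto
  have adm: "((\<lambda>x. U m x t) has_vector_derivative P m x t) (at x within {0..1})"
    "(U m x has_vector_derivative R m x t) (at t within {0..})" if "x \<in> {0..1}" "0 \<le> t" for m x t
    using it[of m] that unfolding admissible_def by blast+
  have Pc: "strip_cont {0..} (P m)"
    and Rc: "strip_cont {0..} (R m)"
    and U0: "x \<in> {0..1} \<Longrightarrow> U m x 0 = phi x" for m x
    using it[of m] unfolding admissible_def by blast+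
  have Uc: "strip_cont {0..} (U m)" for m
    by (rule continuous_on_of_partials[OF _ adm Rc]) auto
  have P0: "P m x 0 = phi' x" if x: "x \<in> {0..1}" for m x
  proof -
    have "(phi has_vector_derivative P m x 0) (at x within {0..1})"
      by (rule has_vector_derivative_transform[OF x _ adm(1)[OF x order_refl]]) (simp add: U0)
    moreover have "at x within {0..1} \<noteq> bot"
      using x by (simp add: trivial_limit_within islimpt_Icc)
    ultimately show ?thesis
      using vector_derivative_unique_within phi_deriv[OF x] by blast
  qed
  \<comment> \<open>\<open>evolves\<close> states the equation for positive times; at
    \<open>t = 0\<close> it follows from the initial values. The case is included so that
    \<open>R\<close> converges uniformly up to the initial line.\<close>
  have eq: "R (Suc m) x t = (\<chi> i. f x t (U m x t) $ i - lam x t $ i * P (Suc m) x t $ i)"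
    if "x \<in> {0..1}" "0 \<le> t" for m x t
  proof (cases "t = 0")
    case True
    then show ?thesis using R0[OF that(1)] U0[OF that(1)] P0[OF that(1)] by (simp add: q0_def)
  next
    case False
    then show ?thesis using evolvesD(5)[OF ev that(1), of t] that(2) by (simp add: vec_eq_iff)
  qed
  have sub: "strip_cont {0..T} g"
    if "strip_cont {0..} g" for T and g :: "real \<Rightarrow> real \<Rightarrow> real ^ 'n"
    by (rule continuous_on_subset[OF that]) auto
  have UP: "ucb ({0..1} \<times> {0..T}) (\<lambda>m (x, t). U m x t) \<and> ucb ({0..1} \<times> {0..T}) (\<lambda>m (x, t). P (Suc m) x t)"
    if T: "0 \<le> T" for T
  proof -
    obtain \<Lambda> c F H where C: "0 \<le> c" "0 \<le> F" "0 \<le> H"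
      "\<And>i x s. x \<in> {0..1} \<Longrightarrow> 0 \<le> s \<Longrightarrow> s \<le> T \<Longrightarrow> (1 - 2 * e i) * lam x s $ i \<le> \<Lambda>"
      "\<And>i x s. x \<in> {0..1} \<Longrightarrow> 0 \<le> s \<Longrightarrow> s \<le> T \<Longrightarrow> \<bar>lamx x s $ i\<bar> \<le> c"
      "\<And>i x s y. x \<in> {0..1} \<Longrightarrow> 0 \<le> s \<Longrightarrow> s \<le> T \<Longrightarrow> norm (gf i x s y) \<le> F"
      "\<And>i s z. 0 \<le> s \<Longrightarrow> s \<le> T \<Longrightarrow> norm (gh i s z) \<le> H"
      by (rule constants_exist[where T = T]) (rule that)
    have ucbU: "ucb ({0..1} \<times> {0..T}) (\<lambda>m (x, t). U m x t)"
    proof (rule strip_system.ucb_of_transport_ineq[OF strip_systemI[OF T C(1-4)]])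
      show "strip_cont {0..T} (U m)" for m by (rule sub[OF Uc])
      show "transport_ineq T e \<gamma> c F H 0 (\<lambda>x t. U (Suc (Suc m)) x t - U (Suc m) x t) (\<lambda>x t. U (Suc m) x t - U m x t)" for m
        by (rule diff_ineq[OF ev ev C(6) C(2) C(7) C(3) C(1)]) auto
    qed
    have Kz: "compact ({0..1::real} \<times> {0..T})" by (intro compact_Times) auto
    have ucbY: "ucb {0..T} (\<lambda>m t. (U m 0 t, U m 1 t))"
    proof (rule ucb_Pair)
      show "ucb {0..T} (\<lambda>m t. U m 0 t)" using ucb_reparam[OF ucbU, of "{0..T}" "\<lambda>t. (0, t)"] by simp
      show "ucb {0..T} (\<lambda>m t. U m 1 t)" using ucb_reparam[OF ucbU, of "{0..T}" "\<lambda>t. (1, t)"] by simp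
    qed
    define r where "r = (\<lambda>i m (x, t). fx x t (U (Suc m) x t) $ i)"
    define A where "A = (\<lambda>i m (x, t). gf i x t (U (Suc m) x t))"
    define s where "s = (\<lambda>i m t. inflow_const i t ((U m 0 t, U m 1 t), (U (Suc m) 0 t, U (Suc m) 1 t)))"
    define B where "B = (\<lambda>i m t. inflow_linear i t (U (Suc m) 0 t, U (Suc m) 1 t))"
    have ucbU': "ucb ({0..1} \<times> {0..T}) (\<lambda>m (x, t). U (Suc m) x t)"
      using ucb_Suc[OF ucbU] by simp
    have ucb_r: "ucb ({0..1} \<times> {0..T}) (r i)" for i
    proof -
      have "continuous_on (({0..1} \<times> {0..T}) \<times> UNIV) (\<lambda>(z, y). fx (fst z) (snd z) y $ i)"
        unfolding split_beta by (intro continuous_intros continuous_on_comps) auto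
      from ucb_compose[OF Kz this ucbU'] show ?thesis by (simp add: r_def case_prod_unfold)
    qed
    have ucb_A: "ucb ({0..1} \<times> {0..T}) (A i)" for i
    proof -
      have "continuous_on (({0..1} \<times> {0..T}) \<times> UNIV) (\<lambda>(z, y). gf i (fst z) (snd z) y)"
        unfolding split_beta by (intro continuous_intros continuous_on_comps) auto
      from ucb_compose[OF Kz this ucbU'] show ?thesis by (simp add: A_def case_prod_unfold)
    qed
    have ucb_s: "ucb {0..T} (s i)" for i
      using ucb_compose[OF _ inflow_const_cont ucb_Pair[OF ucbY ucb_Suc[OF ucbY]], of i] by (simp add: s_def)
    have ucb_B: "ucb {0..T} (B i)" for i
      using ucb_compose[OF _ inflow_linear_cont ucb_Suc[OF ucbY], of i] by (simp add: B_def)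
    have "\<forall>i. \<exists>K. \<forall>m. \<forall>t\<in>{0..T}. norm (B i m t) \<le> K" using ucb_B by (simp add: ucb_def)
    then obtain K where K: "\<And>i m t. t \<in> {0..T} \<Longrightarrow> norm (B i m t) \<le> K i" unfolding choice_iff by blast
    have K0: "0 \<le> K i" for i using order_trans[OF norm_ge_zero K[of 0 i]] T by simp
    \<comment> \<open>The inflow coefficients for the derivatives contain quotients of speeds
      besides the gradient of \<open>h\<close>, so \<open>H\<close> does not bound them. A second
      instance of \<open>strip_system\<close>, with its own \<open>a\<close> and \<open>M\<close>,
      is used.\<close>
    define H' where "H' = (\<Sum>i\<in>UNIV. K i)"
    have H': "0 \<le> H'" "K i \<le> H'" for i
      unfolding H'_def using K0 by (auto intro: sum_nonneg member_le_sum)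
    note sys = strip_systemI[OF T C(1,2) H'(1) C(4)]
    have "ucb ({0..1} \<times> {0..T}) (\<lambda>m (x, t). P (Suc m) x t)"
    \<comment> \<open>The recursion starts at \<open>P (Suc 0)\<close>: the inflow formula uses the
      equation satisfied by the previous iterate, and the starting iterate \<open>U 0\<close> need
      not satisfy one.\<close>
    proof (rule strip_system.linear_transport_ucb[OF sys, where A = A and r = r and B = B and s = s and lx = "\<lambda>i x t. lamx x t $ i"])
      show "strip_cont {0..T} (P (Suc m))" for m by (rule sub[OF Pc])
      show "((\<lambda>\<tau>. P (Suc (Suc m)) (\<gamma> i x t \<tau>) \<tau> $ i) has_real_derivative
          r i m (x, t) + A i m (x, t) \<bullet> P (Suc m) x t - lamx x t $ i * P (Suc (Suc m)) x t $ i)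
          (at t within strip_times (\<gamma> i x t))"
        if "x \<in> {0..1}" "0 < t" "t \<le> T" for i m x t
        using al[of "Suc m"] that unfolding along_def r_def A_def by (auto simp: less_imp_le)
      show "P (Suc (Suc m)) (e i) t $ i = s i m t + B i m t \<bullet> outflow e (P (Suc m)) t"
        if "0 < t" "t \<le> T" for i m t
        unfolding s_def B_def by (rule inflow_derivative[OF ev ev that(1)])
      show "P (Suc m) x 0 = P (Suc 0) x 0" if "x \<in> {0..1}" for m x using P0[OF that] by simp
      show "ucb ({0..1} \<times> {0..T}) (r i)" "ucb ({0..1} \<times> {0..T}) (A i)" for i by (fact ucb_r ucb_A)+
      show "ucb {0..T} (s i)" "ucb {0..T} (B i)" for i by (fact ucb_s ucb_B)+
      show "norm (A i m z) \<le> F" if "z \<in> {0..1} \<times> {0..T}" for i m z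
        using that C(6) by (auto simp: A_def)
      show "norm (B i m t) \<le> H'" if "t \<in> {0..T}" for i m t
        using K[OF that] H'(2) order_trans by blast
    qed (use C(5) in auto)
    with ucbU show ?thesis by blast
  qed
  define u where "u = (\<lambda>x t. lim (\<lambda>m. U m x t))"
  define p where "p = (\<lambda>x t. lim (\<lambda>m. P (Suc m) x t))"
  have uT: "uniform_limit ({0..1} \<times> {0..T}) (\<lambda>m (x, t). U m x t) (\<lambda>(x, t). u x t) sequentially"
    and pT: "uniform_limit ({0..1} \<times> {0..T}) (\<lambda>m (x, t). P (Suc m) x t) (\<lambda>(x, t). p x t) sequentially" if "0 \<le> T" for T
    using ucb_limit[OF conjunct1[OF UP[OF that]]] ucb_limit[OF conjunct2[OF UP[OF that]]]
    by (simp_all add: u_def p_def case_prod_unfold)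
  have ul: "(\<lambda>m. U m x t) \<longlonglongrightarrow> u x t" and pl: "(\<lambda>m. P (Suc m) x t) \<longlonglongrightarrow> p x t" if "x \<in> {0..1}" "0 \<le> t" for x t
    using tendsto_uniform_limitI[OF uT[of t], of "(x, t)"] tendsto_uniform_limitI[OF pT[of t], of "(x, t)"] that by auto
  define q where "q = (\<lambda>x t. \<chi> i. f x t (u x t) $ i - lam x t $ i * p x t $ i)"
  have uc: "strip_cont {0..} u"
    by (rule continuous_on_strip_local, rule uniform_limit_theorem[OF _ uT])
      (auto intro: always_eventually sub[OF Uc])
  have pc: "strip_cont {0..} p"
    by (rule continuous_on_strip_local, rule uniform_limit_theorem[OF _ pT])
      (auto intro: always_eventually sub[OF Pc])
  have qc: "strip_cont {0..} q"
    unfolding q_def split_beta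
    by (intro continuous_on_vec_lambda continuous_intros continuous_on_comps uc[unfolded split_beta] pc[unfolded split_beta]) auto
  have fl: "(\<lambda>m. f x t (U m x t)) \<longlonglongrightarrow> f x t (u x t)" if "x \<in> {0..1}" "0 \<le> t" for x t
  proof -
    have "continuous_on UNIV (f x t)"
      using continuous_on_comps(3)[of UNIV "\<lambda>_. x" "\<lambda>_. t" "\<lambda>y. y"] that by (auto simp: continuous_on_const continuous_on_id)
    then have "isCont (f x t) (u x t)" by (simp add: continuous_on_eq_continuous_at)
    from isCont_tendsto_compose[OF this ul[OF that]] show ?thesis .
  qed
  \<comment> \<open>By \<open>eq\<close> the time derivative is a fixed continuous function of the
    point and of the values of \<open>U\<close> and \<open>P\<close>, so \<open>ucb_compose\<close>
    gives its convergence without a further recursion.\<close>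
  have qT: "uniform_limit ({0..1} \<times> {0..T}) (\<lambda>m (x, t). R (Suc m) x t) (\<lambda>(x, t). q x t) sequentially" if T: "0 \<le> T" for T
  proof -
    have Kz: "compact ({0..1::real} \<times> {0..T})" by (intro compact_Times) auto
    have c: "continuous_on (({0..1} \<times> {0..T}) \<times> UNIV) (\<lambda>(z, y). \<chi> i. f (fst z) (snd z) (fst y) $ i - lam (fst z) (snd z) $ i * snd y $ i)"
      unfolding split_beta by (intro continuous_on_vec_lambda continuous_intros continuous_on_comps) auto
    have "ucb ({0..1} \<times> {0..T}) (\<lambda>m z. \<chi> i. f (fst z) (snd z) (U m (fst z) (snd z)) $ i - lam (fst z) (snd z) $ i * P (Suc m) (fst z) (snd z) $ i)"
      using ucb_compose[OF Kz c ucb_Pair[OF conjunct1[OF UP[OF T]] conjunct2[OF UP[OF T]]]]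
      by (simp add: split_beta)
    from ucb_limit[OF this]
    have 1: "uniform_limit ({0..1} \<times> {0..T}) (\<lambda>m z. R (Suc m) (fst z) (snd z))
      (\<lambda>z. lim (\<lambda>m. \<chi> i. f (fst z) (snd z) (U m (fst z) (snd z)) $ i - lam (fst z) (snd z) $ i * P (Suc m) (fst z) (snd z) $ i)) sequentially"
      by (rule uniform_limit_cong'[THEN iffD1, rotated 2]) (auto simp: eq)
    have "lim (\<lambda>m. \<chi> i. f x t (U m x t) $ i - lam x t $ i * P (Suc m) x t $ i) = q x t" if "x \<in> {0..1}" "0 \<le> t" for x t
      unfolding q_def
      by (intro limI vec_tendstoI) (auto intro!: tendsto_intros fl pl that tendsto_vec_nth)
    then have 2: "lim (\<lambda>m. \<chi> i. f (fst z) (snd z) (U m (fst z) (snd z)) $ i - lam (fst z) (snd z) $ i * P (Suc m) (fst z) (snd z) $ i) = q (fst z) (snd z)"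
      if "z \<in> {0..1} \<times> {0..T}" for z using that by auto
    have "uniform_limit ({0..1} \<times> {0..T}) (\<lambda>m z. R (Suc m) (fst z) (snd z)) (\<lambda>z. q (fst z) (snd z)) sequentially"
      by (rule uniform_limit_cong'[THEN iffD1, OF refl 2 1])
    then show ?thesis by (simp add: case_prod_unfold)
  qed
  have "evolves u u p q"
    unfolding evolves_def
  proof (intro conjI ballI allI impI)
    fix x t :: real assume x: "x \<in> {0..1}" and t: "0 \<le> t"
    show "((\<lambda>x. u x t) has_vector_derivative p x t) (at x within {0..1})"
    proof (rule has_vector_derivative_limit[where f = "\<lambda>m x. U (Suc m) x t" and f' = "\<lambda>m x. P (Suc m) x t" and g' = "\<lambda>x. p x t"])
      show "uniform_limit {0..1} (\<lambda>m x. P (Suc m) x t) (\<lambda>x. p x t) sequentially"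
        using uniform_limit_compose'[OF pT[OF t], of "\<lambda>x. (x, t)" "{0..1}"] t by (simp add: Pi_iff)
    qed (use x t adm LIMSEQ_Suc[OF ul] in auto)
    have "(u x has_vector_derivative q x t) (at t within {0..t+1})"
    proof (rule has_vector_derivative_limit[where f = "\<lambda>m. U (Suc m) x" and f' = "\<lambda>m. R (Suc m) x" and g' = "q x"])
      show "uniform_limit {0..t+1} (\<lambda>m. R (Suc m) x) (q x) sequentially"
        using uniform_limit_compose'[OF qT[of "t+1"], of "\<lambda>s. (x, s)" "{0..t+1}"] t x by (simp add: Pi_iff)
      show "(U (Suc m) x has_vector_derivative R (Suc m) x s) (at s within {0..t+1})" if "s \<in> {0..t+1}" for m s
        by (rule has_vector_derivative_within_subset[OF adm(2)]) (use that x in auto)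
      show "(\<lambda>m. U (Suc m) x s) \<longlonglongrightarrow> u x s" if "s \<in> {0..t+1}" for s
        using ul[OF x, of s] that by (intro LIMSEQ_Suc) auto
    qed (use t in auto)
    moreover have "at t within {0..t+1} = at t within {0..}"
      by (rule at_within_nhd[where S = "{..<t+1}"]) auto
    ultimately show "(u x has_vector_derivative q x t) (at t within {0..})" by simp
  next
    fix x t :: real and i assume "x \<in> {0..1}" "0 < t"
    show "q x t $ i = f x t (u x t) $ i - lam x t $ i * p x t $ i" by (simp add: q_def)
  next
    fix i and t :: real assume t: "0 < t"
    \<comment> \<open>Only partial derivatives of \<open>h\<close> are given; continuity in
      \<open>z\<close> comes from the continuous gradient.\<close>
    have "continuous_on UNIV (\<lambda>z. h t z $ i)"
      using has_derivative_grad[where F = "\<lambda>z. h t z $ i"] h_dz t continuous_on_comps(7)[of UNIV "\<lambda>_. 0" "\<lambda>_. t" "\<lambda>y. y" i]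
      by (intro continuous_at_imp_continuous_on ballI has_derivative_continuous[where f' = "(\<bullet>) (gh i t _)"])
        (auto simp: gh_def continuous_on_const continuous_on_id)
    then have "isCont (\<lambda>z. h t z $ i) (outflow e u t)" by (simp add: continuous_on_eq_continuous_at)
    moreover have "(\<lambda>m. outflow e (U m) t) \<longlonglongrightarrow> outflow e u t"
      by (rule vec_tendstoI) (auto intro!: tendsto_vec_nth ul less_imp_le[OF t])
    ultimately have "(\<lambda>m. h t (outflow e (U m) t) $ i) \<longlonglongrightarrow> h t (outflow e u t) $ i"
      by (rule isCont_tendsto_compose)
    moreover have "(\<lambda>m. U (Suc m) (e i) t $ i) \<longlonglongrightarrow> u (e i) t $ i"
      by (intro tendsto_vec_nth LIMSEQ_Suc ul) (use t in auto)
    moreover have "(\<lambda>m. U (Suc m) (e i) t $ i) = (\<lambda>m. h t (outflow e (U m) t) $ i)"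
      by (rule ext) (rule evolvesD(6)[OF ev t])
    ultimately show "u (e i) t $ i = h t (outflow e u t) $ i" using LIMSEQ_unique by metis
  next
    fix x :: real assume x: "x \<in> {0..1}"
    have "(\<lambda>m. U m x 0) = (\<lambda>_. phi x)" using U0[OF x] by auto
    then show "u x 0 = phi x" using LIMSEQ_unique[OF ul[OF x order_refl]] by auto
  qed (fact pc qc)+
  then show ?thesis by blast
qed

section \<open>Fixed points of the step and classical solutions\<close>

lemma outflow_eq_glue:
  assumes "\<And>i. e i = (if num i \<le> k then 1 else 0)"
  shows "outflow e u t = glue num k (u 0 t) (u 1 t)"
  using assms by (simp add: vec_eq_iff glue_def)

text \<open>The problem states the equation in the open strip and the initial condition on the open
  interval. Continuity in \<open>x\<close> carries both to \<open>x = 0\<close> and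
  \<open>x = 1\<close>; the uniqueness estimate uses the equation at the outflow end.\<close>

lemma classical_solution_imp_evolves:
  assumes en: "\<And>i. e i = (if num i \<le> k then 1 else 0)" and w: "classical_solution num k lam f phi h w"
  shows "evolves w w (dx w) (dt w)"
proof -
  note C = w[unfolded classical_solution_def]
  have w_x: "((\<lambda>x. w x t) has_vector_derivative dx w x t) (at x within {0..1})" if "x \<in> {0..1}" "0 \<le> t" for x t
    unfolding dx_def using C that by (intro C1_inD(1)) auto
  have w_t: "(w x has_vector_derivative dt w x t) (at t within {0..})" if "x \<in> {0..1}" "0 \<le> t" for x t
    unfolding dt_def using C1_inD(1)[of "{0..}" "{0..1}" "\<lambda>t x. w x t" t x] C that by auto
  have dxc: "strip_cont {0..} (dx w)"
    unfolding dx_def using C by (intro C1_inD(2)) auto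
  have dtc: "strip_cont {0..} (dt w)"
    unfolding dt_def using C by (intro continuous_on_swap_args[OF C1_inD(2)]) auto
  have wc: "strip_cont {0..} w"
    by (rule continuous_on_of_partials[OF _ w_x w_t dtc]) auto
  have slice: "continuous_on {0..1} (\<lambda>x. g x t)" if "strip_cont {0..} g" "0 \<le> t"
    for g :: "real \<Rightarrow> real \<Rightarrow> real ^ 'n" and t
  proof -
    have "continuous_on {0..1} (\<lambda>x. (\<lambda>(x, t). g x t) (x, t))"
      by (rule continuous_on_compose2[OF that(1)]) (use that(2) in \<open>auto intro!: continuous_intros\<close>)
    then show ?thesis by simp
  qed
  have pde: "dt w x t $ i = f x t (w x t) $ i - lam x t $ i * dx w x t $ i" if "x \<in> {0..1}" "0 < t" for x t i
  proof (rule continuous_eq_on_unit_interval[OF _ _ _ that(1)])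
    note s = slice[OF wc less_imp_le[OF that(2)]] slice[OF dxc less_imp_le[OF that(2)]] slice[OF dtc less_imp_le[OF that(2)]]
    show "continuous_on {0..1} (\<lambda>x. dt w x t $ i)" by (intro continuous_intros s)
    show "continuous_on {0..1} (\<lambda>x. f x t (w x t) $ i - lam x t $ i * dx w x t $ i)"
      by (intro continuous_intros continuous_on_comps s) (use that in auto)
    show "dt w x t $ i = f x t (w x t) $ i - lam x t $ i * dx w x t $ i" if "0 < x" "x < 1" for x
    proof -
      have "(x, t) \<in> Pi_dom" using that \<open>0 < t\<close> by (simp add: Pi_dom_def)
      then have "dt w x t $ i + lam x t $ i * dx w x t $ i = f x t (w x t) $ i" using C by fast
      then show ?thesis by linarith
    qed
  qed
  have bc: "w (e i) t $ i = h t (outflow e w t) $ i" if "0 < t" for i t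
    using C that en[of i] unfolding outflow_eq_glue[OF en] by (cases "num i \<le> k") auto
  have "w x 0 = phi x" if "x \<in> {0..1}" for x
  proof (rule continuous_eq_on_unit_interval[OF slice[OF wc order_refl] _ _ that])
    show "continuous_on {0..1} phi"
      unfolding continuous_on_eq_continuous_within using has_vector_derivative_continuous[OF phi_deriv] by blast
  qed (use C in auto)
  then show ?thesis unfolding evolves_def using w_x w_t dxc dtc pde bc by blast
qed

lemma evolves_imp_classical_solution:
  assumes en: "\<And>i. e i = (if num i \<le> k then 1 else 0)" and u: "evolves u u p q"
  shows "classical_solution num k lam f phi h u"
proof -
  note U = evolvesD[OF u]
  have dx: "dx u x t = p x t" if "x \<in> {0..1}" "0 \<le> t" for x t
    unfolding dx_def using at_within_unit_neq_bot[OF that(1)] U(1)[OF that] by (rule vector_derivative_within)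
  have dt: "dt u x t = q x t" if "x \<in> {0..1}" "0 \<le> t" for x t
    unfolding dt_def using at_within_atLeast_neq_bot[OF that(2)] U(2)[OF that] by (rule vector_derivative_within)
  show ?thesis
    unfolding classical_solution_def
  proof (intro conjI allI ballI impI)
    show "C1_in {0..1} {0..} u"
      by (rule C1_inI[OF _ U(3)]) (use U(1) at_within_unit_neq_bot in auto)
    show "C1_in {0..} {0..1} (\<lambda>t x. u x t)"
      by (rule C1_inI[OF _ continuous_on_swap_args[OF U(4)]]) (use U(2) at_within_atLeast_neq_bot in auto)
    show "case z of (x, t) \<Rightarrow> \<forall>i. dt u x t $ i + lam x t $ i * dx u x t $ i = f x t (u x t) $ i" if z: "z \<in> Pi_dom" for z
      using z U(5) by (auto simp: Pi_dom_def dx dt)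
    show "u x 0 = phi x" if "x \<in> {0<..<1}" for x using U(7) that by auto
    show "u 0 t $ i = h t (glue num k (u 0 t) (u 1 t)) $ i" if "t \<in> {0<..}" "k + 1 \<le> num i" for i t
      using U(6)[of t i] that en[of i] by (simp add: outflow_eq_glue[OF en])
    show "u 1 t $ i = h t (glue num k (u 0 t) (u 1 t)) $ i" if "t \<in> {0<..}" "num i \<le> k" for i t
      using U(6)[of t i] that en[of i] by (simp add: outflow_eq_glue[OF en])
  qed
qed

end

lemma bounded_image_family:
  fixes g :: "'i::finite \<Rightarrow> 'a \<Rightarrow> 'b::real_normed_vector"
  assumes "\<And>i. bounded (g i ` A)"
  shows "\<exists>K. \<forall>i. \<forall>a\<in>A. norm (g i a) \<le> K"
proof -
  have "bounded (\<Union>i. g i ` A)" using assms by (intro bounded_UN) auto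
  then obtain K where "\<forall>b\<in>(\<Union>i. g i ` A). norm b \<le> K" unfolding bounded_iff by blast
  then show ?thesis by (intro exI[of _ K]) auto
qed

theorem theorem2p1:
  fixes num :: "'n::finite \<Rightarrow> nat"
    and k :: nat
    and lam :: "real \<Rightarrow> real \<Rightarrow> real ^ 'n"
    and f :: "real \<Rightarrow> real \<Rightarrow> real ^ 'n \<Rightarrow> real ^ 'n"
    and phi :: "real \<Rightarrow> real ^ 'n"
    and h :: "real \<Rightarrow> real ^ 'n \<Rightarrow> real ^ 'n"
  assumes num: "bij_betw num UNIV {1..CARD('n)}"
    and k: "1 \<le> k" "k \<le> CARD('n)"
    and lam_neg: "\<And>i x t. num i \<le> k \<Longrightarrow> (x, t) \<in> Pi_bar \<Longrightarrow> lam x t $ i < 0"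
    and lam_pos: "\<And>i x t. k + 1 \<le> num i \<Longrightarrow> (x, t) \<in> Pi_bar \<Longrightarrow> lam x t $ i > 0"
    and lam_cont: "continuous_on Pi_bar (\<lambda>(x, t). lam x t)"
    and f_cont: "continuous_on (Pi_bar \<times> UNIV) (\<lambda>((x, t), y). f x t y)"
    and lam_C1: "C1_in {0..1} {0..} lam"
    and phi_C1: "phi differentiable_on {0..1}"
      "continuous_on {0..1} (\<lambda>x. vector_derivative phi (at x within {0..1}))"
    and f_C1_x: "C1_in {0..1} ({0..} \<times> UNIV) (\<lambda>x (t, y). f x t y)"
    and f_C1_y: "\<And>i. C1_in_vec Pi_bar (\<lambda>(x, t) y. f x t y $ i)"
    and h_C1_t: "C1_in {0..} UNIV h"
    and h_C1_z: "\<And>i. C1_in_vec {0..} (\<lambda>t z. h t z $ i)"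
    and f_grad_bdd: "\<And>K i. compact K \<Longrightarrow> K \<subseteq> Pi_bar \<Longrightarrow>
      bounded ((\<lambda>((x, t), y). grad (\<lambda>y. f x t y $ i) y) ` (K \<times> UNIV))"
    and h_grad_bdd: "\<And>K i. compact K \<Longrightarrow> K \<subseteq> {0..} \<Longrightarrow>
      bounded ((\<lambda>(t, z). grad (\<lambda>z. h t z $ i) z) ` (K \<times> UNIV))"
    and compat0: "zero_order_compat num k phi h"
    and compat1: "first_order_compat num k lam f phi h"
  shows "\<exists>u. classical_solution num k lam f phi h u \<and>
    (\<forall>w. classical_solution num k lam f phi h w \<longrightarrow> (\<forall>(x, t)\<in>Pi_bar. w x t = u x t))"
proof -
  \<comment> \<open>Components with \<open>num i \<le> k\<close> have negative speed and enter at
    \<open>x = 1\<close>, the others at \<open>x = 0\<close>.\<close>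
  define e where "e = (\<lambda>i. if num i \<le> k then 1 else 0 :: real)"
  have en: "e i = (if num i \<le> k then 1 else 0)" for i by (simp add: e_def)
  have glue_e: "(\<chi> j. g (1 - e j) $ j) = glue num k (g 0) (g 1)" for g :: "real \<Rightarrow> real ^ 'n"
    by (simp add: vec_eq_iff glue_def en)
  interpret hyperbolic_problem e lam "dx lam" f "\<lambda>x t y. vector_derivative (\<lambda>x. f x t y) (at x within {0..1})"
    phi "\<lambda>x. vector_derivative phi (at x within {0..1})" h "\<lambda>t z. vector_derivative (\<lambda>t. h t z) (at t within {0..})"
  proof
    show "e i = 0 \<or> e i = 1" for i by (simp add: en)
    show "strip_cont {0..} lam" using lam_cont by (simp add: Pi_bar_def)
    show "strip_cont {0..} (dx lam)" unfolding dx_def by (rule C1_inD(2)[OF lam_C1])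
    show "((\<lambda>x. lam x t) has_vector_derivative dx lam x t) (at x within {0..1})" if "x \<in> {0..1}" "0 \<le> t" for x t
      unfolding dx_def using that by (intro C1_inD(1)[OF lam_C1]) auto
    show "0 < (1 - 2 * e i) * lam x t $ i" if "x \<in> {0..1}" "0 \<le> t" for i x t
      using lam_neg[of i x t] lam_pos[of i x t] that by (cases "num i \<le> k") (auto simp: en Pi_bar_def)
    show "continuous_on (({0..1} \<times> {0..}) \<times> UNIV) (\<lambda>((x, t), y). f x t y)" using f_cont by (simp add: Pi_bar_def)
    have "continuous_on (({0..1} \<times> {0..}) \<times> UNIV)
        (\<lambda>z. (\<lambda>(s, p). vector_derivative (\<lambda>s. (\<lambda>(t, y). f s t y) p) (at s within {0..1})) (fst (fst z), (snd (fst z), snd z)))"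
      by (rule continuous_on_compose2[OF C1_inD(2)[OF f_C1_x]]) (auto intro!: continuous_intros)
    then show "continuous_on (({0..1} \<times> {0..}) \<times> UNIV) (\<lambda>((x, t), y). vector_derivative (\<lambda>x. f x t y) (at x within {0..1}))"
      by (simp add: case_prod_unfold)
    show "((\<lambda>x. f x t y) has_vector_derivative vector_derivative (\<lambda>x. f x t y) (at x within {0..1})) (at x within {0..1})"
      if "x \<in> {0..1}" "0 \<le> t" for x t y
      using C1_inD(1)[OF f_C1_x that(1), of "(t, y)"] that by simp
    show "(\<lambda>s. f x t (y + s *\<^sub>R axis j 1) $ i) differentiable at 0" if "x \<in> {0..1}" "0 \<le> t" for i x t y j
      using bspec[OF conjunct1[OF f_C1_y[of i, unfolded C1_in_vec_def]], of "(x, t)"] that by (simp add: Pi_bar_def)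
    show "continuous_on (({0..1} \<times> {0..}) \<times> UNIV) (\<lambda>((x, t), y). grad (\<lambda>y. f x t y $ i) y)" for i
      using f_C1_y[of i] by (simp add: C1_in_vec_def Pi_bar_def case_prod_unfold)
    show "\<exists>K. \<forall>i x t y. x \<in> {0..1} \<longrightarrow> 0 \<le> t \<longrightarrow> t \<le> T \<longrightarrow> norm (grad (\<lambda>y. f x t y $ i) y) \<le> K" for T
    proof -
      have "\<exists>K. \<forall>i. \<forall>z\<in>({0..1} \<times> {0..T}) \<times> UNIV. norm ((\<lambda>((x, t), y). grad (\<lambda>y. f x t y $ i) y) z) \<le> K"
        by (intro bounded_image_family f_grad_bdd compact_Times) (auto simp: Pi_bar_def)
      then show ?thesis by fastforce
    qed
    show "((\<lambda>t. h t z) has_vector_derivative vector_derivative (\<lambda>t. h t z) (at t within {0..})) (at t within {0..})"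
      if "0 \<le> t" for t z
      using that by (intro C1_inD(1)[OF h_C1_t]) auto
    show "continuous_on ({0..} \<times> UNIV) (\<lambda>(t, z). vector_derivative (\<lambda>t. h t z) (at t within {0..}))"
      by (rule C1_inD(2)[OF h_C1_t])
    show "(\<lambda>s. h t (z + s *\<^sub>R axis j 1) $ i) differentiable at 0" if "0 \<le> t" for i t z j
      using h_C1_z[of i] that by (simp add: C1_in_vec_def)
    show "continuous_on ({0..} \<times> UNIV) (\<lambda>(t, z). grad (\<lambda>z. h t z $ i) z)" for i
      using h_C1_z[of i] by (simp add: C1_in_vec_def)
    show "\<exists>K. \<forall>i t z. 0 \<le> t \<longrightarrow> t \<le> T \<longrightarrow> norm (grad (\<lambda>z. h t z $ i) z) \<le> K" for T
    proof -
      have "\<exists>K. \<forall>i. \<forall>p\<in>{0..T} \<times> UNIV. norm ((\<lambda>(t, z). grad (\<lambda>z. h t z $ i) z) p) \<le> K"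
        by (intro bounded_image_family h_grad_bdd) auto
      then show ?thesis by fastforce
    qed
    show "(phi has_vector_derivative vector_derivative phi (at x within {0..1})) (at x within {0..1})" if "x \<in> {0..1}" for x
      using phi_C1(1) that by (simp add: differentiable_on_def vector_derivative_works[symmetric])
    show "continuous_on {0..1} (\<lambda>x. vector_derivative phi (at x within {0..1}))" by (rule phi_C1(2))
    show "phi (e i) $ i = h 0 (\<chi> j. phi (1 - e j) $ j) $ i" for i
      using compat0 unfolding glue_e zero_order_compat_def Let_def by (cases "num i \<le> k") (auto simp: en)
    have d: "(\<chi> j. f (1 - e j) 0 (phi (1 - e j)) $ j - lam (1 - e j) 0 $ j * vector_derivative phi (at (1 - e j) within {0..1}) $ j)
        = glue num k (initial_dt lam f phi 0) (initial_dt lam f phi 1)"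
      by (simp add: vec_eq_iff glue_def en initial_dt_def)
    show "f (e i) 0 (phi (e i)) $ i - lam (e i) 0 $ i * vector_derivative phi (at (e i) within {0..1}) $ i =
      vector_derivative (\<lambda>t. h t (\<chi> j. phi (1 - e j) $ j)) (at 0 within {0..}) $ i +
      grad (\<lambda>z. h 0 z $ i) (\<chi> j. phi (1 - e j) $ j) \<bullet>
        (\<chi> j. f (1 - e j) 0 (phi (1 - e j)) $ j - lam (1 - e j) 0 $ j * vector_derivative phi (at (1 - e j) within {0..1}) $ j)" for i
      unfolding d glue_e using compat1 unfolding first_order_compat_def Let_def
      by (cases "num i \<le> k") (auto simp: en initial_dt_def)
  qed
  obtain u p q where u: "evolves u u p q" using evolves_exists by blast
  show ?thesis
  proof (intro exI conjI allI impI ballI)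
    show "classical_solution num k lam f phi h u" by (rule evolves_imp_classical_solution[OF en u])
    fix w z assume w: "classical_solution num k lam f phi h w" and z: "z \<in> Pi_bar"
    show "case z of (x, t) \<Rightarrow> w x t = u x t"
      using z evolves_unique[OF u classical_solution_imp_evolves[OF en w]] by (auto simp: Pi_bar_def)
  qed
qed

end
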